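(* Let $X=C_{0,l}(W)\sqcup_WY$ be a space with a conical singularity of dimension $n=m+1$ with metric $g_X$, where $(Y,W)$ is a compact connected oriented smooth Riemannian manifold of dimension $n$ with boundary $W$. Let $\rho:\pi_1(X)\to O(V)$ be an orthogonal representation on a $k$-dimensional real vector space $V$. Let $\mathfrak p=\mathfrak m$ or $\mathfrak p=\mathfrak m^c$. Then $$I^{\mathfrak p}\tau_{\rm RS}(X;V_\rho)=I^{\mathfrak p}\tau_{\rm RS}(C_{0,l}(W);V_\rho)\;\tau_{\rm RS}(Y,W;V_\rho)\;\tau_{\rm R}\big(I^{\mathfrak p}\ddot{\mathcal H};I^{\mathfrak p}\mathcal A_{{\rm abs},\bullet}(I^{\mathfrak p}a_{C,\bullet}),I^{\mathfrak p}\mathcal A_\bullet(I^{\mathfrak p}a_{X,\bullet}),\mathcal A_{Y,{\rm rel},\bullet}(a_{Y,{\rm rel},\bullet})\big),$$ where $I^{\mathfrak p}a_{C,q}$, $I^{\mathfrak p}a_{X,q}$, $a_{Y,{\rm rel},q}$ are orthonormal bases of $\mathcal H^q_{\rm abs,\mathfrak p}(C_{0,l}(W),V_\rho)$, $\mathcal H^q_{\mathfrak p}(X,V_\rho)$, $\mathcal H^q_{\rm rel}(Y,V_\rho)$ respectively, $I^{\mathfrak p}\mathcal A_{{\rm abs},q}$, $I^{\mathfrak p}\mathcal A_q$, $\mathcal A_{Y,{\rm rel},q}$ are the corresponding De Rham maps, and $I^{\mathfrak p}\ddot{\mathcal H}$ is the long exact sequence $$\dots\to I^{\mathfrak p}H_q(C_{0,l}(W);V_\rho)\to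 I^{\mathfrak p}H_q(X;V_\rho)\to H_q(Y,W;V_\rho)\to\dots .$$
   Context: Space. $(W,\tilde g)$ is a compact connected oriented Riemannian manifold without boundary, $m=\dim W$, $l>0$, $h(x)=xH(x)$ with $H$ smooth and non-vanishing on $[0,l]$, $H(0)=1$. $C=C_{0,l}(W)=(0,l]\times W$ has metric $dx\otimes dx+h(x)^2\tilde g$. $X=C_{0,l}(W)\sqcup_WY$ (plus the cone tip, topologically), $Y$ having boundary isometric to $(W,h(l)^2\tilde g)$, the union and metric being smooth along $W$. Forms take values in the flat bundle of $\rho$; $\tilde\Delta^{(q)}$ is the Hodge-Laplace operator on $q$-forms on $W$. Perversities: $\mathfrak m_j=[j/2]-1$, $\mathfrak m^c_j=j-2-\mathfrak m_j$ ($2\le j\le n$); $\mathfrak a=n-\mathfrak p_n$. Harmonic forms. Let $\alpha_q=\frac12(1+2q-m)$. On the cone write a $q$-form $\omega=\omega_1+dx\wedge\omega_2$, $u_1=h^{\frac12-\alpha_q}\omega_1$, $u_2=h^{\frac12-\alpha_{q-1}}\omega_2$. Decompose $u_1$ (resp. $u_2$) along eigenspaces of $\tilde\Delta^{(q)}$ with eigenvalue $\tilde\lambda_1$ (resp. of $\tilde\Delta^{(q-1)}$, eigenvalue $\tilde\lambda_2$), $\nu_1=\sqrt{\tilde\lambda_1+\alpha_q^2}$, $\nu_2=\sqrt{\tilde\lambda_2+\alpha_{q-2}^2}$. For $\nu\ge0$, $\alpha\in\mathbb R$ let $\mathfrak u_+=x^{\frac12+\nu}\varphi_+$ ($\varphi_+$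 continuous on $[0,l]$, $\varphi_+(0)=1$) be the solution of $-u''-(\alpha-\frac12)\frac{h''}{h}u+(\alpha^2-\frac14)\frac{h'^2}{h^2}u+\frac{\nu^2-\alpha^2}{h^2}u=0$, with $\alpha=\alpha_q$ for $u_1$, $\alpha=-\alpha_{q-2}$ for $u_2$, and $BV_{\nu,+}(u)=\lim_{x\to0^+}(\mathfrak u_+u'-\mathfrak u_+'u)$. Tip conditions for $\mathfrak p$: $BV_{\nu_j,+}(u_j)=0$ for every component with $\nu_j<1$, except that, if $m=2p$: for $\mathfrak p=\mathfrak m^c$ in degree $p+1$ the component of $u_2$ along harmonic forms of $W$ satisfies instead $\lim_{x\to0^+}u_2'(x)=0$; for $\mathfrak p=\mathfrak m$ in degree $p$ the component of $u_1$ along harmonic forms of $W$ satisfies instead $\lim_{x\to0^+}u_1'(x)=0$. $\mathcal H^q_{\mathfrak p}(X,V_\rho)$ (resp. $\mathcal H^q_{\rm abs,\mathfrak p}(C,V_\rho)$) is the kernel of the restriction of the maximal $L^2$ extension of the Hodge-Laplace operator on $X$ (resp. on $C$) to forms satisfying the tip conditions (resp. the tip conditions and $\omega_2(l)=0$, $\omega_1'(l)=0$); $\mathcal H^q_{\rm rel}(Y,V_\rho)$ are the usual harmonic forms on $Y$ with relative boundary conditions. Intersection complexes. Let $K=M\sqcup_NC(N)$ be a coherent cellular decomposition of $X$ ($M$ a regular cellular decomposition of $Y$, $N$ its restriction to $W$, $C(N)$ the cone complex). $I^{\mathfrak p}K_{(q)}=M_{(q)}$ (skeleton) for $q<\mathfrak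 a$, $=K_{(q)}$ for $q\ge\mathfrak a$; $I^{\mathfrak p}C_q(K)=H_q(I^{\mathfrak p}K_{(q)},I^{\mathfrak p}K_{(q-1)})$ with the boundary of the filtration, formed on the universal cover and tensored with $V$ over $\rho$; similarly for $C(N)$ with $M$ replaced by $N$. Homologies: $I^{\mathfrak p}H_q(X;V_\rho)$, $I^{\mathfrak p}H_q(C;V_\rho)$. Chain bases (lifted cells tensored with an orthonormal basis of $V$): cells of $M$ (resp. $N$) for $q<\mathfrak a$; for $q=\mathfrak a$ the $\mathfrak a$-cells of $M$ (resp. $N$) and the cones over a $\mathbb Z$-basis of the cellular cycles $Z_{\mathfrak a-1}(N;\mathbb Z)$; cells of $K$ (resp. $C(N)$) for $q>\mathfrak a$. De Rham maps. Each sends $\omega$ to the homology class corresponding (up to sign) under Poincaré duality ($I^{\mathfrak p}H_q(X)\cong I^{\mathfrak p^c}H^{n-q}(X)$, $I^{\mathfrak p}H_q(C)\cong I^{\mathfrak p^c}H^{n-q}(C,W)$, $H_q(Y,W)\cong H^{n-q}(Y)$, dual cells) to the class of $c\mapsto\int_c\star\omega$. Torsions. For a finite complex $D_\bullet$ of finite dimensional real vector spaces with bases $c_q$ of $D_q$, $h_q$ of $H_q$: $\tau_{\rm R}=\prod_q|\det(\partial_{q+1}(b_{q+1})\hat h_qb_q/c_q)|^{(-1)^q}$, where $b_q\subset D_q$ is mapped bijectively by $\partial_q$ onto a basis of ${\rm im}\,\partial_q$, $\hat h_q$ lifts $h_q$, $(y/x)$ is the change of basis matrix. $I^{\mathfrak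 p}\tau_{\rm RS}(X;V_\rho)$, $I^{\mathfrak p}\tau_{\rm RS}(C;V_\rho)$, $\tau_{\rm RS}(Y,W;V_\rho)$ are the R torsions of $I^{\mathfrak p}C_\bullet(K;V_\rho)$, $I^{\mathfrak p}C_\bullet(C(N);V_\rho)$ and the cellular complex $C_\bullet(M,N;V_\rho)$ (cell basis), with homology bases the De Rham images of orthonormal bases of the harmonic forms. The long exact sequence is an acyclic complex with $H_q(Y,W)$ in degree $3q$, $I^{\mathfrak p}H_q(X)$ in degree $3q+1$, $I^{\mathfrak p}H_q(C)$ in degree $3q+2$. *)

theory Defs
  imports
    "HOL-Analysis.Analysis"
    "HOL-Analysis.Finite_Function_Topology"
    "Jordan_Normal_Form.Determinant"
begin

section \<open>Torsion of complexes of real vector spaces\<close>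

text \<open>A complex of real vector spaces, in which the space in degree \<open>q\<close> is the quotient
  \<open>num q / den q\<close> of two subspaces of one ambient space and \<open>dif q\<close> induces the map from
  degree \<open>q\<close> to degree \<open>q - 1\<close>. Chain complexes have \<open>den q = {0}\<close>; the general form is used
  for long exact sequences, whose terms are homology groups. Lists of vectors of
  \<open>num q / den q\<close> are given by representatives.\<close>

record 's qcomplex =
  num :: "nat \<Rightarrow> 's set"
  den :: "nat \<Rightarrow> 's set"
  dif :: "nat \<Rightarrow> 's \<Rightarrow> 's"
  top_deg :: nat

definition cycles :: "'s::real_vector qcomplex \<Rightarrow> nat \<Rightarrow> 's set" where
  "cycles D q = {z \<in> num D q. q = 0 \<or> dif D q z \<in> den D (q - 1)}"

definition boundaries :: "'s::real_vector qcomplex \<Rightarrow> nat \<Rightarrow> 's set" where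
  "boundaries D q = {dif D (Suc q) y + r |y r. y \<in> num D (Suc q) \<and> r \<in> den D q}"

definition basis_mod :: "'s::real_vector set \<Rightarrow> 's set \<Rightarrow> 's list \<Rightarrow> bool" where
  "basis_mod Z B xs \<longleftrightarrow>
     subspace Z \<and> subspace B \<and> B \<subseteq> Z \<and> set xs \<subseteq> Z \<and>
     (\<forall>z\<in>Z. \<exists>c. z - (\<Sum>i<length xs. c i *\<^sub>R xs ! i) \<in> B) \<and>
     (\<forall>c. (\<Sum>i<length xs. c i *\<^sub>R xs ! i) \<in> B \<longrightarrow> (\<forall>i<length xs. c i = 0))"

definition homology_basis :: "'s::real_vector qcomplex \<Rightarrow> nat \<Rightarrow> 's list \<Rightarrow> bool" where
  "homology_basis D q xs \<longleftrightarrow> basis_mod (cycles D q) (boundaries D q) xs"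

definition coords_mod :: "'s::real_vector set \<Rightarrow> 's list \<Rightarrow> 's \<Rightarrow> nat \<Rightarrow> real" where
  "coords_mod B xs y = (SOME c. y - (\<Sum>i<length xs. c i *\<^sub>R xs ! i) \<in> B)"

definition det_change :: "'s::real_vector set \<Rightarrow> 's list \<Rightarrow> 's list \<Rightarrow> real" where
  "det_change B ys xs =
     Determinant.det (Matrix.mat (length xs) (length xs) (\<lambda>(i, j). coords_mod B xs (ys ! i) j))"

text \<open>\<open>c q\<close> is a basis in degree \<open>q\<close>; \<open>h q\<close> consists of cycles representing a basis of the
  homology in degree \<open>q\<close>, so that it serves as its own lift.\<close>

definition has_R_torsion ::
  "'s::real_vector qcomplex \<Rightarrow> (nat \<Rightarrow> 's list) \<Rightarrow> (nat \<Rightarrow> 's list) \<Rightarrow> real \<Rightarrow> bool" where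
  "has_R_torsion D c h t \<longleftrightarrow>
     (\<exists>b. b 0 = [] \<and>
          (\<forall>q. set (b q) \<subseteq> num D q) \<and>
          (\<forall>q. basis_mod (boundaries D q) (den D q) (map (dif D (Suc q)) (b (Suc q)))) \<and>
          t = (\<Prod>q\<le>top_deg D.
                 \<bar>det_change (den D q) (map (dif D (Suc q)) (b (Suc q)) @ h q @ b q) (c q)\<bar>
                   powi ((-1) ^ q)))"

definition R_torsion ::
  "'s::real_vector qcomplex \<Rightarrow> (nat \<Rightarrow> 's list) \<Rightarrow> (nat \<Rightarrow> 's list) \<Rightarrow> real" where
  "R_torsion D c h = (THE t. has_R_torsion D c h t)"


section \<open>Smooth maps and oriented Riemannian manifolds\<close>

text \<open>Derivatives are taken within \<open>S\<close>, so that the notion makes sense on intervals and on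
  (relatively open subsets of) half spaces, including their boundary points.\<close>

primrec Ck_on ::
  "nat \<Rightarrow> ('a::euclidean_space \<Rightarrow> 'b::real_normed_vector) \<Rightarrow> 'a set \<Rightarrow> bool" where
  "Ck_on 0 f S \<longleftrightarrow> continuous_on S f"
| "Ck_on (Suc k) f S \<longleftrightarrow>
     (\<forall>x\<in>S. f differentiable (at x within S)) \<and>
     (\<forall>v. Ck_on k (\<lambda>x. frechet_derivative f (at x within S) v) S)"

definition smooth_on :: "('a::euclidean_space \<Rightarrow> 'b::real_normed_vector) \<Rightarrow> 'a set \<Rightarrow> bool" where
  "smooth_on f S \<longleftrightarrow> (\<forall>k. Ck_on k f S)"

type_synonym ('x, 'e) chart = "'x set \<times> ('x \<Rightarrow> 'e)"

text \<open>Tensors at a point are given by their expressions in all charts of the atlas; an argument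
  list of \<open>q\<close> tangent vectors is a function on \<open>nat\<close> of which only the values below \<open>q\<close> matter.
  An orientation is recorded by its Riemannian volume form \<open>volf\<close>.\<close>

record ('x, 'e) riemannian =
  pts :: "'x set"
  atlas :: "('x, 'e) chart set"
  metric :: "('x, 'e) chart \<Rightarrow> 'x \<Rightarrow> 'e \<Rightarrow> 'e \<Rightarrow> real"
  volf :: "('x, 'e) chart \<Rightarrow> 'x \<Rightarrow> (nat \<Rightarrow> 'e) \<Rightarrow> real"

definition trans_deriv ::
  "('x, 'e::euclidean_space) chart \<Rightarrow> ('x, 'e) chart \<Rightarrow> 'x \<Rightarrow> 'e \<Rightarrow> 'e" where
  "trans_deriv c c' x = frechet_derivative (snd c' \<circ> inv_into (fst c) (snd c)) (at (snd c x))"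

definition alt_form :: "nat \<Rightarrow> ((nat \<Rightarrow> 'e::real_vector) \<Rightarrow> 'v::real_vector) \<Rightarrow> bool" where
  "alt_form q f \<longleftrightarrow>
     (\<forall>v w. (\<forall>i<q. v i = w i) \<longrightarrow> f v = f w) \<and>
     (\<forall>v. \<forall>i<q. linear (\<lambda>x. f (v(i := x)))) \<and>
     (\<forall>v. \<forall>i<q. \<forall>j<q. i \<noteq> j \<and> v i = v j \<longrightarrow> f v = 0)"

definition smooth_atlas ::
  "'x::topological_space set \<Rightarrow> ('x, 'e::euclidean_space) chart set \<Rightarrow> bool" where
  "smooth_atlas P A \<longleftrightarrow>
     (\<Union>c\<in>A. fst c) = P \<and>
     (\<forall>(U, \<phi>)\<in>A. open U \<and> open (\<phi> ` U) \<and> homeomorphism U (\<phi> ` U) \<phi> (inv_into U \<phi>)) \<and>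
     (\<forall>(U, \<phi>)\<in>A. \<forall>(V, \<psi>)\<in>A. smooth_on (\<psi> \<circ> inv_into U \<phi>) (\<phi> ` (U \<inter> V)))"

definition orthonormal_frame ::
  "('x, 'e::euclidean_space) riemannian \<Rightarrow> ('x, 'e) chart \<Rightarrow> 'x \<Rightarrow> (nat \<Rightarrow> 'e) \<Rightarrow> bool" where
  "orthonormal_frame M c x e \<longleftrightarrow>
     (\<forall>i<DIM('e). \<forall>j<DIM('e). metric M c x (e i) (e j) = (if i = j then 1 else 0))"

definition oriented_riemannian ::
  "('x::topological_space, 'e::euclidean_space) riemannian \<Rightarrow> bool" where
  "oriented_riemannian M \<longleftrightarrow>
     open (pts M) \<and> smooth_atlas (pts M) (atlas M) \<and>
     (\<forall>c\<in>atlas M.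
        (\<forall>x\<in>fst c. bilinear (metric M c x) \<and>
           (\<forall>v w. metric M c x v w = metric M c x w v) \<and>
           (\<forall>v. v \<noteq> 0 \<longrightarrow> metric M c x v v > 0) \<and>
           alt_form DIM('e) (volf M c x) \<and>
           (\<forall>e. orthonormal_frame M c x e \<longrightarrow> \<bar>volf M c x e\<bar> = 1)) \<and>
        (\<forall>v w. smooth_on (\<lambda>y. metric M c (inv_into (fst c) (snd c) y) v w) (snd c ` fst c)) \<and>
        (\<forall>v. smooth_on (\<lambda>y. volf M c (inv_into (fst c) (snd c) y) v) (snd c ` fst c))) \<and>
     (\<forall>c\<in>atlas M. \<forall>c'\<in>atlas M. \<forall>x\<in>fst c \<inter> fst c'.
        (\<forall>v w. metric M c x v w = metric M c' x (trans_deriv c c' x v) (trans_deriv c c' x w)) \<and>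
        (\<forall>v. volf M c x v = volf M c' x (\<lambda>i. trans_deriv c c' x (v i))))"

definition basis_frame :: "nat \<Rightarrow> 'e::euclidean_space" where
  "basis_frame = (SOME b. bij_betw b {..<DIM('e)} Basis)"

text \<open>The Riemannian measure has density
  \<open>sqrt (det g) = \<bar>volf (\<partial>\<^sub>1, \<dots>, \<partial>\<^sub>n)\<bar>\<close> in every chart.\<close>

definition riem_measure ::
  "('x::topological_space, 'e::euclidean_space) riemannian \<Rightarrow> 'x measure" where
  "riem_measure M = (SOME \<mu>. sets \<mu> = sets borel \<and> emeasure \<mu> (- pts M) = 0 \<and>
     (\<forall>c\<in>atlas M. \<forall>A\<in>sets borel. A \<subseteq> fst c \<longrightarrow>
        emeasure \<mu> A =
          (\<integral>\<^sup>+y. ennreal \<bar>volf M c (inv_into (fst c) (snd c) y) basis_frame\<bar>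
                  * indicator (snd c ` A) y \<partial>lborel)))"


section \<open>Forms with values in a flat bundle\<close>

text \<open>A flat bundle over \<open>M\<close> is given by a regular covering \<open>cov\<close> with group \<open>grp\<close> of covering
  transformations and a representation \<open>act\<close> of this group. Its sections are the equivariant
  functions on the covering: a \<open>q\<close>-form assigns to a chart \<open>c\<close> of the base and a point \<open>u\<close> of
  the covering lying over the chart domain an alternating form on the tangent space at
  \<open>cov u\<close>. The covering may extend over points outside \<open>M\<close> (the cone tip).\<close>

record ('x, 'u, 'v) flat_bundle =
  cov :: "'u \<Rightarrow> 'x"
  grp :: "('u \<Rightarrow> 'u) set"
  act :: "('u \<Rightarrow> 'u) \<Rightarrow> 'v \<Rightarrow> 'v"

definition trivial_bundle :: "('x, 'x, 'v) flat_bundle" where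
  "trivial_bundle = \<lparr>cov = id, grp = {id}, act = (\<lambda>_. id)\<rparr>"

type_synonym ('x, 'u, 'e, 'v) form = "('x, 'e) chart \<Rightarrow> 'u \<Rightarrow> (nat \<Rightarrow> 'e) \<Rightarrow> 'v"

definition is_sheet ::
  "('x, 'u::topological_space, 'v) flat_bundle \<Rightarrow> ('x, 'e) chart \<Rightarrow> 'u set \<Rightarrow> bool" where
  "is_sheet B c Q \<longleftrightarrow> open Q \<and> inj_on (cov B) Q \<and> cov B ` Q \<subseteq> fst c"

definition sheet_at ::
  "('x, 'u::topological_space, 'v) flat_bundle \<Rightarrow> ('x, 'e) chart \<Rightarrow> 'u \<Rightarrow> 'u set" where
  "sheet_at B c u = (SOME Q. is_sheet B c Q \<and> u \<in> Q)"

definition local_coeff ::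
  "('x, 'u, 'v) flat_bundle \<Rightarrow> ('x, 'e) chart \<Rightarrow> 'u set \<Rightarrow> ('x, 'u, 'e, 'v) form
     \<Rightarrow> (nat \<Rightarrow> 'e) \<Rightarrow> 'e \<Rightarrow> 'v" where
  "local_coeff B c Q \<omega> v = (\<lambda>y. \<omega> c (inv_into Q (snd c \<circ> cov B) y) v)"

text \<open>Smooth forms on \<open>S\<close>, which is meant to be an open subset of \<open>M\<close> or a domain with smooth
  boundary; smoothness is up to the boundary points belonging to \<open>S\<close>.\<close>

definition is_form ::
  "('x, 'e::euclidean_space) riemannian \<Rightarrow>
   ('x, 'u::topological_space, 'v::euclidean_space) flat_bundle
     \<Rightarrow> 'x set \<Rightarrow> nat \<Rightarrow> ('x, 'u, 'e, 'v) form \<Rightarrow> bool" where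
  "is_form M B S q \<omega> \<longleftrightarrow>
     (\<forall>c\<in>atlas M. \<forall>u. cov B u \<in> fst c \<inter> S \<longrightarrow>
        alt_form q (\<omega> c u) \<and>
        (\<forall>\<sigma>\<in>grp B. \<forall>v. \<omega> c (\<sigma> u) v = act B \<sigma> (\<omega> c u v)) \<and>
        (\<forall>c'\<in>atlas M. cov B u \<in> fst c' \<longrightarrow>
           (\<forall>v. \<omega> c u v = \<omega> c' u (\<lambda>i. trans_deriv c c' (cov B u) (v i))))) \<and>
     (\<forall>c\<in>atlas M. \<forall>Q v. is_sheet B c Q \<longrightarrow>
        smooth_on (local_coeff B c Q \<omega> v) (snd c ` (cov B ` Q \<inter> S)))"

definition forms_eq ::
  "('x, 'e) riemannian \<Rightarrow> ('x, 'u, 'v) flat_bundle \<Rightarrow> 'x set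
     \<Rightarrow> ('x, 'u, 'e, 'v) form \<Rightarrow> ('x, 'u, 'e, 'v) form \<Rightarrow> bool" where
  "forms_eq M B S \<omega> \<eta> \<longleftrightarrow>
     (\<forall>c\<in>atlas M. \<forall>u v. cov B u \<in> fst c \<inter> S \<longrightarrow> \<omega> c u v = \<eta> c u v)"

definition skip :: "nat \<Rightarrow> (nat \<Rightarrow> 'a) \<Rightarrow> nat \<Rightarrow> 'a" where
  "skip i v = (\<lambda>j. if j < i then v j else v (Suc j))"

definition ext_d ::
  "('x, 'u::topological_space, 'v::euclidean_space) flat_bundle
     \<Rightarrow> 'x set \<Rightarrow> nat \<Rightarrow> ('x, 'u, 'e::euclidean_space, 'v) form \<Rightarrow> ('x, 'u, 'e, 'v) form" where
  "ext_d B S q \<omega> = (\<lambda>c u v. \<Sum>i\<le>q. (-1) ^ i *\<^sub>R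
     frechet_derivative (local_coeff B c (sheet_at B c u) \<omega> (skip i v))
       (at (snd c (cov B u)) within snd c ` (cov B ` sheet_at B c u \<inter> S)) (v i))"

definition some_frame ::
  "('x, 'e::euclidean_space) riemannian \<Rightarrow> ('x, 'e) chart \<Rightarrow> 'x \<Rightarrow> nat \<Rightarrow> 'e" where
  "some_frame M c x = (SOME e. orthonormal_frame M c x e)"

definition subframe :: "(nat \<Rightarrow> 'e) \<Rightarrow> nat set \<Rightarrow> nat \<Rightarrow> 'e" where
  "subframe e I = (\<lambda>k. e (sorted_list_of_set I ! k))"

text \<open>Characterised by \<open>\<eta> \<and> \<star>\<omega> = \<langle>\<eta>, \<omega>\<rangle> vol\<close>: in an orthonormal frame \<open>e\<close>,
  \<open>\<star>\<omega> = (\<Sum>I. \<omega> (e\<^sub>I) vol (e\<^sub>I, \<cdot>))\<close>.\<close>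

definition hodge_star ::
  "('x, 'e::euclidean_space) riemannian \<Rightarrow> ('x, 'u, 'v::euclidean_space) flat_bundle
     \<Rightarrow> nat \<Rightarrow> ('x, 'u, 'e, 'v) form \<Rightarrow> ('x, 'u, 'e, 'v) form" where
  "hodge_star M B q \<omega> = (\<lambda>c u v. let e = some_frame M c (cov B u) in
     \<Sum>I | I \<subseteq> {..<DIM('e)} \<and> card I = q.
       volf M c (cov B u) (\<lambda>k. if k < q then subframe e I k else v (k - q))
         *\<^sub>R \<omega> c u (subframe e I))"

definition codiff ::
  "('x, 'e::euclidean_space) riemannian \<Rightarrow>
   ('x, 'u::topological_space, 'v::euclidean_space) flat_bundle
     \<Rightarrow> 'x set \<Rightarrow> nat \<Rightarrow> ('x, 'u, 'e, 'v) form \<Rightarrow> ('x, 'u, 'e, 'v) form" where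
  "codiff M B S q \<omega> = (\<lambda>c u v. if q = 0 then 0 else
     (-1) ^ (DIM('e) * q + DIM('e) + 1) *\<^sub>R
       hodge_star M B (DIM('e) - q + 1) (ext_d B S (DIM('e) - q) (hodge_star M B q \<omega>)) c u v)"

definition hodge_laplace ::
  "('x, 'e::euclidean_space) riemannian \<Rightarrow>
   ('x, 'u::topological_space, 'v::euclidean_space) flat_bundle
     \<Rightarrow> 'x set \<Rightarrow> nat \<Rightarrow> ('x, 'u, 'e, 'v) form \<Rightarrow> ('x, 'u, 'e, 'v) form" where
  "hodge_laplace M B S q \<omega> = (\<lambda>c u v.
     (if q = 0 then 0 else ext_d B S (q - 1) (codiff M B S q \<omega>) c u v)
     + codiff M B S (q + 1) (ext_d B S q \<omega>) c u v)"

definition form_inner ::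
  "('x, 'e::euclidean_space) riemannian \<Rightarrow> ('x, 'u, 'v::euclidean_space) flat_bundle
     \<Rightarrow> nat \<Rightarrow> ('x, 'u, 'e, 'v) form \<Rightarrow> ('x, 'u, 'e, 'v) form \<Rightarrow> 'x \<Rightarrow> real" where
  "form_inner M B q \<omega> \<eta> x =
     (let c = (SOME c. c \<in> atlas M \<and> x \<in> fst c);
          u = (SOME u. cov B u = x);
          e = some_frame M c x
      in \<Sum>I | I \<subseteq> {..<DIM('e)} \<and> card I = q. \<omega> c u (subframe e I) \<bullet> \<eta> c u (subframe e I))"

definition L2_form ::
  "('x::topological_space, 'e::euclidean_space) riemannian \<Rightarrow>
   ('x, 'u, 'v::euclidean_space) flat_bundle
     \<Rightarrow> 'x set \<Rightarrow> nat \<Rightarrow> ('x, 'u, 'e, 'v) form \<Rightarrow> bool" where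
  "L2_form M B S q \<omega> \<longleftrightarrow> set_integrable (riem_measure M) S (form_inner M B q \<omega> \<omega>)"

definition L2_inner ::
  "('x::topological_space, 'e::euclidean_space) riemannian \<Rightarrow>
   ('x, 'u, 'v::euclidean_space) flat_bundle
     \<Rightarrow> 'x set \<Rightarrow> nat \<Rightarrow> ('x, 'u, 'e, 'v) form \<Rightarrow> ('x, 'u, 'e, 'v) form \<Rightarrow> real" where
  "L2_inner M B S q \<omega> \<eta> = (LINT x:S|riem_measure M. form_inner M B q \<omega> \<eta> x)"

text \<open>The maximal \<open>L\<^sup>2\<close> extension of the Hodge-Laplace operator. By elliptic regularity the
  elements of its kernel are smooth, and the class in \<open>L\<^sup>2\<close> of an element of the kernel is
  represented here by its smooth representative.\<close>

definition max_domain ::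
  "('x::topological_space, 'e::euclidean_space) riemannian \<Rightarrow>
   ('x, 'u::topological_space, 'v::euclidean_space) flat_bundle
     \<Rightarrow> 'x set \<Rightarrow> nat \<Rightarrow> ('x, 'u, 'e, 'v) form set" where
  "max_domain M B S q = {\<omega>. is_form M B S q \<omega> \<and> L2_form M B S q \<omega> \<and>
     L2_form M B S q (hodge_laplace M B S q \<omega>)}"

definition max_kernel ::
  "('x::topological_space, 'e::euclidean_space) riemannian \<Rightarrow>
   ('x, 'u::topological_space, 'v::euclidean_space) flat_bundle
     \<Rightarrow> 'x set \<Rightarrow> nat \<Rightarrow> ('x, 'u, 'e, 'v) form set" where
  "max_kernel M B S q = {\<omega> \<in> max_domain M B S q.
     forms_eq M B S (hodge_laplace M B S q \<omega>) (\<lambda>c u v. 0)}"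

definition orthonormal_basis ::
  "('x::topological_space, 'e::euclidean_space) riemannian \<Rightarrow>
   ('x, 'u, 'v::euclidean_space) flat_bundle
     \<Rightarrow> 'x set \<Rightarrow> nat \<Rightarrow> ('x, 'u, 'e, 'v) form set \<Rightarrow> ('x, 'u, 'e, 'v) form list \<Rightarrow> bool" where
  "orthonormal_basis M B S q F as \<longleftrightarrow>
     set as \<subseteq> F \<and>
     (\<forall>i<length as. \<forall>j<length as.
        L2_inner M B S q (as ! i) (as ! j) = (if i = j then 1 else 0)) \<and>
     (\<forall>\<omega>\<in>F. \<exists>r. forms_eq M B S \<omega> (\<lambda>c u v. \<Sum>i<length as. r i *\<^sub>R (as ! i) c u v))"


section \<open>Spaces with a conical singularity\<close>

definition lower_middle :: "nat \<Rightarrow> nat" where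
  "lower_middle j = j div 2 - 1"

definition upper_middle :: "nat \<Rightarrow> nat" where
  "upper_middle j = j - 2 - lower_middle j"

text \<open>The space \<open>X\<close> is the type \<open>'x\<close>, and \<open>'u\<close> is its universal covering space.
  \<open>link\<close> is \<open>W\<close>; \<open>reg\<close> is the Riemannian manifold \<open>X - {tip}\<close>; \<open>emb x w\<close> is the point \<open>(x, w)\<close>
  of the cone \<open>(0, l] \<times> W\<close>, where \<open>l\<close> is \<open>len\<close>, and the map extends to a collar
  \<open>(0, collar_len) \<times> W\<close> with \<open>collar_len > l\<close>, on which no condition is put on the metric beyond
  \<open>l\<close>; the function \<open>H\<close> is \<open>prof\<close>. The bundle is that of the
  representation of the fundamental group, realised as the group of deck transformations of the
  universal covering. The cone is simply connected, so that it lifts to the universal covering;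
  \<open>sec\<close> is such a lift, and is used to regard forms on the cone as forms with values in \<open>V\<close>.\<close>

record ('x, 'u, 'w, 'd, 'v) conical =
  link :: "('w, 'd) riemannian"
  reg :: "('x, real \<times> 'd) riemannian"
  tip :: 'x
  len :: real
  collar_len :: real
  prof :: "real \<Rightarrow> real"
  emb :: "real \<Rightarrow> 'w \<Rightarrow> 'x"
  flatb :: "('x, 'u, 'v) flat_bundle"
  sec :: "real \<Rightarrow> 'w \<Rightarrow> 'u"

definition dimW :: "('x, 'u, 'w, 'd::euclidean_space, 'v) conical \<Rightarrow> nat" where
  "dimW G = DIM('d)"

definition dimX :: "('x, 'u, 'w, 'd::euclidean_space, 'v) conical \<Rightarrow> nat" where
  "dimX G = dimW G + 1"

definition hfun :: "('x, 'u, 'w, 'd, 'v) conical \<Rightarrow> real \<Rightarrow> real" where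
  "hfun G x = x * prof G x"

definition cone_upto :: "('x, 'u, 'w, 'd, 'v) conical \<Rightarrow> real \<Rightarrow> 'x set" where
  "cone_upto G r = {emb G x w |x w. 0 < x \<and> x < r}"

definition coneC :: "('x, 'u, 'w, 'd, 'v) conical \<Rightarrow> 'x set" where
  "coneC G = {emb G x w |x w. 0 < x \<and> x \<le> len G}"

definition interface :: "('x, 'u, 'w, 'd, 'v) conical \<Rightarrow> 'x set" where
  "interface G = range (emb G (len G))"

definition partY :: "('x, 'u, 'w, 'd, 'v) conical \<Rightarrow> 'x set" where
  "partY G = - insert (tip G) (cone_upto G (len G))"

definition cone_coords :: "('x, 'u, 'w, 'd, 'v) conical \<Rightarrow> 'x \<Rightarrow> real \<times> 'w" where
  "cone_coords G = inv_into ({0<..<collar_len G} \<times> UNIV) (\<lambda>(x, w). emb G x w)"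

definition cone_chart ::
  "('x, 'u, 'w, 'd, 'v) conical \<Rightarrow> ('w, 'd) chart \<Rightarrow> ('x, real \<times> 'd) chart" where
  "cone_chart G c =
     ({emb G x w |x w. 0 < x \<and> x < collar_len G \<and> w \<in> fst c},
      \<lambda>z. (fst (cone_coords G z), snd c (snd (cone_coords G z))))"

definition deck :: "('u::topological_space \<Rightarrow> 'x) \<Rightarrow> ('u \<Rightarrow> 'u) set" where
  "deck p = {\<sigma>. homeomorphism UNIV UNIV \<sigma> (inv_into UNIV \<sigma>) \<and> p \<circ> \<sigma> = p}"

text \<open>The last condition, transitivity of the deck group on the fibres, is automatic over
  locally path-connected spaces.\<close>

definition universal_covering :: "('u::topological_space \<Rightarrow> 'x::topological_space) \<Rightarrow> bool" where
  "universal_covering p \<longleftrightarrow>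
     covering_space UNIV p UNIV \<and> path_connected (UNIV :: 'u set) \<and>
     simply_connected (UNIV :: 'u set) \<and>
     (\<forall>u u'. p u = p u' \<longrightarrow> (\<exists>\<sigma>\<in>deck p. \<sigma> u = u'))"

definition conical_space ::
  "('x::{t2_space, second_countable_topology}, 'u::topological_space,
    'w::{t2_space, second_countable_topology}, 'd::euclidean_space, 'v::euclidean_space) conical
     \<Rightarrow> bool" where
  "conical_space G \<longleftrightarrow>
     \<comment> \<open>the link\<close>
     oriented_riemannian (link G) \<and> pts (link G) = UNIV \<and>
     compact (UNIV :: 'w set) \<and> connected (UNIV :: 'w set) \<and>
     \<comment> \<open>the regular part\<close>
     compact (UNIV :: 'x set) \<and> oriented_riemannian (reg G) \<and> pts (reg G) = - {tip G} \<and>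
     connected (partY G) \<and>
     \<comment> \<open>the metric cone\<close>
     0 < len G \<and> len G < collar_len G \<and>
     smooth_on (prof G) {0..len G} \<and> (\<forall>x\<in>{0..len G}. prof G x \<noteq> 0) \<and> prof G 0 = 1 \<and>
     open (cone_upto G (collar_len G)) \<and>
     homeomorphism ({0<..<collar_len G} \<times> UNIV) (cone_upto G (collar_len G))
       (\<lambda>(x, w). emb G x w) (cone_coords G) \<and>
     (\<forall>r. 0 < r \<and> r \<le> len G \<longrightarrow> open (insert (tip G) (cone_upto G r))) \<and>
     (\<forall>c\<in>atlas (link G). cone_chart G c \<in> atlas (reg G) \<and>
        (\<forall>w\<in>fst c. \<forall>x. 0 < x \<and> x \<le> len G \<longrightarrow>
           (\<forall>a b v v'. metric (reg G) (cone_chart G c) (emb G x w) (a, v) (b, v') =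
              a * b + (hfun G x)\<^sup>2 * metric (link G) c w v v'))) \<and>
     \<comment> \<open>the orthogonal representation of the fundamental group\<close>
     universal_covering (cov (flatb G)) \<and> grp (flatb G) = deck (cov (flatb G)) \<and>
     (\<forall>\<sigma>\<in>grp (flatb G). orthogonal_transformation (act (flatb G) \<sigma>)) \<and>
     (\<forall>\<sigma>\<in>grp (flatb G). \<forall>\<tau>\<in>grp (flatb G).
        act (flatb G) (\<sigma> \<circ> \<tau>) = act (flatb G) \<sigma> \<circ> act (flatb G) \<tau>) \<and>
     \<comment> \<open>the lift of the cone\<close>
     continuous_on ({0<..len G} \<times> UNIV) (\<lambda>(x, w). sec G x w) \<and>
     (\<forall>x w. 0 < x \<and> x \<le> len G \<longrightarrow> cov (flatb G) (sec G x w) = emb G x w)"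


section \<open>Harmonic forms\<close>

text \<open>On the cone, \<open>\<omega> = \<omega>\<^sub>1 + dx \<and> \<omega>\<^sub>2\<close>; \<open>cone_tan G \<omega> x\<close> and \<open>cone_nor G \<omega> x\<close> are
  \<open>\<omega>\<^sub>1\<close> and \<open>\<omega>\<^sub>2\<close> at \<open>x\<close>, as forms on the link. For a \<open>0\<close>-form there is no \<open>\<omega>\<^sub>2\<close>.\<close>

definition cone_tan ::
  "('x, 'u, 'w, 'd::euclidean_space, 'v) conical \<Rightarrow> ('x, 'u, real \<times> 'd, 'v) form
     \<Rightarrow> real \<Rightarrow> ('w, 'w, 'd, 'v) form" where
  "cone_tan G \<omega> x = (\<lambda>c w v. \<omega> (cone_chart G c) (sec G x w) (\<lambda>i. (0, v i)))"

definition cone_nor ::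
  "('x, 'u, 'w, 'd::euclidean_space, 'v) conical \<Rightarrow> ('x, 'u, real \<times> 'd, 'v) form
     \<Rightarrow> real \<Rightarrow> ('w, 'w, 'd, 'v) form" where
  "cone_nor G \<omega> x =
     (\<lambda>c w v. \<omega> (cone_chart G c) (sec G x w) (case_nat (1, 0) (\<lambda>i. (0, v i))))"

definition alpha_deg :: "('x, 'u, 'w, 'd::euclidean_space, 'v) conical \<Rightarrow> real \<Rightarrow> real" where
  "alpha_deg G q = (1 + 2 * q - real (dimW G)) / 2"

definition is_u_plus ::
  "('x, 'u, 'w, 'd, 'v) conical \<Rightarrow> real \<Rightarrow> real \<Rightarrow> (real \<Rightarrow> real) \<Rightarrow> bool" where
  "is_u_plus G \<alpha> \<nu> u \<longleftrightarrow>
     (\<exists>\<phi>. continuous_on {0..len G} \<phi> \<and> \<phi> 0 = 1 \<and>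
        (\<forall>x\<in>{0<..len G}. u x = x powr (1/2 + \<nu>) * \<phi> x)) \<and>
     (\<forall>x\<in>{0<..<len G}. u differentiable at x \<and> deriv u differentiable at x \<and>
        - deriv (deriv u) x
        - (\<alpha> - 1/2) * (deriv (deriv (hfun G)) x / hfun G x) * u x
        + (\<alpha>\<^sup>2 - 1/4) * ((deriv (hfun G) x)\<^sup>2 / (hfun G x)\<^sup>2) * u x
        + (\<nu>\<^sup>2 - \<alpha>\<^sup>2) / (hfun G x)\<^sup>2 * u x = 0)"

definition u_plus ::
  "('x, 'u, 'w, 'd, 'v) conical \<Rightarrow> real \<Rightarrow> real \<Rightarrow> real \<Rightarrow> real" where
  "u_plus G \<alpha> \<nu> = (SOME u. is_u_plus G \<alpha> \<nu> u)"

text \<open>\<open>BV_zero G \<alpha> \<nu> u\<close> is the condition \<open>BV\<^sub>\<nu>\<^sub>,\<^sub>+ u = 0\<close>.\<close>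

definition BV_zero ::
  "('x, 'u, 'w, 'd, 'v) conical \<Rightarrow> real \<Rightarrow> real \<Rightarrow> (real \<Rightarrow> real) \<Rightarrow> bool" where
  "BV_zero G \<alpha> \<nu> u \<longleftrightarrow>
     ((\<lambda>x. u_plus G \<alpha> \<nu> x * deriv u x - deriv (u_plus G \<alpha> \<nu>) x * u x) \<longlongrightarrow> 0) (at_right 0)"

definition link_eigenform ::
  "('x, 'u, 'w::topological_space, 'd::euclidean_space, 'v::euclidean_space) conical
     \<Rightarrow> nat \<Rightarrow> real \<Rightarrow> ('w, 'w, 'd, 'v) form \<Rightarrow> bool" where
  "link_eigenform G q ev \<theta> \<longleftrightarrow>
     is_form (link G) trivial_bundle UNIV q \<theta> \<and>
     forms_eq (link G) trivial_bundle UNIV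
       (hodge_laplace (link G) trivial_bundle UNIV q \<theta>) (\<lambda>c w v. ev *\<^sub>R \<theta> c w v)"

text \<open>The components along \<open>\<theta>\<close> of \<open>u\<^sub>1\<close> and \<open>u\<^sub>2\<close>, for a form of degree \<open>q\<close>.\<close>

definition comp1 ::
  "('x, 'u, 'w::topological_space, 'd::euclidean_space, 'v::euclidean_space) conical
     \<Rightarrow> nat \<Rightarrow> ('x, 'u, real \<times> 'd, 'v) form \<Rightarrow> ('w, 'w, 'd, 'v) form \<Rightarrow> real \<Rightarrow> real" where
  "comp1 G q \<omega> \<theta> x = hfun G x powr (1/2 - alpha_deg G (real q)) *
     L2_inner (link G) trivial_bundle UNIV q (cone_tan G \<omega> x) \<theta>"

definition comp2 ::
  "('x, 'u, 'w::topological_space, 'd::euclidean_space, 'v::euclidean_space) conical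
     \<Rightarrow> nat \<Rightarrow> ('x, 'u, real \<times> 'd, 'v) form \<Rightarrow> ('w, 'w, 'd, 'v) form \<Rightarrow> real \<Rightarrow> real" where
  "comp2 G q \<omega> \<theta> x = hfun G x powr (1/2 - alpha_deg G (real q - 1)) *
     L2_inner (link G) trivial_bundle UNIV (q - 1) (cone_nor G \<omega> x) \<theta>"

definition tip_conditions ::
  "('x, 'u, 'w::topological_space, 'd::euclidean_space, 'v::euclidean_space) conical
     \<Rightarrow> (nat \<Rightarrow> nat) \<Rightarrow> nat \<Rightarrow> ('x, 'u, real \<times> 'd, 'v) form \<Rightarrow> bool" where
  "tip_conditions G \<pp> q \<omega> \<longleftrightarrow>
     (\<forall>ev \<theta>. let \<alpha> = alpha_deg G (real q); \<nu> = sqrt (ev + \<alpha>\<^sup>2) in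
        link_eigenform G q ev \<theta> \<and> \<nu> < 1 \<longrightarrow>
        (if dimW G = 2 * q \<and> \<pp> = lower_middle \<and> ev = 0
         then (deriv (comp1 G q \<omega> \<theta>) \<longlongrightarrow> 0) (at_right 0)
         else BV_zero G \<alpha> \<nu> (comp1 G q \<omega> \<theta>))) \<and>
     (q \<ge> 1 \<longrightarrow>
     (\<forall>ev \<theta>. let \<alpha> = - alpha_deg G (real q - 2); \<nu> = sqrt (ev + \<alpha>\<^sup>2) in
        link_eigenform G (q - 1) ev \<theta> \<and> \<nu> < 1 \<longrightarrow>
        (if dimW G = 2 * (q - 1) \<and> \<pp> = upper_middle \<and> ev = 0
         then (deriv (comp2 G q \<omega> \<theta>) \<longlongrightarrow> 0) (at_right 0)
         else BV_zero G \<alpha> \<nu> (comp2 G q \<omega> \<theta>))))"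

definition harm_X ::
  "('x::topological_space, 'u::topological_space, 'w::topological_space,
    'd::euclidean_space, 'v::euclidean_space) conical
     \<Rightarrow> (nat \<Rightarrow> nat) \<Rightarrow> nat \<Rightarrow> ('x, 'u, real \<times> 'd, 'v) form set" where
  "harm_X G \<pp> q = {\<omega> \<in> max_kernel (reg G) (flatb G) (pts (reg G)) q. tip_conditions G \<pp> q \<omega>}"

definition abs_conditions ::
  "('x, 'u, 'w, 'd::euclidean_space, 'v::euclidean_space) conical
     \<Rightarrow> nat \<Rightarrow> ('x, 'u, real \<times> 'd, 'v) form \<Rightarrow> bool" where
  "abs_conditions G q \<omega> \<longleftrightarrow>
     (\<forall>c\<in>atlas (link G). \<forall>w\<in>fst c. \<forall>v.
        (q \<ge> 1 \<longrightarrow> cone_nor G \<omega> (len G) c w v = 0) \<and>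
        ((\<lambda>x. cone_tan G \<omega> x c w v) has_vector_derivative 0) (at (len G) within {0<..len G}))"

definition harm_C ::
  "('x::topological_space, 'u::topological_space, 'w::topological_space,
    'd::euclidean_space, 'v::euclidean_space) conical
     \<Rightarrow> (nat \<Rightarrow> nat) \<Rightarrow> nat \<Rightarrow> ('x, 'u, real \<times> 'd, 'v) form set" where
  "harm_C G \<pp> q = {\<omega> \<in> max_kernel (reg G) (flatb G) (coneC G) q.
     tip_conditions G \<pp> q \<omega> \<and> abs_conditions G q \<omega>}"

text \<open>Relative boundary conditions: the tangential parts of \<open>\<omega>\<close> and of its codifferential
  vanish at the boundary.\<close>

definition rel_conditions ::
  "('x, 'u::topological_space, 'w, 'd::euclidean_space, 'v::euclidean_space) conical
     \<Rightarrow> nat \<Rightarrow> ('x, 'u, real \<times> 'd, 'v) form \<Rightarrow> bool" where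
  "rel_conditions G q \<omega> \<longleftrightarrow>
     (\<forall>c\<in>atlas (link G). \<forall>w\<in>fst c. \<forall>v.
        cone_tan G \<omega> (len G) c w v = 0 \<and>
        cone_tan G (codiff (reg G) (flatb G) (partY G) q \<omega>) (len G) c w v = 0)"

definition harm_Y ::
  "('x::topological_space, 'u::topological_space, 'w::topological_space,
    'd::euclidean_space, 'v::euclidean_space) conical
     \<Rightarrow> nat \<Rightarrow> ('x, 'u, real \<times> 'd, 'v) form set" where
  "harm_Y G q = {\<omega> \<in> max_kernel (reg G) (flatb G) (partY G) q. rel_conditions G q \<omega>}"


section \<open>Cellular decompositions\<close>

text \<open>\<open>std_simplex k\<close> is the simplex with vertices \<open>0, b\<^sub>0, \<dots>, b\<^sub>k\<^sub>-\<^sub>1\<close>, where \<open>b\<close> is the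
  basis of \<open>'e\<close>; \<open>bary k s\<close> is the point with barycentric coordinates \<open>s 0, \<dots>, s k\<close>.\<close>

definition bary :: "nat \<Rightarrow> (nat \<Rightarrow> real) \<Rightarrow> 'e::euclidean_space" where
  "bary k s = (\<Sum>i<k. s (Suc i) *\<^sub>R basis_frame i)"

definition bary_coords :: "nat \<Rightarrow> (nat \<Rightarrow> real) set" where
  "bary_coords k = {s. (\<forall>i\<le>k. 0 \<le> s i) \<and> (\<Sum>i\<le>k. s i) = 1}"

definition std_simplex :: "nat \<Rightarrow> 'e::euclidean_space set" where
  "std_simplex k = bary k ` bary_coords k"

definition open_simplex :: "nat \<Rightarrow> 'e::euclidean_space set" where
  "open_simplex k = bary k ` {s \<in> bary_coords k. \<forall>i\<le>k. 0 < s i}"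

text \<open>A regular cellular decomposition is given by its finite set of open cells.\<close>

definition is_cell :: "'e::euclidean_space itself \<Rightarrow> nat \<Rightarrow> 'x::topological_space set \<Rightarrow> bool" where
  "is_cell T d e \<longleftrightarrow>
     (\<exists>(D :: 'e set) f g. compact D \<and> convex D \<and> aff_dim D = int d \<and>
        homeomorphism (closure e) D f g \<and> f ` e = rel_interior D)"

definition regular_decomposition ::
  "'e::euclidean_space itself \<Rightarrow> 'x::topological_space set \<Rightarrow> 'x set set
     \<Rightarrow> ('x set \<Rightarrow> nat) \<Rightarrow> bool" where
  "regular_decomposition T S A d \<longleftrightarrow>
     finite A \<and> \<Union>A = S \<and> disjoint A \<and> (\<forall>e\<in>A. is_cell T (d e) e) \<and>
     (\<forall>e\<in>A. closure e = \<Union>{f \<in> A. f \<subseteq> closure e} \<and>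
        (\<forall>f\<in>A. f \<subseteq> closure e \<and> f \<noteq> e \<longrightarrow> d f < d e))"

text \<open>Incidence numbers of oriented cells of a regular complex; they determine the cellular
  chain complex.\<close>

definition incidence_function ::
  "'x::topological_space set set \<Rightarrow> ('x set \<Rightarrow> nat) \<Rightarrow> ('x set \<Rightarrow> 'x set \<Rightarrow> int) \<Rightarrow> bool" where
  "incidence_function A d \<epsilon> \<longleftrightarrow>
     (\<forall>e\<in>A. \<forall>f\<in>A. \<epsilon> e f \<in> (if f \<subseteq> closure e \<and> d e = d f + 1 then {-1, 1} else {0})) \<and>
     (\<forall>e\<in>A. \<forall>g\<in>A. (\<Sum>f\<in>A. \<epsilon> e f * \<epsilon> f g) = 0) \<and>
     (\<forall>e\<in>A. d e = 1 \<longrightarrow> (\<Sum>f\<in>A. \<epsilon> e f) = 0)"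

text \<open>\<open>cells\<close> is the decomposition \<open>M\<close> of \<open>Y\<close>; \<open>cdim\<close>, \<open>incid\<close> and \<open>lifts\<close> refer to the cells
  of \<open>K\<close>. \<open>lifts e\<close> is the lift of the closed cell \<open>e\<close> to the universal covering. \<open>orient\<close> are
  coefficients of a fundamental cycle of \<open>(Y, W)\<close>. \<open>flagmap\<close> is a smooth realisation of the
  barycentric subdivision of \<open>M\<close>: to a flag \<open>f\<^sub>0 < \<dots> < f\<^sub>k\<close> of cells it assigns the simplex
  whose vertices are the barycentres of the \<open>f\<^sub>i\<close>; it is needed to integrate over dual cells.\<close>

record ('x, 'u, 'e) decomposition =
  cells :: "'x set set"
  cdim :: "'x set \<Rightarrow> nat"
  incid :: "'x set \<Rightarrow> 'x set \<Rightarrow> int"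
  lifts :: "'x set \<Rightarrow> 'x \<Rightarrow> 'u"
  orient :: "'x set \<Rightarrow> int"
  flagmap :: "'x set list \<Rightarrow> 'e \<Rightarrow> 'x"

definition cells_N ::
  "('x, 'u, 'w, 'd, 'v) conical \<Rightarrow> ('x, 'u, real \<times> 'd) decomposition \<Rightarrow> 'x set set" where
  "cells_N G K = {e \<in> cells K. e \<subseteq> interface G}"

definition cone_cell :: "('x, 'u, 'w, 'd, 'v) conical \<Rightarrow> 'x set \<Rightarrow> 'x set" where
  "cone_cell G e = {emb G x w |x w. 0 < x \<and> x < len G \<and> emb G (len G) w \<in> e}"

definition cells_CN ::
  "('x, 'u, 'w, 'd, 'v) conical \<Rightarrow> ('x, 'u, real \<times> 'd) decomposition \<Rightarrow> 'x set set" where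
  "cells_CN G K = insert {tip G} (cells_N G K \<union> cone_cell G ` cells_N G K)"

definition cells_K ::
  "('x, 'u, 'w, 'd, 'v) conical \<Rightarrow> ('x, 'u, real \<times> 'd) decomposition \<Rightarrow> 'x set set" where
  "cells_K G K = cells K \<union> cells_CN G K"

definition is_flag :: "'x::topological_space set set \<Rightarrow> 'x set list \<Rightarrow> bool" where
  "is_flag A F \<longleftrightarrow> F \<noteq> [] \<and> set F \<subseteq> A \<and>
     (\<forall>i. Suc i < length F \<longrightarrow> F ! i \<subseteq> closure (F ! Suc i) \<and> F ! i \<noteq> F ! Suc i)"

definition smooth_barycentric ::
  "('x::topological_space, 'e::euclidean_space) riemannian \<Rightarrow> 'x set set
     \<Rightarrow> ('x set list \<Rightarrow> 'e \<Rightarrow> 'x) \<Rightarrow> bool" where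
  "smooth_barycentric M A \<sigma> \<longleftrightarrow>
     (\<forall>F. is_flag A F \<longrightarrow> (let k = length F - 1 in
        (\<exists>Q. open Q \<and> std_simplex k \<subseteq> Q \<and> continuous_on Q (\<sigma> F) \<and> \<sigma> F ` Q \<subseteq> pts M \<and>
           (\<forall>c\<in>atlas M. smooth_on (snd c \<circ> \<sigma> F) (Q \<inter> \<sigma> F -` fst c))) \<and>
        inj_on (\<sigma> F) (std_simplex k) \<and>
        (\<forall>i\<le>k. \<forall>s\<in>bary_coords k. 1 \<le> k \<and> s i = 0 \<longrightarrow>
           \<sigma> F (bary k s) = \<sigma> (take i F @ drop (Suc i) F) (bary (k - 1) (skip i s))))) \<and>
     (\<forall>e\<in>A. e = (\<Union>F\<in>{F. is_flag A F \<and> last F = e}. \<sigma> F ` open_simplex (length F - 1))) \<and>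
     (\<forall>F F'. is_flag A F \<and> is_flag A F' \<and> F \<noteq> F' \<longrightarrow>
        \<sigma> F ` open_simplex (length F - 1) \<inter> \<sigma> F' ` open_simplex (length F' - 1) = {})"

text \<open>All cells of the cone \<open>C(N)\<close> are lifted by the lift \<open>sec\<close> of the cone.\<close>

definition coherent_decomposition ::
  "('x::{t2_space, second_countable_topology}, 'u::topological_space,
    'w::{t2_space, second_countable_topology}, 'd::euclidean_space, 'v::euclidean_space) conical
     \<Rightarrow> ('x, 'u, real \<times> 'd) decomposition \<Rightarrow> bool" where
  "coherent_decomposition G K \<longleftrightarrow>
     regular_decomposition TYPE(real \<times> 'd) (partY G) (cells K) (cdim K) \<and>
     (\<forall>e\<in>cells K. e \<subseteq> interface G \<or> e \<inter> interface G = {}) \<and>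
     cdim K {tip G} = 0 \<and> (\<forall>e\<in>cells_N G K. cdim K (cone_cell G e) = cdim K e + 1) \<and>
     incidence_function (cells_K G K) (cdim K) (incid K) \<and>
     (\<forall>e\<in>cells_K G K. continuous_on (closure e) (lifts K e) \<and>
        (\<forall>x\<in>closure e. cov (flatb G) (lifts K e x) = x)) \<and>
     (\<forall>e\<in>cells_CN G K. \<forall>x w. 0 < x \<and> x \<le> len G \<and> emb G x w \<in> closure e \<longrightarrow>
        lifts K e (emb G x w) = sec G x w) \<and>
     (\<forall>f\<in>cells K. cdim K f = dimX G \<longrightarrow> orient K f \<in> {-1, 1}) \<and>
     (\<forall>g\<in>cells K - cells_N G K. cdim K g = dimW G \<longrightarrow>
        (\<Sum>f | f \<in> cells K \<and> cdim K f = dimX G. orient K f * incid K f g) = 0) \<and>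
     smooth_barycentric (reg G) (cells K) (flagmap K)"


section \<open>Chain complexes\<close>

text \<open>The choice of lifts identifies the \<open>q\<close>-chains of \<open>K\<close> with coefficients in \<open>V\<^sub>\<rho>\<close>, that is,
  the chains of the universal covering tensored with \<open>V\<close> over \<open>\<rho>\<close>, with \<open>V\<close>-valued functions on
  the \<open>q\<close>-cells. If \<open>twist G K e f = \<sigma>\<close>, then \<open>\<sigma>\<close> times the lift of \<open>f\<close> is a face of the lift of
  \<open>e\<close>. In the tensor product \<open>\<sigma> c \<otimes> v = c \<otimes> \<rho>(\<sigma>\<^sup>-\<^sup>1) v\<close>.\<close>

definition twist ::
  "('x::topological_space, 'u, 'w, 'd, 'v) conical \<Rightarrow> ('x, 'u, real \<times> 'd) decomposition
     \<Rightarrow> 'x set \<Rightarrow> 'x set \<Rightarrow> 'u \<Rightarrow> 'u" where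
  "twist G K e f = (THE \<sigma>. \<sigma> \<in> grp (flatb G) \<and> (\<forall>x\<in>f. \<sigma> (lifts K f x) = lifts K e x))"

definition bdry ::
  "('x::topological_space, 'u, 'w, 'd, 'v::real_vector) conical
     \<Rightarrow> ('x, 'u, real \<times> 'd) decomposition \<Rightarrow> ('x set \<Rightarrow>\<^sub>0 'v) \<Rightarrow> ('x set \<Rightarrow>\<^sub>0 'v)" where
  "bdry G K z = (\<Sum>e\<in>cells_K G K. \<Sum>f\<in>cells_K G K. Poly_Mapping.single f
     (real_of_int (incid K e f) *\<^sub>R act (flatb G) (inv_into UNIV (twist G K e f)) (Poly_Mapping.lookup z e)))"

definition chains ::
  "('x, 'u, 'e) decomposition \<Rightarrow> 'x set set \<Rightarrow> nat \<Rightarrow> ('x set \<Rightarrow>\<^sub>0 'v::real_vector) set" where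
  "chains K A q = {z. Poly_Mapping.keys z \<subseteq> {e \<in> A. cdim K e = q}}"

definition restrict_chain ::
  "'x set set \<Rightarrow> ('x set \<Rightarrow>\<^sub>0 'v::real_vector) \<Rightarrow> ('x set \<Rightarrow>\<^sub>0 'v)" where
  "restrict_chain A z =
     (\<Sum>e\<in>Poly_Mapping.keys z \<inter> A. Poly_Mapping.single e (Poly_Mapping.lookup z e))"

text \<open>The complex of the filtration by \<open>S\<^sub>q\<close>, the \<open>q\<close>-skeleton of \<open>A\<close> if \<open>q < a\<close> and of \<open>A'\<close> if
  \<open>q \<ge> a\<close>. In terms of cellular chains \<open>H\<^sub>q(S\<^sub>q, S\<^sub>q\<^sub>-\<^sub>1)\<close> consists of the \<open>q\<close>-chains of \<open>S\<^sub>q\<close> whose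
  boundary lies in \<open>S\<^sub>q\<^sub>-\<^sub>1\<close>: for dimensional reasons nothing is divided out.\<close>

definition filtered_chains ::
  "('x::topological_space, 'u, 'w, 'd, 'v::real_vector) conical
     \<Rightarrow> ('x, 'u, real \<times> 'd) decomposition
     \<Rightarrow> 'x set set \<Rightarrow> 'x set set \<Rightarrow> nat \<Rightarrow> nat \<Rightarrow> ('x set \<Rightarrow>\<^sub>0 'v) set" where
  "filtered_chains G K A A' a q = {z \<in> chains K (if q < a then A else A') q.
     q = 0 \<or> bdry G K z \<in> chains K (if q - 1 < a then A else A') (q - 1)}"

definition cutoff ::
  "('x, 'u, 'w, 'd::euclidean_space, 'v) conical \<Rightarrow> (nat \<Rightarrow> nat) \<Rightarrow> nat" where
  "cutoff G \<pp> = dimX G - \<pp> (dimX G)"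

definition complex_X ::
  "('x::topological_space, 'u, 'w, 'd::euclidean_space, 'v::real_vector) conical
     \<Rightarrow> ('x, 'u, real \<times> 'd) decomposition \<Rightarrow> (nat \<Rightarrow> nat) \<Rightarrow> ('x set \<Rightarrow>\<^sub>0 'v) qcomplex" where
  "complex_X G K \<pp> =
     \<lparr>num = filtered_chains G K (cells K) (cells_K G K) (cutoff G \<pp>), den = (\<lambda>_. {0}),
      dif = (\<lambda>_. bdry G K), top_deg = dimX G\<rparr>"

definition complex_C ::
  "('x::topological_space, 'u, 'w, 'd::euclidean_space, 'v::real_vector) conical
     \<Rightarrow> ('x, 'u, real \<times> 'd) decomposition \<Rightarrow> (nat \<Rightarrow> nat) \<Rightarrow> ('x set \<Rightarrow>\<^sub>0 'v) qcomplex" where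
  "complex_C G K \<pp> =
     \<lparr>num = filtered_chains G K (cells_N G K) (cells_CN G K) (cutoff G \<pp>), den = (\<lambda>_. {0}),
      dif = (\<lambda>_. bdry G K), top_deg = dimX G\<rparr>"

text \<open>Relative chains are represented by chains on the cells of \<open>M\<close> not in \<open>N\<close>.\<close>

definition complex_Y ::
  "('x::topological_space, 'u, 'w, 'd::euclidean_space, 'v::real_vector) conical
     \<Rightarrow> ('x, 'u, real \<times> 'd) decomposition \<Rightarrow> ('x set \<Rightarrow>\<^sub>0 'v) qcomplex" where
  "complex_Y G K =
     \<lparr>num = chains K (cells K - cells_N G K), den = (\<lambda>_. {0}),
      dif = (\<lambda>_ z. restrict_chain (cells K - cells_N G K) (bdry G K z)), top_deg = dimX G\<rparr>"

text \<open>The long exact sequence. The connecting homomorphism \<open>H\<^sub>q(Y, W) \<rightarrow> I\<^sup>pH\<^sub>q\<^sub>-\<^sub>1(C)\<close> is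
  induced by \<open>bdry\<close>, as chains of \<open>M\<close> are their own lifts to the complex of \<open>X\<close>.\<close>

definition long_exact ::
  "('x::topological_space, 'u, 'w, 'd::euclidean_space, 'v::real_vector) conical
     \<Rightarrow> ('x, 'u, real \<times> 'd) decomposition \<Rightarrow> (nat \<Rightarrow> nat) \<Rightarrow> ('x set \<Rightarrow>\<^sub>0 'v) qcomplex" where
  "long_exact G K \<pp> =
     (let D = (\<lambda>d. if d mod 3 = 0 then complex_Y G K
                   else if d mod 3 = 1 then complex_X G K \<pp> else complex_C G K \<pp>)
      in \<lparr>num = (\<lambda>d. cycles (D d) (d div 3)), den = (\<lambda>d. boundaries (D d) (d div 3)),
          dif = (\<lambda>d z. if d mod 3 = 0 then bdry G K z
                       else if d mod 3 = 1 then restrict_chain (cells K - cells_N G K) z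
                       else z),
          top_deg = 3 * dimX G + 2\<rparr>)"

definition long_exact_basis ::
  "(nat \<Rightarrow> 's list) \<Rightarrow> (nat \<Rightarrow> 's list) \<Rightarrow> (nat \<Rightarrow> 's list) \<Rightarrow> nat \<Rightarrow> 's list" where
  "long_exact_basis hC hX hY d =
     (if d mod 3 = 0 then hY (d div 3) else if d mod 3 = 1 then hX (d div 3) else hC (d div 3))"


section \<open>Chain bases\<close>

definition orthonormal_vectors :: "'v::euclidean_space list \<Rightarrow> bool" where
  "orthonormal_vectors vb \<longleftrightarrow> length vb = DIM('v) \<and>
     (\<forall>i<length vb. \<forall>j<length vb. vb ! i \<bullet> vb ! j = (if i = j then 1 else 0))"

definition int_cycles_N ::
  "('x, 'u, 'w, 'd, 'v) conical \<Rightarrow> ('x, 'u, real \<times> 'd) decomposition \<Rightarrow> nat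
     \<Rightarrow> ('x set \<Rightarrow> int) set" where
  "int_cycles_N G K q =
     {z. (\<forall>e. z e \<noteq> 0 \<longrightarrow> e \<in> cells_N G K \<and> cdim K e = q) \<and>
         (\<forall>f\<in>cells_N G K. (\<Sum>e\<in>cells_N G K. z e * incid K e f) = 0)}"

definition int_cycle_basis ::
  "('x, 'u, 'w, 'd, 'v) conical \<Rightarrow> ('x, 'u, real \<times> 'd) decomposition \<Rightarrow> nat
     \<Rightarrow> ('x set \<Rightarrow> int) list \<Rightarrow> bool" where
  "int_cycle_basis G K q zb \<longleftrightarrow>
     set zb \<subseteq> int_cycles_N G K q \<and>
     (\<forall>z\<in>int_cycles_N G K q. \<exists>r. \<forall>e. z e = (\<Sum>i<length zb. r i * (zb ! i) e)) \<and>
     (\<forall>r. (\<forall>e. (\<Sum>i<length zb. r i * (zb ! i) e) = 0) \<longrightarrow> (\<forall>i<length zb. r i = 0))"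

definition cell_basis ::
  "('x, 'u, 'e) decomposition \<Rightarrow> 'v::real_vector list \<Rightarrow> 'x set set \<Rightarrow> nat
     \<Rightarrow> ('x set \<Rightarrow>\<^sub>0 'v) list" where
  "cell_basis K vb A q =
     (let es = (SOME es. distinct es \<and> set es = {e \<in> A. cdim K e = q})
      in concat (map (\<lambda>e. map (\<lambda>v. Poly_Mapping.single e v) vb) es))"

text \<open>The cone over a cycle; \<open>incid K (cone_cell G e) e\<close> compares the chosen orientation of the
  cone over \<open>e\<close> with that of \<open>e\<close>.\<close>

definition cone_over ::
  "('x, 'u, 'w, 'd, 'v::real_vector) conical \<Rightarrow> ('x, 'u, real \<times> 'd) decomposition
     \<Rightarrow> ('x set \<Rightarrow> int) \<Rightarrow> 'v \<Rightarrow> ('x set \<Rightarrow>\<^sub>0 'v)" where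
  "cone_over G K z v = (\<Sum>e\<in>cells_N G K. Poly_Mapping.single (cone_cell G e)
     (real_of_int (z e * incid K (cone_cell G e) e) *\<^sub>R v))"

definition filtered_basis ::
  "('x, 'u, 'w, 'd, 'v::real_vector) conical \<Rightarrow> ('x, 'u, real \<times> 'd) decomposition
     \<Rightarrow> 'v list \<Rightarrow> ('x set \<Rightarrow> int) list \<Rightarrow> 'x set set \<Rightarrow> 'x set set \<Rightarrow> nat
     \<Rightarrow> nat \<Rightarrow> ('x set \<Rightarrow>\<^sub>0 'v) list" where
  "filtered_basis G K vb zb A A' a q =
     (if q < a then cell_basis K vb A q
      else if q = a then
        cell_basis K vb A q @ concat (map (\<lambda>z. map (cone_over G K z) vb) zb)
      else cell_basis K vb A' q)"


section \<open>De Rham maps\<close>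

text \<open>Integral of a form over the simplex of a flag, along its lift starting at the given lift of
  the barycentre of the cell \<open>e\<close>.\<close>

definition std_domain :: "nat \<Rightarrow> (nat \<Rightarrow> real) set" where
  "std_domain k = {t. (\<forall>i<k. 0 \<le> t i) \<and> (\<Sum>i<k. t i) \<le> 1}"

definition flag_integral ::
  "('x::topological_space, 'u::topological_space, 'w, 'd::euclidean_space,
    'v::euclidean_space) conical
     \<Rightarrow> ('x, 'u, real \<times> 'd) decomposition \<Rightarrow> ('x, 'u, real \<times> 'd, 'v) form
     \<Rightarrow> 'x set \<Rightarrow> 'x set list \<Rightarrow> 'v" where
  "flag_integral G K \<eta> e F =
     (let k = length F - 1;
          \<sigma> = flagmap K F;
          g = (SOME g. continuous_on (std_simplex k) g \<and> g 0 = lifts K e (\<sigma> 0) \<and>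
                 (\<forall>y\<in>std_simplex k. cov (flatb G) (g y) = \<sigma> y))
      in LINT t:std_domain k|PiM {..<k} (\<lambda>_. lborel).
           (let y = (\<Sum>i<k. t i *\<^sub>R basis_frame i);
                c = (SOME c. c \<in> atlas (reg G) \<and> \<sigma> y \<in> fst c)
            in \<eta> c (g y) (\<lambda>i. frechet_derivative (snd c \<circ> \<sigma>) (at y) (basis_frame i))))"

text \<open>Integral over the (lifted) cone \<open>(0, l] \<times> \<sigma>\<close> over the simplex \<open>\<sigma>\<close> of a flag in \<open>N\<close>.\<close>

definition cone_flag_integral ::
  "('x::topological_space, 'u, 'w, 'd::euclidean_space, 'v::euclidean_space) conical
     \<Rightarrow> ('x, 'u, real \<times> 'd) decomposition \<Rightarrow> ('x, 'u, real \<times> 'd, 'v) form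
     \<Rightarrow> 'x set list \<Rightarrow> 'v" where
  "cone_flag_integral G K \<eta> F =
     (let k = length F - 1;
          \<sigma> = flagmap K F
      in LINT x:{0<..len G}|lborel. LINT t:std_domain k|PiM {..<k} (\<lambda>_. lborel).
           (let y = (\<Sum>i<k. t i *\<^sub>R basis_frame i);
                w = snd (cone_coords G (\<sigma> y));
                c = (SOME c. c \<in> atlas (link G) \<and> w \<in> fst c)
            in \<eta> (cone_chart G c) (sec G x w)
                 (case_nat (1, 0) (\<lambda>i.
                   (0, snd (frechet_derivative (snd (cone_chart G c) \<circ> \<sigma>) (at y)
                              (basis_frame i)))))))"

definition flags_from ::
  "('x::topological_space, 'u, 'e) decomposition \<Rightarrow> 'x set set \<Rightarrow> nat \<Rightarrow> 'x set
     \<Rightarrow> 'x set list set" where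
  "flags_from K A d e =
     {F. is_flag A F \<and> hd F = e \<and> cdim K (last F) = d \<and> length F = d - cdim K e + 1}"

definition flag_sign ::
  "('x, 'u, 'e) decomposition \<Rightarrow> ('x set \<Rightarrow> int) \<Rightarrow> 'x set list \<Rightarrow> int" where
  "flag_sign K w F = (\<Prod>i<length F - 1. incid K (F ! Suc i) (F ! i)) * w (last F)"

text \<open>The dual cell \<open>D(e)\<close> of a \<open>q\<close>-cell \<open>e\<close> of \<open>M\<close> is the union of the simplices of all maximal
  flags starting at \<open>e\<close>. With the signs below
  \<open>\<partial>D(e) = (\<Sum>f. [f : e] D(f)) + (-1)\<^sup>n\<^sup>-\<^sup>q D\<^sub>N(e)\<close>, where \<open>D\<^sub>N(e)\<close> is the dual cell in \<open>N\<close> if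
  \<open>e\<close> is in \<open>N\<close> and is absent otherwise.\<close>

definition dual_integral ::
  "('x::topological_space, 'u::topological_space, 'w, 'd::euclidean_space,
    'v::euclidean_space) conical
     \<Rightarrow> ('x, 'u, real \<times> 'd) decomposition \<Rightarrow> ('x, 'u, real \<times> 'd, 'v) form
     \<Rightarrow> 'x set \<Rightarrow> 'v" where
  "dual_integral G K \<eta> e = (\<Sum>F\<in>flags_from K (cells K) (dimX G) e.
     real_of_int (flag_sign K (orient K) F) *\<^sub>R flag_integral G K \<eta> e F)"

definition link_orient ::
  "('x, 'u, 'w, 'd::euclidean_space, 'v) conical \<Rightarrow> ('x, 'u, real \<times> 'd) decomposition
     \<Rightarrow> 'x set \<Rightarrow> int" where
  "link_orient G K g =
     (\<Sum>f | f \<in> cells K \<and> cdim K f = dimX G. orient K f * incid K f g)"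

text \<open>Integral over the cone on the dual cell \<open>D\<^sub>N(e)\<close>. The sign is such that \<open>D(e)\<close> together with
  this cone has no boundary along \<open>W\<close>.\<close>

definition cone_dual_integral ::
  "('x::topological_space, 'u, 'w, 'd::euclidean_space, 'v::euclidean_space) conical
     \<Rightarrow> ('x, 'u, real \<times> 'd) decomposition \<Rightarrow> ('x, 'u, real \<times> 'd, 'v) form
     \<Rightarrow> 'x set \<Rightarrow> 'v" where
  "cone_dual_integral G K \<eta> e = (-1) ^ (dimX G - cdim K e + 1) *\<^sub>R
     (\<Sum>F\<in>flags_from K (cells_N G K) (dimW G) e.
        real_of_int (flag_sign K (link_orient G K) F) *\<^sub>R cone_flag_integral G K \<eta> F)"

text \<open>The De Rham maps are given as relations between a form and the cycles representing its
  image.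

  For \<open>q \<le> a - 2\<close> one has \<open>n - q \<ge> a\<^sup>c\<close>, so the cones on the dual cells of \<open>N\<close> occur in the dual
  intersection complex of the complementary perversity. The cell dual to \<open>e\<close> is \<open>D(e)\<close>, with the
  cone on \<open>D\<^sub>N(e)\<close> attached if \<open>e\<close> is in \<open>N\<close>, and these are dual to the cells of \<open>M\<close>, which span
  the complex in degree \<open>q\<close>.

  For \<open>q \<ge> a - 1\<close> the dual complex in degree \<open>n - q\<close> is that of \<open>Y\<close>, with cells dual to the
  cells of \<open>M\<close> not in \<open>N\<close>; the coefficients of these cells determine the intersection homology
  class, because the map to the homology of \<open>(Y, W)\<close> is injective in these degrees.

  On the cone the same description applies with \<open>Y\<close> replaced by \<open>W\<close>; the homology vanishes
  for \<open>q \<ge> a - 1\<close>.\<close>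

definition de_rham_X ::
  "('x::topological_space, 'u::topological_space, 'w, 'd::euclidean_space,
    'v::euclidean_space) conical
     \<Rightarrow> ('x, 'u, real \<times> 'd) decomposition \<Rightarrow> (nat \<Rightarrow> nat) \<Rightarrow> nat
     \<Rightarrow> ('x, 'u, real \<times> 'd, 'v) form \<Rightarrow> ('x set \<Rightarrow>\<^sub>0 'v) \<Rightarrow> bool" where
  "de_rham_X G K \<pp> q \<omega> z \<longleftrightarrow>
     (let \<eta> = hodge_star (reg G) (flatb G) q \<omega> in
      z \<in> cycles (complex_X G K \<pp>) q \<and>
      (\<forall>e\<in>cells K - cells_N G K. cdim K e = q \<longrightarrow>
         Poly_Mapping.lookup z e = dual_integral G K \<eta> e) \<and>
      (q + 2 \<le> cutoff G \<pp> \<longrightarrow> (\<forall>e\<in>cells_N G K. cdim K e = q \<longrightarrow>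
         Poly_Mapping.lookup z e = dual_integral G K \<eta> e + cone_dual_integral G K \<eta> e)))"

definition de_rham_C ::
  "('x::topological_space, 'u::topological_space, 'w, 'd::euclidean_space,
    'v::euclidean_space) conical
     \<Rightarrow> ('x, 'u, real \<times> 'd) decomposition \<Rightarrow> (nat \<Rightarrow> nat) \<Rightarrow> nat
     \<Rightarrow> ('x, 'u, real \<times> 'd, 'v) form \<Rightarrow> ('x set \<Rightarrow>\<^sub>0 'v) \<Rightarrow> bool" where
  "de_rham_C G K \<pp> q \<omega> z \<longleftrightarrow>
     (let \<eta> = hodge_star (reg G) (flatb G) q \<omega> in
      z \<in> cycles (complex_C G K \<pp>) q \<and>
      (q + 2 \<le> cutoff G \<pp> \<longrightarrow> (\<forall>e\<in>cells_N G K. cdim K e = q \<longrightarrow>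
         Poly_Mapping.lookup z e = cone_dual_integral G K \<eta> e)))"

definition de_rham_Y ::
  "('x::topological_space, 'u::topological_space, 'w, 'd::euclidean_space,
    'v::euclidean_space) conical
     \<Rightarrow> ('x, 'u, real \<times> 'd) decomposition \<Rightarrow> nat
     \<Rightarrow> ('x, 'u, real \<times> 'd, 'v) form \<Rightarrow> ('x set \<Rightarrow>\<^sub>0 'v) \<Rightarrow> bool" where
  "de_rham_Y G K q \<omega> z \<longleftrightarrow>
     (let \<eta> = hodge_star (reg G) (flatb G) q \<omega> in
      z \<in> cycles (complex_Y G K) q \<and>
      (\<forall>e\<in>cells K - cells_N G K. cdim K e = q \<longrightarrow>
         Poly_Mapping.lookup z e = dual_integral G K \<eta> e))"

text \<open>\<open>h\<close> is the basis of the homology of \<open>D\<close> formed by the images of the forms \<open>a\<close> under the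
  De Rham map \<open>R\<close>.\<close>

definition de_rham_basis ::
  "'s::real_vector qcomplex \<Rightarrow> (nat \<Rightarrow> 'f \<Rightarrow> 's \<Rightarrow> bool) \<Rightarrow> (nat \<Rightarrow> 'f list) \<Rightarrow> (nat \<Rightarrow> 's list)
     \<Rightarrow> bool" where
  "de_rham_basis D R a h \<longleftrightarrow>
     (\<forall>q. list_all2 (R q) (a q) (h q) \<and> homology_basis D q (h q))"


section \<open>The RS torsions\<close>

definition tau_RS_X ::
  "('x::topological_space, 'u, 'w, 'd::euclidean_space, 'v::real_vector) conical
     \<Rightarrow> ('x, 'u, real \<times> 'd) decomposition \<Rightarrow> (nat \<Rightarrow> nat) \<Rightarrow> 'v list \<Rightarrow> ('x set \<Rightarrow> int) list
     \<Rightarrow> (nat \<Rightarrow> ('x set \<Rightarrow>\<^sub>0 'v) list) \<Rightarrow> real" where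
  "tau_RS_X G K \<pp> vb zb h = R_torsion (complex_X G K \<pp>)
     (filtered_basis G K vb zb (cells K) (cells_K G K) (cutoff G \<pp>)) h"

definition tau_RS_C ::
  "('x::topological_space, 'u, 'w, 'd::euclidean_space, 'v::real_vector) conical
     \<Rightarrow> ('x, 'u, real \<times> 'd) decomposition \<Rightarrow> (nat \<Rightarrow> nat) \<Rightarrow> 'v list \<Rightarrow> ('x set \<Rightarrow> int) list
     \<Rightarrow> (nat \<Rightarrow> ('x set \<Rightarrow>\<^sub>0 'v) list) \<Rightarrow> real" where
  "tau_RS_C G K \<pp> vb zb h = R_torsion (complex_C G K \<pp>)
     (filtered_basis G K vb zb (cells_N G K) (cells_CN G K) (cutoff G \<pp>)) h"

definition tau_RS_Y ::
  "('x::topological_space, 'u, 'w, 'd::euclidean_space, 'v::real_vector) conical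
     \<Rightarrow> ('x, 'u, real \<times> 'd) decomposition \<Rightarrow> 'v list
     \<Rightarrow> (nat \<Rightarrow> ('x set \<Rightarrow>\<^sub>0 'v) list) \<Rightarrow> real" where
  "tau_RS_Y G K vb h = R_torsion (complex_Y G K) (cell_basis K vb (cells K - cells_N G K)) h"

end

theory Submission
  imports Defs
begin

text \<open>The formula is Milnor's multiplicativity of torsion for the short exact sequence
  \<open>0 \<rightarrow> C \<rightarrow> X \<rightarrow> Y \<rightarrow> 0\<close> of intersection chains on the cone, on the whole space and relative
  chains of \<open>(Y, W)\<close>; the analysis enters only through the fact that the De Rham images of the
  harmonic forms are bases of the homology groups. Relative chains of \<open>(Y, W)\<close> are their own lifts
  to \<open>X\<close>, so the sequence splits in each degree, and a basis of the exact homology sequence yields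
  homology bases for which the torsion of \<open>X\<close> is literally the product of the torsions of \<open>C\<close> and
  \<open>Y\<close>; passing to the given homology bases produces the torsion of the homology sequence. The chain
  bases are compatible because the chains on the cone in the degree of the cutoff are spanned by the
  cones over the cycles of \<open>N\<close>, and the real cycles are spanned by the integral ones.\<close>

section \<open>Bases of quotient spaces\<close>

text \<open>The terms of the homology sequence are quotients of subspaces of one ambient space, so
  the linear algebra is done with lists of representatives: \<open>basis_mod\<close> plays the role
  of a basis of a quotient, and lengths, determinants and exchange arguments are developed for it
  directly. That the twisted boundary operator squares to zero is never computed: a homology basis
  presupposes that boundaries are cycles. Deck transformations are evaluated only between two open
  cone cells, where the common lift \<open>sec\<close> makes them trivial; this is why untwisted
  integral cycles describe the chains in the degree of the cutoff. The geometric obstacle is to know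
  the faces of a cone cell. \<open>conical_space\<close> says that the truncated cones around the
  tip are open, not that they shrink to the tip; this has to be derived from compactness and
  connectedness before closures of cone cells can be controlled. That cells of \<open>N\<close> have
  dimension at most that of the link, which bounds the degrees of the complexes, comes from
  invariance of dimension.\<close>

definition lin_comb :: "(nat \<Rightarrow> real) \<Rightarrow> 's::real_vector list \<Rightarrow> 's" where
  "lin_comb c xs = (\<Sum>i<length xs. c i *\<^sub>R xs ! i)"

lemma lin_comb_Nil [simp]: "lin_comb c [] = 0"
  by (simp add: lin_comb_def)

lemma lin_comb_append:
  "lin_comb c (xs @ ys) = lin_comb c xs + lin_comb (\<lambda>i. c (length xs + i)) ys"
proof -
  have "lin_comb c (xs @ ys) = (\<Sum>i=0..<length xs + length ys. c i *\<^sub>R (xs @ ys) ! i)"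
    by (simp add: lin_comb_def atLeast0LessThan)
  also have "\<dots> = (\<Sum>i=0..<length xs. c i *\<^sub>R (xs @ ys) ! i)
      + (\<Sum>i=length xs..<length xs + length ys. c i *\<^sub>R (xs @ ys) ! i)"
    by (rule sum.atLeastLessThan_concat [symmetric]) auto
  also have "(\<Sum>i=length xs..<length xs + length ys. c i *\<^sub>R (xs @ ys) ! i)
      = (\<Sum>i=0..<length ys. c (length xs + i) *\<^sub>R ys ! i)"
    using sum.shift_bounds_nat_ivl [of "\<lambda>i. c i *\<^sub>R (xs @ ys) ! i" 0 "length xs" "length ys"]
    by (simp add: add.commute nth_append)
  also have "(\<Sum>i=0..<length xs. c i *\<^sub>R (xs @ ys) ! i) = lin_comb c xs"
    by (simp add: lin_comb_def atLeast0LessThan nth_append)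
  finally show ?thesis
    by (simp add: lin_comb_def atLeast0LessThan)
qed

lemma lin_comb_cong: "(\<And>i. i < length xs \<Longrightarrow> c i = c' i) \<Longrightarrow> lin_comb c xs = lin_comb c' xs"
  by (simp add: lin_comb_def)

lemma lin_comb_diff: "lin_comb (\<lambda>i. c i - c' i) xs = lin_comb c xs - lin_comb c' xs"
  by (simp add: lin_comb_def scaleR_left_diff_distrib sum_subtractf)

lemma lin_comb_sum: "(\<Sum>j\<in>J. a j *\<^sub>R lin_comb (c j) xs) = lin_comb (\<lambda>i. \<Sum>j\<in>J. a j * c j i) xs"
proof -
  have "(\<Sum>j\<in>J. a j *\<^sub>R lin_comb (c j) xs) = (\<Sum>j\<in>J. \<Sum>i<length xs. (a j * c j i) *\<^sub>R xs ! i)"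
    by (simp add: lin_comb_def scaleR_sum_right)
  also have "\<dots> = lin_comb (\<lambda>i. \<Sum>j\<in>J. a j * c j i) xs"
    unfolding lin_comb_def by (subst sum.swap) (simp add: scaleR_sum_left)
  finally show ?thesis .
qed

lemma lin_comb_map: "linear f \<Longrightarrow> lin_comb c (map f xs) = f (lin_comb c xs)"
  by (simp add: lin_comb_def linear_sum linear_cmul)

lemma lin_comb_in_subspace: "subspace A \<Longrightarrow> set xs \<subseteq> A \<Longrightarrow> lin_comb c xs \<in> A"
  unfolding lin_comb_def by (intro subspace_sum subspace_scale) auto

section \<open>Bases and coordinates modulo a subspace\<close>

lemma basis_mod_iff:
  "basis_mod Z B xs \<longleftrightarrow>
     subspace Z \<and> subspace B \<and> B \<subseteq> Z \<and> set xs \<subseteq> Z \<and>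
     (\<forall>z\<in>Z. \<exists>c. z - lin_comb c xs \<in> B) \<and>
     (\<forall>c. lin_comb c xs \<in> B \<longrightarrow> (\<forall>i<length xs. c i = 0))"
  by (simp add: basis_mod_def lin_comb_def)

lemma basis_modD:
  assumes "basis_mod Z B xs"
  shows "subspace Z" "subspace B" "B \<subseteq> Z" "set xs \<subseteq> Z"
    and "z \<in> Z \<Longrightarrow> \<exists>c. z - lin_comb c xs \<in> B"
    and "lin_comb c xs \<in> B \<Longrightarrow> i < length xs \<Longrightarrow> c i = 0"
  using assms unfolding basis_mod_iff by blast+

lemma coords_mod_rep:
  assumes "basis_mod Z B xs" "y \<in> Z"
  shows "y - lin_comb (coords_mod B xs y) xs \<in> B"
  using basis_modD(5) [OF assms] unfolding coords_mod_def lin_comb_def by (rule someI_ex)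

text \<open>The choice in \<open>coords_mod\<close> yields a function on all of \<open>nat\<close>;
  independence of \<open>xs\<close> pins down its values below the length, and these are the values
  that \<open>det_change\<close> reads.\<close>

lemma coords_mod_unique:
  assumes "basis_mod Z B xs" and "y - lin_comb c xs \<in> B" and "i < length xs"
  shows "coords_mod B xs y i = c i"
proof -
  have B: "subspace B" "B \<subseteq> Z" and xs: "set xs \<subseteq> Z" and Z: "subspace Z"
    using basis_modD [OF assms(1)] by auto
  have "y = (y - lin_comb c xs) + lin_comb c xs" by simp
  also have "\<dots> \<in> Z"
    using assms(2) B lin_comb_in_subspace [OF Z xs] by (intro subspace_add [OF Z]) auto
  finally have "y - lin_comb (coords_mod B xs y) xs \<in> B"
    by (rule coords_mod_rep [OF assms(1)])
  from subspace_diff [OF B(1) assms(2) this]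
  have "lin_comb (\<lambda>i. coords_mod B xs y i - c i) xs \<in> B"
    by (simp add: lin_comb_diff)
  from basis_modD(6) [OF assms(1) this assms(3)] show ?thesis by simp
qed

text \<open>Serves the degree just above the top, where all chains are cycles, so that a lift of a
  basis of boundaries is empty there.\<close>

lemma basis_mod_eq_Nil:
  assumes "basis_mod Z Z xs" shows "xs = []"
proof (rule ccontr)
  assume "xs \<noteq> []"
  then show False
    using basis_modD(6) [OF assms, of "\<lambda>_. 1" 0] lin_comb_in_subspace [of Z xs "\<lambda>_. 1"]
      basis_modD(1,4) [OF assms] by auto
qed

text \<open>For \<open>B\<close> inside \<open>A\<close> inside \<open>Z\<close>, reduce first
  modulo \<open>A\<close> by \<open>ys\<close>, then the remainder modulo \<open>B\<close> by
  \<open>xs\<close>. The smaller space comes first in the list, as in the order boundaries,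
  homology, lifts in the definition of torsion.\<close>

lemma basis_mod_append:
  assumes xs: "basis_mod A B xs" and ys: "basis_mod Z A ys"
  shows "basis_mod Z B (xs @ ys)"
proof -
  note X = basis_modD [OF xs] and Y = basis_modD [OF ys]
  have "\<exists>c. z - lin_comb c (xs @ ys) \<in> B" if z: "z \<in> Z" for z
  proof -
    obtain c where c: "z - lin_comb c ys \<in> A" using Y(5) [OF z] by blast
    obtain c' where c': "z - lin_comb c ys - lin_comb c' xs \<in> B" using X(5) [OF c] by blast
    let ?c = "\<lambda>i. if i < length xs then c' i else c (i - length xs)"
    have "lin_comb ?c (xs @ ys) = lin_comb c' xs + lin_comb c ys"
      unfolding lin_comb_append by (simp cong: lin_comb_cong)
    with c' show ?thesis by (metis add.commute diff_diff_eq)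
  qed
  moreover have "c i = 0" if c: "lin_comb c (xs @ ys) \<in> B" and i: "i < length (xs @ ys)" for c i
  proof -
    let ?d = "\<lambda>i. c (length xs + i)"
    have "lin_comb c (xs @ ys) - lin_comb c xs \<in> A"
      using c X lin_comb_in_subspace [OF X(1,4)] by (intro subspace_diff [OF X(1)]) auto
    then have A: "lin_comb ?d ys \<in> A" by (simp add: lin_comb_append)
    have d: "?d j = 0" if "j < length ys" for j using Y(6) [OF A that] .
    then have "lin_comb ?d ys = 0" by (simp add: lin_comb_def)
    with c have "lin_comb c xs \<in> B" by (simp add: lin_comb_append)
    with X(6) have "c j = 0" if "j < length xs" for j using that by blast
    with d [of "i - length xs"] i show ?thesis by (cases "i < length xs") auto
  qed
  ultimately show ?thesis using X Y unfolding basis_mod_iff by auto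
qed

text \<open>An isomorphism of \<open>Z/B\<close> onto \<open>Z'/B'\<close> induced by a map of the
  ambient spaces. Surjectivity is required up to \<open>B'\<close> only, and the final equivalence
  gives both well-definedness and injectivity.\<close>

definition quot_iso :: "('s::real_vector \<Rightarrow> 't::real_vector) \<Rightarrow> 's set \<Rightarrow> 's set \<Rightarrow> 't set \<Rightarrow> 't set \<Rightarrow> bool"
  where "quot_iso f Z B Z' B' \<longleftrightarrow> linear f \<and> subspace Z \<and> subspace B \<and> B \<subseteq> Z \<and>
    subspace Z' \<and> subspace B' \<and> B' \<subseteq> Z' \<and> f ` Z \<subseteq> Z' \<and>
    (\<forall>z'\<in>Z'. \<exists>z\<in>Z. z' - f z \<in> B') \<and> (\<forall>z\<in>Z. f z \<in> B' \<longleftrightarrow> z \<in> B)"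

lemma quot_iso_basis_mod:
  assumes f: "quot_iso f Z B Z' B'" and xs: "set xs \<subseteq> Z"
  shows "basis_mod Z' B' (map f xs) \<longleftrightarrow> basis_mod Z B xs"
proof -
  have lin: "linear f" and Z: "subspace Z" "subspace B" "B \<subseteq> Z"
    and Z': "subspace Z'" "subspace B'" "B' \<subseteq> Z'" "f ` Z \<subseteq> Z'"
    and onto: "\<And>z'. z' \<in> Z' \<Longrightarrow> \<exists>z\<in>Z. z' - f z \<in> B'"
    and inj: "\<And>z. z \<in> Z \<Longrightarrow> f z \<in> B' \<longleftrightarrow> z \<in> B"
    using f unfolding quot_iso_def by auto
  have lc: "lin_comb c xs \<in> Z" for c by (rule lin_comb_in_subspace [OF Z(1) xs])
  have d: "f z - lin_comb c (map f xs) \<in> B' \<longleftrightarrow> z - lin_comb c xs \<in> B" if "z \<in> Z" for z c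
    using inj [OF subspace_diff [OF Z(1) that lc]] by (simp add: lin_comb_map [OF lin] linear_diff [OF lin])
  have "(\<forall>z\<in>Z'. \<exists>c. z - lin_comb c (map f xs) \<in> B') \<longleftrightarrow> (\<forall>z\<in>Z. \<exists>c. z - lin_comb c xs \<in> B)"
  proof
    assume "\<forall>z\<in>Z'. \<exists>c. z - lin_comb c (map f xs) \<in> B'"
    then show "\<forall>z\<in>Z. \<exists>c. z - lin_comb c xs \<in> B" using d Z'(4) by blast
  next
    assume A: "\<forall>z\<in>Z. \<exists>c. z - lin_comb c xs \<in> B"
    show "\<forall>z\<in>Z'. \<exists>c. z - lin_comb c (map f xs) \<in> B'"
    proof
      fix z' assume "z' \<in> Z'"
      then obtain z where z: "z \<in> Z" "z' - f z \<in> B'" using onto by blast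
      then obtain c where "f z - lin_comb c (map f xs) \<in> B'" using A d by blast
      from subspace_add [OF Z'(2) z(2) this]
      show "\<exists>c. z' - lin_comb c (map f xs) \<in> B'" by auto
    qed
  qed
  moreover have "lin_comb c (map f xs) \<in> B' \<longleftrightarrow> lin_comb c xs \<in> B" for c
    using inj [OF lc] by (simp add: lin_comb_map [OF lin])
  moreover have "set (map f xs) \<subseteq> Z'" using xs Z'(4) by auto
  ultimately show ?thesis using Z Z' xs unfolding basis_mod_iff by simp
qed

lemma quot_iso_coords:
  assumes f: "quot_iso f Z B Z' B'" and xs: "basis_mod Z B xs" and y: "y \<in> Z" and i: "i < length xs"
  shows "coords_mod B' (map f xs) (f y) i = coords_mod B xs y i"
proof (rule coords_mod_unique)
  note X = basis_modD [OF xs]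
  show "basis_mod Z' B' (map f xs)" using quot_iso_basis_mod [OF f X(4)] xs by simp
  have lin: "linear f" using f unfolding quot_iso_def by auto
  have "y - lin_comb (coords_mod B xs y) xs \<in> B" using coords_mod_rep [OF xs y] .
  then have "f (y - lin_comb (coords_mod B xs y) xs) \<in> B'" using f X(3) unfolding quot_iso_def by blast
  then show "f y - lin_comb (coords_mod B xs y) (map f xs) \<in> B'"
    by (simp add: lin_comb_map [OF lin] linear_diff [OF lin])
qed (use i in simp)

text \<open>Traces replace a dimension count: the two changes of basis \<open>P\<close> and
  \<open>Q\<close> are inverse to each other, and comparing the traces of the products in the two
  orders equates the lengths. Only the diagonal entries of the products are computed.\<close>

lemma basis_mod_length:
  assumes xs: "basis_mod Z B xs" and ys: "basis_mod Z B ys"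
  shows "length xs = length ys"
proof -
  let ?P = "\<lambda>i j. coords_mod B xs (ys ! i) j" and ?Q = "\<lambda>j i. coords_mod B ys (xs ! j) i"
  have *: "(\<Sum>j<length xs. coords_mod B xs (ys ! i) j * coords_mod B ys (xs ! j) i) = 1"
    if xs: "basis_mod Z B xs" and ys: "basis_mod Z B ys" and i: "i < length ys" for xs ys i
  proof -
    note X = basis_modD [OF xs] and Y = basis_modD [OF ys]
    have yi: "ys ! i \<in> Z" using Y(4) i by auto
    let ?c = "coords_mod B xs (ys ! i)"
    have 1: "ys ! i - lin_comb ?c xs \<in> B" using coords_mod_rep [OF xs yi] .
    have 2: "(\<Sum>j<length xs. ?c j *\<^sub>R (xs ! j - lin_comb (coords_mod B ys (xs ! j)) ys)) \<in> B"
      using X(4) by (intro subspace_sum [OF X(2)] subspace_scale [OF X(2)] coords_mod_rep [OF ys]) auto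
    have "(\<Sum>j<length xs. ?c j *\<^sub>R (xs ! j - lin_comb (coords_mod B ys (xs ! j)) ys)) =
        lin_comb ?c xs - lin_comb (\<lambda>k. \<Sum>j<length xs. ?c j * coords_mod B ys (xs ! j) k) ys"
      by (simp add: scaleR_diff_right sum_subtractf lin_comb_sum) (simp add: lin_comb_def)
    with subspace_add [OF X(2) 1 2]
    have "ys ! i - lin_comb (\<lambda>k. \<Sum>j<length xs. ?c j * coords_mod B ys (xs ! j) k) ys \<in> B" by simp
    from coords_mod_unique [OF ys this i]
    have "coords_mod B ys (ys ! i) i = (\<Sum>j<length xs. ?c j * coords_mod B ys (xs ! j) i)" .
    moreover have "coords_mod B ys (ys ! i) i = (if i = i then 1 else 0)"
    proof (rule coords_mod_unique [where c = "\<lambda>k. if k = i then 1 else 0", OF ys _ i])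
      have "lin_comb (\<lambda>k. if k = i then 1 else 0) ys = ys ! i"
        using i by (simp add: lin_comb_def if_distrib [of "\<lambda>c. c *\<^sub>R _"] cong: if_cong)
      then show "ys ! i - lin_comb (\<lambda>k. if k = i then 1 else 0) ys \<in> B"
        using subspace_0 [OF X(2)] by simp
    qed
    ultimately show ?thesis by simp
  qed
  have "real (length ys) = (\<Sum>i<length ys. \<Sum>j<length xs. ?P i j * ?Q j i)"
    using * [OF xs ys] by simp
  also have "\<dots> = (\<Sum>j<length xs. \<Sum>i<length ys. ?Q j i * ?P i j)"
    by (subst sum.swap) (simp add: mult.commute)
  also have "\<dots> = real (length xs)" using * [OF ys xs] by simp
  finally show ?thesis by simp
qed

section \<open>Determinants of changes of basis\<close>

lemma det_change_same: assumes "basis_mod Z B xs" shows "det_change B xs xs = 1"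
proof -
  have "Matrix.mat (length xs) (length xs) (\<lambda>(i, j). coords_mod B xs (xs ! i) j) = 1\<^sub>m (length xs)"
  proof (rule eq_matI)
    fix i j assume "i < dim_row (1\<^sub>m (length xs) :: real mat)" "j < dim_col (1\<^sub>m (length xs) :: real mat)"
    then have i: "i < length xs" and j: "j < length xs" by auto
    have "coords_mod B xs (xs ! i) j = (if j = i then 1 else 0)"
    proof (rule coords_mod_unique [OF assms _ j])
      have "lin_comb (\<lambda>k. if k = i then 1 else 0) xs = xs ! i"
        using i by (simp add: lin_comb_def if_distrib [of "\<lambda>c. c *\<^sub>R _"] cong: if_cong)
      then show "xs ! i - lin_comb (\<lambda>k. if k = i then 1 else 0) xs \<in> B"
        using subspace_0 basis_modD(2) [OF assms] by simp
    qed
    then show "Matrix.mat (length xs) (length xs) (\<lambda>(i, j). coords_mod B xs (xs ! i) j) $$ (i, j)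
        = 1\<^sub>m (length xs) $$ (i, j)" using i j by simp
  qed auto
  then show ?thesis by (simp add: det_change_def)
qed

lemma det_change_trans:
  assumes xs: "basis_mod Z B xs" and ys: "basis_mod Z B ys" and zs: "set zs \<subseteq> Z"
    and len: "length zs = length xs"
  shows "det_change B zs xs = det_change B zs ys * det_change B ys xs"
proof -
  note X = basis_modD [OF xs] and Y = basis_modD [OF ys]
  let ?n = "length xs"
  have ly: "length ys = ?n" using basis_mod_length [OF ys xs] .
  let ?M = "\<lambda>us vs. Matrix.mat ?n ?n (\<lambda>(i, j). coords_mod B vs (us ! i) j)"
  have "?M zs xs = ?M zs ys * ?M ys xs"
  proof (rule eq_matI)
    fix i j assume "i < dim_row (?M zs ys * ?M ys xs)" "j < dim_col (?M zs ys * ?M ys xs)"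
    then have i: "i < ?n" and j: "j < ?n" by auto
    let ?c = "coords_mod B ys (zs ! i)"
    have zi: "zs ! i \<in> Z" using zs i len by (metis nth_mem subsetD)
    have 1: "zs ! i - lin_comb ?c ys \<in> B" using coords_mod_rep [OF ys zi] .
    have 2: "(\<Sum>k<?n. ?c k *\<^sub>R (ys ! k - lin_comb (coords_mod B xs (ys ! k)) xs)) \<in> B"
      using Y(4) ly by (intro subspace_sum [OF X(2)] subspace_scale [OF X(2)] coords_mod_rep [OF xs]) auto
    have "(\<Sum>k<?n. ?c k *\<^sub>R (ys ! k - lin_comb (coords_mod B xs (ys ! k)) xs)) =
        lin_comb ?c ys - lin_comb (\<lambda>m. \<Sum>k<?n. ?c k * coords_mod B xs (ys ! k) m) xs"
      by (simp add: scaleR_diff_right sum_subtractf lin_comb_sum) (simp add: lin_comb_def ly)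
    with subspace_add [OF X(2) 1 2]
    have "zs ! i - lin_comb (\<lambda>m. \<Sum>k<?n. ?c k * coords_mod B xs (ys ! k) m) xs \<in> B" by simp
    from coords_mod_unique [OF xs this j]
    show "?M zs xs $$ (i, j) = (?M zs ys * ?M ys xs) $$ (i, j)"
      using i j by (simp add: scalar_prod_def atLeast0LessThan)
  qed auto
  then show ?thesis
    using det_mult [of "?M zs ys" ?n "?M ys xs"] by (simp add: det_change_def len ly)
qed

lemma det_change_nonzero:
  assumes xs: "basis_mod Z B xs" and ys: "basis_mod Z B ys"
  shows "det_change B ys xs \<noteq> 0"
proof -
  have "det_change B xs ys * det_change B ys xs = 1"
    using det_change_trans [OF xs ys basis_modD(4) [OF xs]] det_change_same [OF xs] by simp
  then show ?thesis by auto
qed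

text \<open>Vectors of \<open>A\<close> have no coordinates along \<open>ys\<close>, so the matrix
  is block triangular. The lower right block consists of coordinates modulo \<open>A\<close>,
  because the part along \<open>xs\<close> lies in \<open>A\<close>; the lower left block is
  arbitrary.\<close>

lemma det_change_append:
  assumes xs: "basis_mod A B xs" and ys: "basis_mod Z A ys"
    and xs': "set xs' \<subseteq> A" "length xs' = length xs" and ys': "set ys' \<subseteq> Z" "length ys' = length ys"
  shows "det_change B (xs' @ ys') (xs @ ys) = det_change B xs' xs * det_change A ys' ys"
proof -
  note X = basis_modD [OF xs] and Y = basis_modD [OF ys]
  let ?n = "length xs" and ?m = "length ys"
  have bas: "basis_mod Z B (xs @ ys)" using basis_mod_append [OF xs ys] .
  let ?M = "Matrix.mat (?n + ?m) (?n + ?m) (\<lambda>(i, j). coords_mod B (xs @ ys) ((xs' @ ys') ! i) j)"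
  let ?A = "Matrix.mat ?n ?n (\<lambda>(i, j). coords_mod B xs (xs' ! i) j)"
  let ?D = "Matrix.mat ?m ?m (\<lambda>(i, j). coords_mod A ys (ys' ! i) j)"
  let ?C = "Matrix.mat ?m ?n (\<lambda>(i, j). coords_mod B (xs @ ys) (ys' ! i) j)"
  have "?M = four_block_mat ?A (0\<^sub>m ?n ?m) ?C ?D"
  proof (rule eq_matI)
    fix i j assume "i < dim_row (four_block_mat ?A (0\<^sub>m ?n ?m) ?C ?D)"
      "j < dim_col (four_block_mat ?A (0\<^sub>m ?n ?m) ?C ?D)"
    then have i: "i < ?n + ?m" and j: "j < ?n + ?m" by auto
    have 1: "coords_mod B (xs @ ys) (xs' ! i) j = (if j < ?n then coords_mod B xs (xs' ! i) j else 0)"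
      if "i < ?n"
    proof (rule coords_mod_unique [OF bas])
      let ?c = "\<lambda>j. if j < ?n then coords_mod B xs (xs' ! i) j else 0"
      have "lin_comb ?c (xs @ ys) = lin_comb (coords_mod B xs (xs' ! i)) xs"
        by (simp add: lin_comb_append cong: lin_comb_cong) (simp add: lin_comb_def)
      moreover have "xs' ! i \<in> A" using xs' that by (metis nth_mem subsetD)
      ultimately show "xs' ! i - lin_comb ?c (xs @ ys) \<in> B" using coords_mod_rep [OF xs] by simp
    qed (use j in simp)
    have 2: "coords_mod A ys (ys' ! k) l = coords_mod B (xs @ ys) (ys' ! k) (?n + l)"
      if "k < ?m" "l < ?m" for k l
    proof (rule coords_mod_unique [OF ys _ that(2)])
      let ?c = "coords_mod B (xs @ ys) (ys' ! k)"
      have "ys' ! k \<in> Z" using ys' that by (metis nth_mem subsetD)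
      then have "ys' ! k - lin_comb ?c (xs @ ys) \<in> A" using coords_mod_rep [OF bas] X(3) by blast
      from subspace_add [OF X(1) this lin_comb_in_subspace [OF X(1,4), of ?c]]
      show "ys' ! k - lin_comb (\<lambda>l. ?c (?n + l)) ys \<in> A" by (simp add: lin_comb_append)
    qed
    show "?M $$ (i, j) = four_block_mat ?A (0\<^sub>m ?n ?m) ?C ?D $$ (i, j)"
      using i j 1 2 [of "i - ?n" "j - ?n"] xs'(2) by (auto simp: nth_append)
  qed auto
  then have "Determinant.det ?M = Determinant.det ?A * Determinant.det ?D"
    using det_four_block_mat_upper_right_zero [of ?A ?n "0\<^sub>m ?n ?m" ?m ?C ?D] by simp
  then show ?thesis by (simp add: det_change_def)
qed

lemma det_change_quot_iso:
  assumes f: "quot_iso f Z B Z' B'" and xs: "basis_mod Z B xs"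
    and ys: "set ys \<subseteq> Z" "length ys = length xs"
  shows "det_change B' (map f ys) (map f xs) = det_change B ys xs"
proof -
  have "Matrix.mat (length xs) (length xs) (\<lambda>(i, j). coords_mod B' (map f xs) (map f ys ! i) j)
      = Matrix.mat (length xs) (length xs) (\<lambda>(i, j). coords_mod B xs (ys ! i) j)"
  proof (rule eq_matI)
    fix i j assume "i < dim_row (Matrix.mat (length xs) (length xs) (\<lambda>(i, j). coords_mod B xs (ys ! i) j))"
      "j < dim_col (Matrix.mat (length xs) (length xs) (\<lambda>(i, j). coords_mod B xs (ys ! i) j))"
    then have i: "i < length xs" and j: "j < length xs" by auto
    have "ys ! i \<in> Z" using ys i by (metis nth_mem subsetD)
    from quot_iso_coords [OF f xs this j] i j ys(2)
    show "Matrix.mat (length xs) (length xs) (\<lambda>(i, j). coords_mod B' (map f xs) (map f ys ! i) j) $$ (i, j)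
      = Matrix.mat (length xs) (length xs) (\<lambda>(i, j). coords_mod B xs (ys ! i) j) $$ (i, j)" by simp
  qed auto
  then show ?thesis by (simp add: det_change_def)
qed

text \<open>A permutation of rows costs a sign, which the absolute value in the torsion removes.
  Hence concatenated bases may be regrouped freely.\<close>

lemma abs_det_change_mset:
  assumes "mset ys = mset ys'" and "length ys = length xs"
  shows "\<bar>det_change B ys xs\<bar> = \<bar>det_change B ys' xs\<bar>"
proof -
  let ?n = "length xs"
  have len: "length ys' = ?n" using assms by (metis size_mset)
  obtain p where p: "p permutes {..<length ys'}" "permute_list p ys' = ys"
    using mset_eq_permutation [OF assms(1)] by blast
  have p': "p permutes {0..<?n}" using p(1) len by (simp add: atLeast0LessThan)
  let ?A = "Matrix.mat ?n ?n (\<lambda>(i, j). coords_mod B xs (ys' ! i) j)"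
  have "Matrix.mat ?n ?n (\<lambda>(i, j). coords_mod B xs (ys ! i) j) = Matrix.mat ?n ?n (\<lambda>(i, j). ?A $$ (p i, j))"
  proof (rule eq_matI)
    fix i j assume "i < dim_row (Matrix.mat ?n ?n (\<lambda>(i, j). ?A $$ (p i, j)))"
      "j < dim_col (Matrix.mat ?n ?n (\<lambda>(i, j). ?A $$ (p i, j)))"
    then have i: "i < ?n" and j: "j < ?n" by auto
    have pi: "p i < ?n" using permutes_in_image [OF p', of i] i by simp
    have "ys ! i = ys' ! p i" using permute_list_nth [OF p(1), of i] i len p(2) by simp
    then show "Matrix.mat ?n ?n (\<lambda>(i, j). coords_mod B xs (ys ! i) j) $$ (i, j) =
        Matrix.mat ?n ?n (\<lambda>(i, j). ?A $$ (p i, j)) $$ (i, j)" using i j pi by simp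
  qed auto
  then have "Determinant.det (Matrix.mat ?n ?n (\<lambda>(i, j). coords_mod B xs (ys ! i) j))
      = signof p * Determinant.det ?A"
    using det_permute_rows [of ?A ?n, OF _ p'] by simp
  moreover have "\<bar>signof p :: real\<bar> = 1" by (simp add: sign_def)
  ultimately show ?thesis by (simp add: det_change_def abs_mult)
qed

lemma basis_mod_mset:
  assumes "basis_mod Z B xs" and "mset ys = mset xs"
  shows "basis_mod Z B ys"
proof -
  note X = basis_modD [OF assms(1)]
  have len: "length ys = length xs" using assms(2) by (metis size_mset)
  obtain p where p: "p permutes {..<length xs}" "permute_list p xs = ys"
    using mset_eq_permutation [OF assms(2)] by blast
  have nth: "ys ! i = xs ! p i" if "i < length xs" for i
    using permute_list_nth [OF p(1) that] p(2) by simp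
  have eq: "lin_comb (c \<circ> p) ys = lin_comb c xs" for c
    unfolding lin_comb_def len using sum.permute [OF p(1), of "\<lambda>i. c i *\<^sub>R xs ! i"]
    by (simp add: o_def nth)
  have "set ys = set xs" using assms(2) by (metis set_mset_mset)
  moreover have "\<exists>c. z - lin_comb c ys \<in> B" if "z \<in> Z" for z
    using X(5) [OF that] eq by metis
  moreover have "c i = 0" if c: "lin_comb c ys \<in> B" and i: "i < length ys" for c i
  proof -
    have "lin_comb ((c \<circ> inv_into UNIV p) \<circ> p) ys \<in> B"
      using c permutes_inverses(2) [OF p(1)] by (simp add: comp_def)
    then have "lin_comb (c \<circ> inv_into UNIV p) xs \<in> B" by (simp add: eq)
    moreover have "p i < length xs" using permutes_in_image [OF p(1), of i] i len by simp
    ultimately have "(c \<circ> inv_into UNIV p) (p i) = 0" using X(6) by blast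
    then show ?thesis using permutes_inverses(2) [OF p(1)] by simp
  qed
  ultimately show ?thesis using X unfolding basis_mod_iff by metis
qed

section \<open>Bases inside generating lists\<close>

lemma lin_comb_remove:
  assumes i: "i < length ys" and "e i = 0"
  shows "lin_comb e ys = lin_comb (\<lambda>j. if j < i then e j else e (Suc j)) (take i ys @ drop (Suc i) ys)"
proof -
  have "lin_comb e ys = lin_comb e (take i ys @ ([ys ! i] @ drop (Suc i) ys))"
    using id_take_nth_drop [OF i] by simp
  also have "\<dots> = lin_comb e (take i ys) + lin_comb (\<lambda>j. e (i + j)) ([ys ! i] @ drop (Suc i) ys)"
    unfolding lin_comb_append [of _ "take i ys"] using i by (simp only: length_take min_absorb2 less_imp_le)
  also have "lin_comb (\<lambda>j. e (i + j)) ([ys ! i] @ drop (Suc i) ys) = lin_comb (\<lambda>j. e (i + Suc j)) (drop (Suc i) ys)"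
    unfolding lin_comb_append using assms(2) by (simp add: lin_comb_def)
  also have "lin_comb e (take i ys) + \<dots>
      = lin_comb (\<lambda>j. if j < i then e j else e (Suc j)) (take i ys @ drop (Suc i) ys)"
    using i unfolding lin_comb_append by (simp add: lin_comb_def min_absorb2)
  finally show ?thesis .
qed

text \<open>A shortest generating list with entries from \<open>xs\<close> is independent, since an
  entry with nonzero coefficient in a relation could be dropped.\<close>

lemma basis_mod_extract:
  assumes Z: "subspace Z" "subspace B" "B \<subseteq> Z" and xs: "set xs \<subseteq> Z"
    and gen: "\<And>z. z \<in> Z \<Longrightarrow> \<exists>c. z - lin_comb c xs \<in> B"
  shows "\<exists>ys. set ys \<subseteq> set xs \<and> basis_mod Z B ys"
proof -
  define P where "P ys \<longleftrightarrow> set ys \<subseteq> set xs \<and> (\<forall>z\<in>Z. \<exists>c. z - lin_comb c ys \<in> B)" for ys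
  have "P xs" using gen by (simp add: P_def)
  then obtain ys where ys: "P ys" and min: "\<And>zs. P zs \<Longrightarrow> length ys \<le> length zs"
    using arg_min_nat_lemma [of P xs length] by blast
  have "c i = 0" if c: "lin_comb c ys \<in> B" and i: "i < length ys" for c i
  proof (rule ccontr)
    assume ci: "c i \<noteq> 0"
    let ?zs = "take i ys @ drop (Suc i) ys"
    have "\<exists>e. z - lin_comb e ?zs \<in> B" if z: "z \<in> Z" for z
    proof -
      obtain d where d: "z - lin_comb d ys \<in> B"
        using ys z unfolding P_def by blast
      \<comment> \<open>The multiple of the relation is chosen to cancel the coefficient at position
        \<open>i\<close>.\<close>
      let ?e = "\<lambda>j. d j - d i / c i * c j"
      have "z - lin_comb d ys + (d i / c i) *\<^sub>R lin_comb c ys \<in> B"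
        using d c by (intro subspace_add [OF Z(2)] subspace_scale [OF Z(2)])
      moreover have "(d i / c i) *\<^sub>R lin_comb c ys = lin_comb (\<lambda>j. d i / c i * c j) ys"
        using lin_comb_sum [of "\<lambda>_. d i / c i" "\<lambda>_. c" ys "{0::nat}"] by simp
      ultimately have e: "z - lin_comb ?e ys \<in> B"
        by (simp add: lin_comb_diff algebra_simps)
      have "?e i = 0" using ci by simp
      from e [unfolded lin_comb_remove [where e = ?e, OF i this]] show ?thesis
        by (rule exI [where P = "\<lambda>e. z - lin_comb e ?zs \<in> B"])
    qed
    moreover have "set ?zs \<subseteq> set xs"
      using ys set_take_subset [of i ys] set_drop_subset [of "Suc i" ys] unfolding P_def by auto
    ultimately have "P ?zs" unfolding P_def by blast
    from min [OF this] i show False by simp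
  qed
  with ys xs Z show ?thesis unfolding P_def basis_mod_iff by blast
qed

text \<open>Gives the lists \<open>b\<close> of the torsion: with \<open>f\<close> the differential,
  preimages of a basis of the boundaries are found among the given chain basis.\<close>

lemma basis_mod_extract_map:
  assumes Z: "subspace Z" "subspace B" "B \<subseteq> Z" and xs: "f ` set xs \<subseteq> Z"
    and gen: "\<And>z. z \<in> Z \<Longrightarrow> \<exists>c. z - lin_comb c (map f xs) \<in> B"
  shows "\<exists>ys. set ys \<subseteq> set xs \<and> basis_mod Z B (map f ys)"
proof -
  obtain zs where zs: "set zs \<subseteq> f ` set xs" "basis_mod Z B zs"
    using basis_mod_extract [OF Z, of "map f xs"] xs gen by auto
  define ys where "ys = map (inv_into (set xs) f) zs"
  have "map f ys = zs" using zs(1) by (auto simp: ys_def f_inv_into_f intro!: map_idI)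
  moreover have "set ys \<subseteq> set xs" using zs(1) by (auto simp: ys_def intro: inv_into_into)
  ultimately show ?thesis using zs(2) by blast
qed

section \<open>Torsion under change of bases\<close>

definition torsion_lift :: "'s::real_vector qcomplex \<Rightarrow> (nat \<Rightarrow> 's list) \<Rightarrow> bool" where
  "torsion_lift D b \<longleftrightarrow> b 0 = [] \<and> (\<forall>q. set (b q) \<subseteq> num D q) \<and>
     (\<forall>q. basis_mod (boundaries D q) (den D q) (map (dif D (Suc q)) (b (Suc q))))"

definition torsion_prod ::
  "'s::real_vector qcomplex \<Rightarrow> (nat \<Rightarrow> 's list) \<Rightarrow> (nat \<Rightarrow> 's list) \<Rightarrow> (nat \<Rightarrow> 's list) \<Rightarrow> real" where
  "torsion_prod D c h b = (\<Prod>q\<le>top_deg D.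
     \<bar>det_change (den D q) (map (dif D (Suc q)) (b (Suc q)) @ h q @ b q) (c q)\<bar> powi ((-1) ^ q))"

lemma has_R_torsion_iff:
  "has_R_torsion D c h t \<longleftrightarrow> (\<exists>b. torsion_lift D b \<and> t = torsion_prod D c h b)"
  by (simp add: has_R_torsion_def torsion_lift_def torsion_prod_def conj_assoc)

text \<open>That boundaries are cycles is contained in \<open>homology_basis\<close>. Differentials
  are constrained in positive degrees only, as degree 0 has no target. Chains above
  \<open>top_deg\<close> vanish modulo \<open>den\<close>, so that the finite product in the torsion
  misses no factor.\<close>

definition based_complex ::
  "'s::real_vector qcomplex \<Rightarrow> (nat \<Rightarrow> 's list) \<Rightarrow> (nat \<Rightarrow> 's list) \<Rightarrow> bool" where
  "based_complex D c h \<longleftrightarrow>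
     (\<forall>q. basis_mod (num D q) (den D q) (c q)) \<and> (\<forall>q. homology_basis D q (h q)) \<and>
     (\<forall>q. linear (dif D (Suc q)) \<and> dif D (Suc q) ` num D (Suc q) \<subseteq> num D q \<and>
        dif D (Suc q) ` den D (Suc q) \<subseteq> den D q) \<and>
     (\<forall>q>top_deg D. num D q = den D q)"

lemma based_complexD:
  assumes "based_complex D c h"
  shows "basis_mod (num D q) (den D q) (c q)" "basis_mod (cycles D q) (boundaries D q) (h q)"
    "linear (dif D (Suc q))" "dif D (Suc q) ` num D (Suc q) \<subseteq> num D q"
    "dif D (Suc q) ` den D (Suc q) \<subseteq> den D q" "q > top_deg D \<Longrightarrow> num D q = den D q"
    "subspace (num D q)" "subspace (den D q)" "den D q \<subseteq> num D q"
    "subspace (cycles D q)" "subspace (boundaries D q)" "boundaries D q \<subseteq> cycles D q"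
proof -
  show 1: "basis_mod (num D q) (den D q) (c q)" and 2: "basis_mod (cycles D q) (boundaries D q) (h q)"
    using assms by (auto simp: based_complex_def homology_basis_def)
  show "linear (dif D (Suc q))" "dif D (Suc q) ` num D (Suc q) \<subseteq> num D q"
    "dif D (Suc q) ` den D (Suc q) \<subseteq> den D q" "q > top_deg D \<Longrightarrow> num D q = den D q"
    using assms by (simp_all add: based_complex_def)
  show "subspace (num D q)" "subspace (den D q)" "den D q \<subseteq> num D q" by (rule basis_modD [OF 1])+
  show "subspace (cycles D q)" "subspace (boundaries D q)" "boundaries D q \<subseteq> cycles D q"
    by (rule basis_modD [OF 2])+
qed

lemma cycles_subset: "cycles D q \<subseteq> num D q"
  by (auto simp: cycles_def)

lemma den_subset_boundaries: "based_complex D c h \<Longrightarrow> den D q \<subseteq> boundaries D q"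
proof
  fix r assume D: "based_complex D c h" and r: "r \<in> den D q"
  have "0 \<in> num D (Suc q)" using subspace_0 [OF based_complexD(7) [OF D]] .
  moreover have "r = dif D (Suc q) 0 + r" using linear_0 [OF based_complexD(3) [OF D]] by simp
  ultimately show "r \<in> boundaries D q" using r unfolding boundaries_def by blast
qed

text \<open>The homomorphism theorem for the differential: chains modulo cycles correspond to the
  boundaries one degree lower. It moves bases and determinants between neighbouring degrees.\<close>

lemma quot_iso_dif:
  assumes D: "based_complex D c h"
  shows "quot_iso (dif D (Suc q)) (num D (Suc q)) (cycles D (Suc q)) (boundaries D q) (den D q)"
proof -
  have "dif D (Suc q) y \<in> boundaries D q" if "y \<in> num D (Suc q)" for y
  proof -
    have "dif D (Suc q) y = dif D (Suc q) y + 0" by simp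
    with that show ?thesis
      using subspace_0 [OF based_complexD(8) [OF D]] unfolding boundaries_def by blast
  qed
  moreover have "\<exists>y\<in>num D (Suc q). z - dif D (Suc q) y \<in> den D q" if "z \<in> boundaries D q" for z
    using that by (force simp: boundaries_def)
  moreover have mem: "dif D (Suc q) z \<in> den D q \<longleftrightarrow> z \<in> cycles D (Suc q)" if "z \<in> num D (Suc q)" for z
    using that by (simp add: cycles_def)
  ultimately show ?thesis
    using based_complexD [OF D] den_subset_boundaries [OF D] cycles_subset [of D]
      mem
    unfolding quot_iso_def by auto
qed

text \<open>A lift of a basis of boundaries complements the cycles, by pulling back along the
  isomorphism induced by the differential. In degree 0 every chain is a cycle, which matches
  \<open>b 0 = []\<close>.\<close>

lemma torsion_liftD:
  assumes D: "based_complex D c h" and b: "torsion_lift D b"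
  shows "basis_mod (boundaries D q) (den D q) (map (dif D (Suc q)) (b (Suc q)))"
    "basis_mod (num D q) (cycles D q) (b q)" "b 0 = []"
proof -
  show 1: "basis_mod (boundaries D q) (den D q) (map (dif D (Suc q)) (b (Suc q)))" for q
    using b unfolding torsion_lift_def by blast
  show b0: "b 0 = []" using b unfolding torsion_lift_def by blast
  show "basis_mod (num D q) (cycles D q) (b q)"
  proof (cases q)
    case 0
    have "cycles D 0 = num D 0" by (auto simp: cycles_def)
    then show ?thesis using b0 0 based_complexD(7) [OF D] by (auto simp: basis_mod_iff intro: exI)
  next
    case (Suc p)
    have "set (b q) \<subseteq> num D q" using b unfolding torsion_lift_def by blast
    then show ?thesis using 1 [of p] quot_iso_basis_mod [OF quot_iso_dif [OF D]] Suc by blast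
  qed
qed

lemma torsion_lift_basis:
  assumes D: "based_complex D c h" and b: "torsion_lift D b"
  shows "basis_mod (num D q) (den D q) (map (dif D (Suc q)) (b (Suc q)) @ h q @ b q)"
  using basis_mod_append basis_mod_append torsion_liftD [OF D b] based_complexD(2) [OF D] by metis

lemma torsion_lift_exists:
  assumes D: "based_complex D c h"
  shows "\<exists>b. torsion_lift D b"
proof -
  have "\<exists>ys. set ys \<subseteq> set (c (Suc q)) \<and> basis_mod (boundaries D q) (den D q) (map (dif D (Suc q)) ys)" for q
  proof (rule basis_mod_extract_map)
    note B = based_complexD [OF D]
    note c = basis_modD [OF B(1)]
    show "dif D (Suc q) ` set (c (Suc q)) \<subseteq> boundaries D q"
      using quot_iso_dif [OF D] c(4) unfolding quot_iso_def by blast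
    fix z assume "z \<in> boundaries D q"
    then obtain y r where y: "y \<in> num D (Suc q)" "r \<in> den D q" "z = dif D (Suc q) y + r"
      unfolding boundaries_def by blast
    obtain e where e: "y - lin_comb e (c (Suc q)) \<in> den D (Suc q)" using c(5) [OF y(1)] by blast
    then have "dif D (Suc q) (y - lin_comb e (c (Suc q))) \<in> den D q" using B(5) by blast
    from subspace_add [OF B(8) this y(2)]
    have "z - lin_comb e (map (dif D (Suc q)) (c (Suc q))) \<in> den D q"
      by (simp add: y(3) lin_comb_map [OF B(3)] linear_diff [OF B(3)] algebra_simps)
    then show "\<exists>e. z - lin_comb e (map (dif D (Suc q)) (c (Suc q))) \<in> den D q" by blast
  qed (use based_complexD [OF D] den_subset_boundaries [OF D] in auto)
  then obtain f where f: "\<And>q. set (f q) \<subseteq> set (c (Suc q))"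
    "\<And>q. basis_mod (boundaries D q) (den D q) (map (dif D (Suc q)) (f q))" by metis
  have "set (case_nat [] f q) \<subseteq> num D q" for q
    using f(1) basis_modD(4) [OF based_complexD(1) [OF D]] by (auto split: nat.split)
  then have "torsion_lift D (case_nat [] f)"
    using f by (auto simp: torsion_lift_def)
  then show ?thesis by blast
qed

lemma prod_telescope_powi:
  fixes \<beta> :: "nat \<Rightarrow> real"
  assumes "\<And>q. \<beta> q \<noteq> 0"
  shows "(\<Prod>q\<le>n. (\<beta> (Suc q) * \<beta> q) powi ((-1) ^ q)) = \<beta> 0 * \<beta> (Suc n) powi ((-1) ^ n)"
proof (induction n)
  case 0 then show ?case by simp
next
  case (Suc n)
  have "\<beta> (Suc n) powi ((-1) ^ n) * \<beta> (Suc n) powi ((-1) ^ Suc n) = 1"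
    using assms by (simp add: power_int_minus)
  moreover have gen: "x * y * (z * w) = x * z * (y * w)" for x y z w :: real
    by simp
  ultimately have "\<beta> 0 * \<beta> (Suc n) powi ((-1) ^ n) * (\<beta> (Suc (Suc n)) powi ((-1) ^ Suc n) * \<beta> (Suc n) powi ((-1) ^ Suc n))
      = \<beta> 0 * \<beta> (Suc (Suc n)) powi ((-1) ^ Suc n)"
    by (subst gen) (simp only: mult_1_right)
  then show ?case by (simp only: prod.atMost_Suc Suc.IH) (simp only: power_int_mult_distrib)
qed

text \<open>Replacing \<open>b q\<close> multiplies the determinants in degrees \<open>q\<close> and \<open>q - 1\<close> by the same number,
  which cancels because they enter with opposite exponents.\<close>

lemma torsion_prod_change:
  assumes D: "based_complex D c h" and D': "based_complex D c h'"
    and b: "torsion_lift D b" and b': "torsion_lift D b'"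
  shows "torsion_prod D c h' b' = torsion_prod D c h b *
    (\<Prod>q\<le>top_deg D. \<bar>det_change (boundaries D q) (h' q) (h q)\<bar> powi ((-1) ^ q))"
proof -
  note B = torsion_liftD [OF D b] and B' = torsion_liftD [OF D' b']
  define \<beta> where "\<beta> q = \<bar>det_change (cycles D q) (b' q) (b q)\<bar>" for q
  let ?H = "\<lambda>q. \<bar>det_change (boundaries D q) (h' q) (h q)\<bar>"
  let ?T = "\<lambda>h b q. \<bar>det_change (den D q) (map (dif D (Suc q)) (b (Suc q)) @ h q @ b q) (c q)\<bar>"
  have nz: "\<beta> q \<noteq> 0" for q using det_change_nonzero [OF B(2) B'(2)] by (simp add: \<beta>_def)
  \<comment> \<open>The differential identifies chains modulo cycles with boundaries, so it carries
    the determinant of a change of lifts one degree down.\<close>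
  have \<beta>_Suc: "\<bar>det_change (den D q) (map (dif D (Suc q)) (b' (Suc q))) (map (dif D (Suc q)) (b (Suc q)))\<bar>
      = \<beta> (Suc q)" for q
    unfolding \<beta>_def using basis_modD(4) [OF B'(2)] basis_mod_length [OF B'(2) B(2)]
    by (subst det_change_quot_iso [OF quot_iso_dif [OF D] B(2)]) auto
  have step: "?T h' b' q = ?T h b q * (\<beta> (Suc q) * \<beta> q) * ?H q" for q
  proof -
    let ?v = "map (dif D (Suc q)) (b (Suc q))" and ?v' = "map (dif D (Suc q)) (b' (Suc q))"
    note h = based_complexD(2) [OF D, of q] and h' = based_complexD(2) [OF D', of q]
    have hb: "basis_mod (num D q) (boundaries D q) (h q @ b q)" by (rule basis_mod_append [OF h B(2)])
    have hb': "basis_mod (num D q) (boundaries D q) (h' q @ b' q)" by (rule basis_mod_append [OF h' B'(2)])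
    have "?T h' b' q = \<bar>det_change (den D q) (?v' @ h' q @ b' q) (?v @ h q @ b q)\<bar> * ?T h b q"
      using det_change_trans [OF based_complexD(1) [OF D] torsion_lift_basis [OF D b]
          basis_modD(4) [OF torsion_lift_basis [OF D' b']]]
        basis_mod_length [OF torsion_lift_basis [OF D' b'] based_complexD(1) [OF D]]
      by (simp add: abs_mult)
    also have "det_change (den D q) (?v' @ h' q @ b' q) (?v @ h q @ b q)
        = det_change (den D q) ?v' ?v * det_change (boundaries D q) (h' q @ b' q) (h q @ b q)"
      by (rule det_change_append [OF B(1) hb basis_modD(4) [OF B'(1)] basis_mod_length [OF B'(1) B(1)]
            basis_modD(4) [OF hb'] basis_mod_length [OF hb' hb]])
    also have "det_change (boundaries D q) (h' q @ b' q) (h q @ b q)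
        = det_change (boundaries D q) (h' q) (h q) * det_change (cycles D q) (b' q) (b q)"
      by (rule det_change_append [OF h B(2) basis_modD(4) [OF h'] basis_mod_length [OF h' h]
            basis_modD(4) [OF B'(2)] basis_mod_length [OF B'(2) B(2)]])
    finally show ?thesis by (simp add: abs_mult \<beta>_Suc) (simp add: \<beta>_def)
  qed
  have \<beta>0: "\<beta> 0 = 1"
    using B(3) B'(3) by (simp add: \<beta>_def det_change_def)
  \<comment> \<open>Above the top degree all chains are cycles, hence both lifts are empty and the
    telescoping product has no end term.\<close>
  have \<beta>n: "\<beta> (Suc (top_deg D)) = 1"
  proof -
    let ?n = "Suc (top_deg D)"
    have "num D ?n = cycles D ?n"
      using based_complexD(6,9,12) [OF D, of ?n] den_subset_boundaries [OF D, of ?n] cycles_subset [of D ?n]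
      by auto
    then have "b ?n = []" "b' ?n = []"
      using basis_mod_eq_Nil B(2) [of ?n] B'(2) [of ?n] by metis+
    then show ?thesis by (simp add: \<beta>_def det_change_def)
  qed
  have "torsion_prod D c h' b' = torsion_prod D c h b * (\<Prod>q\<le>top_deg D. (\<beta> (Suc q) * \<beta> q) powi ((-1) ^ q))
      * (\<Prod>q\<le>top_deg D. ?H q powi ((-1) ^ q))"
    by (simp only: torsion_prod_def step power_int_mult_distrib prod.distrib)
  then show ?thesis
    by (simp only: prod_telescope_powi [of \<beta>, OF nz] \<beta>0 \<beta>n power_int_1_left mult_1_left mult_1_right)
qed

text \<open>The change formula with equal homology bases shows independence of the lift, which gives
  the definite description in \<open>R_torsion\<close> its unique value.\<close>

lemma R_torsion_eq:
  assumes D: "based_complex D c h" and b: "torsion_lift D b"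
  shows "R_torsion D c h = torsion_prod D c h b"
proof -
  have "torsion_prod D c h b' = torsion_prod D c h b" if "torsion_lift D b'" for b'
    using torsion_prod_change [OF D D b that] by (simp add: det_change_same [OF based_complexD(2) [OF D]])
  then have "has_R_torsion D c h t \<longleftrightarrow> t = torsion_prod D c h b" for t
    unfolding has_R_torsion_iff using b by metis
  then show ?thesis by (simp add: R_torsion_def)
qed

section \<open>Torsion of a split sequence of complexes\<close>

lemma prod_atMost_triples:
  fixes f :: "nat \<Rightarrow> real" and n :: nat
  shows "(\<Prod>k\<le>3 * n + 2. f k) = (\<Prod>q\<le>n. f (3 * q) * f (3 * q + 1) * f (3 * q + 2))"
proof (induction n)
  case 0 then show ?case by (simp add: numeral_2_eq_2)
next
  case (Suc n)
  have "3 * Suc n + 2 = Suc (Suc (Suc (3 * n + 2)))" by simp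
  then show ?case by (simp only: prod.atMost_Suc Suc.IH) (simp add: eval_nat_numeral)
qed

text \<open>In the application \<open>r\<close> restricts chains to the cells off the cone.
  \<open>Y\<close> lies in \<open>X\<close> degree by degree without being a subcomplex: its
  differential is \<open>r \<circ> d\<close>. The splitting is thus one of graded spaces, and the
  failure of \<open>d\<close> to preserve \<open>Y\<close> is the connecting homomorphism.\<close>

locale split_sequence =
  fixes d r :: "'s::real_vector \<Rightarrow> 's" and X Y C :: "nat \<Rightarrow> 's set" and n :: nat
  assumes lin_d: "linear d" and lin_r: "linear r"
    and X: "subspace (X q)" and Y: "subspace (Y q)"
    and dX: "x \<in> X (Suc q) \<Longrightarrow> d x \<in> X q"
    and rX: "x \<in> X q \<Longrightarrow> r x \<in> Y q"
    and YX: "y \<in> Y q \<Longrightarrow> y \<in> X q" and rY: "y \<in> Y q \<Longrightarrow> r y = y"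
    and C_eq: "C q = {x \<in> X q. r x = 0}"
    and dC: "x \<in> C (Suc q) \<Longrightarrow> d x \<in> C q"
    and X_top: "q > n \<Longrightarrow> X q = {0}"
begin

definition cX :: "'s qcomplex" where
  "cX = \<lparr>num = X, den = (\<lambda>_. {0}), dif = (\<lambda>_. d), top_deg = n\<rparr>"

definition cC :: "'s qcomplex" where
  "cC = \<lparr>num = C, den = (\<lambda>_. {0}), dif = (\<lambda>_. d), top_deg = n\<rparr>"

definition cY :: "'s qcomplex" where
  "cY = \<lparr>num = Y, den = (\<lambda>_. {0}), dif = (\<lambda>_ z. r (d z)), top_deg = n\<rparr>"

text \<open>Written exactly as \<open>long_exact\<close>, so that the two coincide by unfolding once
  the three complexes are identified.\<close>

definition les :: "'s qcomplex" where
  "les = (let D = (\<lambda>k. if k mod 3 = 0 then cY else if k mod 3 = 1 then cX else cC)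
      in \<lparr>num = (\<lambda>k. cycles (D k) (k div 3)), den = (\<lambda>k. boundaries (D k) (k div 3)),
          dif = (\<lambda>k z. if k mod 3 = 0 then d z else if k mod 3 = 1 then r z else z),
          top_deg = 3 * n + 2\<rparr>)"

lemma cycles_eq:
  "cycles cX q = {z \<in> X q. q = 0 \<or> d z = 0}" "cycles cC q = {z \<in> C q. q = 0 \<or> d z = 0}"
  "cycles cY q = {z \<in> Y q. q = 0 \<or> r (d z) = 0}"
  by (simp_all add: cycles_def cX_def cC_def cY_def)

lemma boundaries_eq:
  "boundaries cX q = d ` X (Suc q)" "boundaries cC q = d ` C (Suc q)"
  "boundaries cY q = (\<lambda>y. r (d y)) ` Y (Suc q)"
  by (auto simp: boundaries_def cX_def cC_def cY_def)

lemma r_diff: "x \<in> X q \<Longrightarrow> x - r x \<in> C q"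
  using rX [of x q] rY [OF rX, of x q] YX [OF rX, of x q] subspace_diff [OF X] linear_diff [OF lin_r]
  by (auto simp: C_eq)

lemma CX: "x \<in> C q \<Longrightarrow> x \<in> X q"
  using C_eq by blast

lemma C: "subspace (C q)"
  unfolding C_eq subspace_def using X [of q] linear_0 [OF lin_r] linear_add [OF lin_r] linear_cmul [OF lin_r]
  by (auto simp: subspace_def)

text \<open>As \<open>x - r x\<close> lies in the subcomplex \<open>C\<close>, which
  \<open>r\<close> kills, \<open>r\<close> is a chain map from \<open>X\<close> to
  \<open>Y\<close>.\<close>

lemma r_d_r: "x \<in> X (Suc q) \<Longrightarrow> r (d (r x)) = r (d x)"
  using dC [OF r_diff, of x q] C_eq [of q] linear_diff [OF lin_d] linear_diff [OF lin_r] by auto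

lemma r_0: "x \<in> C q \<Longrightarrow> r x = 0"
  using C_eq by blast

lemma les_simps:
  "num les (3 * q) = cycles cY q" "den les (3 * q) = boundaries cY q"
  "num les (Suc (3 * q)) = cycles cX q" "den les (Suc (3 * q)) = boundaries cX q"
  "num les (Suc (Suc (3 * q))) = cycles cC q" "den les (Suc (Suc (3 * q))) = boundaries cC q"
  "dif les (3 * q) = d" "dif les (Suc (3 * q)) = r" "dif les (Suc (Suc (3 * q))) = (\<lambda>z. z)"
  "dif les (Suc (Suc (Suc (3 * q)))) = d"
  "top_deg les = 3 * n + 2"
proof -
  have "3 * q mod 3 = 0" "Suc (3 * q) mod 3 = 1" "Suc (Suc (3 * q)) mod 3 = 2" by presburger+
  moreover have "3 * q div 3 = q" "Suc (3 * q) div 3 = q" "Suc (Suc (3 * q)) div 3 = q" by presburger+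
  moreover have "Suc (Suc (Suc (3 * q))) mod 3 = 0" by presburger
  ultimately show "num les (3 * q) = cycles cY q" "den les (3 * q) = boundaries cY q"
  "num les (Suc (3 * q)) = cycles cX q" "den les (Suc (3 * q)) = boundaries cX q"
  "num les (Suc (Suc (3 * q))) = cycles cC q" "den les (Suc (Suc (3 * q))) = boundaries cC q"
  "dif les (3 * q) = d" "dif les (Suc (3 * q)) = r" "dif les (Suc (Suc (3 * q))) = (\<lambda>z. z)"
  "dif les (Suc (Suc (Suc (3 * q)))) = d"
  "top_deg les = 3 * n + 2"
    by (simp_all add: les_def)
qed

lemma les_Suc3: "num les (Suc (Suc (Suc (3 * q)))) = cycles cY (Suc q)"
  "den les (Suc (Suc (Suc (3 * q)))) = boundaries cY (Suc q)"
proof -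
  have *: "3 * Suc q = Suc (Suc (Suc (3 * q)))" by simp
  show "num les (Suc (Suc (Suc (3 * q)))) = cycles cY (Suc q)"
    "den les (Suc (Suc (Suc (3 * q)))) = boundaries cY (Suc q)"
    by (rule les_simps(1,2) [of "Suc q", unfolded *])+
qed

lemma nat_mod3_cases:
  obtains q where "k = 3 * q" | q where "k = Suc (3 * q)" | q where "k = Suc (Suc (3 * q))"
proof -
  have "k = 3 * (k div 3) \<or> k = Suc (3 * (k div 3)) \<or> k = Suc (Suc (3 * (k div 3)))" by presburger
  then show ?thesis using that by blast
qed

lemma long_exact_basis_simps:
  "long_exact_basis hC hX hY (3 * q) = hY q" "long_exact_basis hC hX hY (Suc (3 * q)) = hX q"
  "long_exact_basis hC hX hY (Suc (Suc (3 * q))) = hC q"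
proof -
  have "3 * q mod 3 = 0" "Suc (3 * q) mod 3 = 1" "Suc (Suc (3 * q)) mod 3 = 2" by presburger+
  moreover have "3 * q div 3 = q" "Suc (3 * q) div 3 = q" "Suc (Suc (3 * q)) div 3 = q" by presburger+
  ultimately show "long_exact_basis hC hX hY (3 * q) = hY q" "long_exact_basis hC hX hY (Suc (3 * q)) = hX q"
  "long_exact_basis hC hX hY (Suc (Suc (3 * q))) = hC q"
    by (simp_all add: long_exact_basis_def)
qed

section \<open>Exactness of the homology sequence\<close>

context
  fixes hX hY hC :: "nat \<Rightarrow> 's list"
  assumes hX: "homology_basis cX q (hX q)" and hY: "homology_basis cY q (hY q)"
    and hC: "homology_basis cC q (hC q)"
begin

lemma hbases:
  "basis_mod (cycles cX q) (boundaries cX q) (hX q)" "basis_mod (cycles cY q) (boundaries cY q) (hY q)"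
  "basis_mod (cycles cC q) (boundaries cC q) (hC q)"
  using hX hY hC by (auto simp: homology_basis_def)

lemmas subspaces = basis_modD(1,2,3) [OF hbases(1)] basis_modD(1,2,3) [OF hbases(2)]
  basis_modD(1,2,3) [OF hbases(3)]

text \<open>Read off from the existence of homology bases, which presupposes that boundaries are
  cycles. The degree starts at 2 because cycles of degree 0 satisfy no condition.\<close>

lemma dd: "x \<in> X (Suc (Suc q)) \<Longrightarrow> d (d x) = 0"
  using subspaces(3) [of "Suc q"] unfolding cycles_eq boundaries_eq by blast

text \<open>If the connecting image \<open>d z\<close> bounds in the cone as \<open>d c\<close>,
  then \<open>z - c\<close> is a cycle of \<open>X\<close> over \<open>z\<close>; in degree 0 the
  element \<open>z\<close> itself will do. Conversely, for \<open>z = r y + r (d w)\<close> the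
  chains \<open>y - r y\<close> and \<open>d w - r (d w)\<close> lie in the cone and their
  boundaries add up to \<open>- d z\<close>.\<close>

lemma exact_Y: "cycles les (3 * q) = boundaries les (3 * q)"
proof
  show "cycles les (3 * q) \<subseteq> boundaries les (3 * q)"
  proof
    fix z assume z: "z \<in> cycles les (3 * q)"
    then have zY: "z \<in> cycles cY q" by (simp add: cycles_def [of les] les_simps)
    have "\<exists>y\<in>cycles cX q. z = r y"
    proof (cases q)
      case 0
      then have "z \<in> Y 0" using zY unfolding cycles_eq by simp
      then show ?thesis using rY [of z 0] YX [of z 0] unfolding 0 cycles_eq by (intro bexI [of _ z]) auto
    next
      case (Suc p)
      have "3 * q - Suc 0 = Suc (Suc (3 * p))" using Suc by simp
      then have "d z \<in> boundaries cC p" using z Suc by (simp add: cycles_def [of les] les_simps del: mult_Suc_right)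
      then obtain c where c: "c \<in> C q" "d z = d c" unfolding boundaries_eq Suc by blast
      have zq: "z \<in> Y q" using zY unfolding cycles_eq by blast
      have "z - c \<in> cycles cX q"
        using c CX YX zq subspace_diff [OF X] linear_diff [OF lin_d] unfolding cycles_eq by auto
      moreover have "r (z - c) = z" using rY [OF zq] r_0 [OF c(1)] linear_diff [OF lin_r] by simp
      ultimately show ?thesis by metis
    qed
    then obtain y where y: "y \<in> cycles cX q" "z = r y + 0" by auto
    moreover have "0 \<in> boundaries cY q" using subspace_0 subspaces by blast
    ultimately show "z \<in> boundaries les (3 * q)"
      unfolding boundaries_def [of les] les_simps by blast
  qed
next
  show "boundaries les (3 * q) \<subseteq> cycles les (3 * q)"
  proof
    fix z assume "z \<in> boundaries les (3 * q)"
    then obtain y w where y: "y \<in> cycles cX q" and w: "w \<in> Y (Suc q)" and z: "z = r y + r (d w)"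
      unfolding boundaries_def [of les] les_simps boundaries_eq by blast
    have yX: "y \<in> X q" using y unfolding cycles_eq by blast
    have s: "r (d w) \<in> cycles cY q"
      using subspaces(6) w unfolding boundaries_eq by blast
    have "r y \<in> cycles cY q"
      using y rX [OF yX] r_d_r linear_0 [OF lin_r] unfolding cycles_eq by (cases q) auto
    from subspace_add [OF subspaces(4) this s] have zY: "z \<in> cycles cY q" by (simp add: z)
    moreover have "d z \<in> boundaries cC p" if q: "q = Suc p" for p
    proof -
      have dw: "d w \<in> X q" using dX YX w by blast
      have "d (y - r y) \<in> boundaries cC p" "d (d w - r (d w)) \<in> boundaries cC p"
        using r_diff [OF yX] r_diff [OF dw] unfolding boundaries_eq q by blast+
      from subspace_diff [OF subspaces(8) subspace_diff [OF subspaces(8) subspace_0 [OF subspaces(8)] this(1)] this(2)]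
      show ?thesis using y dd [of w p] YX [OF w] q linear_diff [OF lin_d] linear_add [OF lin_d]
        by (simp add: z cycles_eq)
    qed
    moreover have "den les (3 * q - 1) = boundaries cC (q - 1)" if "q \<noteq> 0"
    proof -
      have "3 * q - 1 = Suc (Suc (3 * (q - 1)))" using that by simp
      then show ?thesis by (simp only: les_simps)
    qed
    ultimately show "z \<in> cycles les (3 * q)"
      using les_simps(1) [of 0] by (cases q) (auto simp: cycles_def [of les] les_simps simp del: mult_Suc_right)
  qed
qed

text \<open>If \<open>r z\<close> bounds as \<open>r (d w)\<close>, subtracting \<open>d w\<close>
  moves \<open>z\<close> into the cone without changing its class.\<close>

lemma exact_X: "cycles les (Suc (3 * q)) = boundaries les (Suc (3 * q))"
proof
  show "cycles les (Suc (3 * q)) \<subseteq> boundaries les (Suc (3 * q))"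
  proof
    fix z assume "z \<in> cycles les (Suc (3 * q))"
    then have z: "z \<in> cycles cX q" and "r z \<in> boundaries cY q"
      by (simp_all add: cycles_def [of les] les_simps)
    then obtain w where w: "w \<in> Y (Suc q)" "r z = r (d w)" unfolding boundaries_eq by blast
    have dw: "d w \<in> boundaries cX q" using YX [OF w(1)] unfolding boundaries_eq by blast
    have "z - d w \<in> cycles cX q"
      by (rule subspace_diff [OF subspaces(1) z]) (use dw subspaces(3) in blast)
    then have "z - d w \<in> cycles cC q"
      using w(2) linear_diff [OF lin_r] unfolding cycles_eq C_eq by auto
    moreover have "z = (z - d w) + d w" by simp
    ultimately show "z \<in> boundaries les (Suc (3 * q))"
      unfolding boundaries_def [of les] les_simps using dw by blast
  qed
next
  show "boundaries les (Suc (3 * q)) \<subseteq> cycles les (Suc (3 * q))"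
  proof
    fix z assume "z \<in> boundaries les (Suc (3 * q))"
    then obtain y s where y: "y \<in> cycles cC q" and s: "s \<in> boundaries cX q" and z: "z = y + s"
      unfolding boundaries_def [of les] les_simps by blast
    have yX: "y \<in> cycles cX q" using y CX unfolding cycles_eq by auto
    have sX: "s \<in> cycles cX q" using s subspaces(3) by blast
    obtain w where w: "w \<in> X (Suc q)" "s = d w" using s unfolding boundaries_eq by blast
    have "r z = r (d (r w))"
      using y r_0 r_d_r [OF w(1)] linear_add [OF lin_r] w(2) unfolding z cycles_eq by auto
    then have "r z \<in> boundaries cY q" using rX [OF w(1)] unfolding boundaries_eq by blast
    then show "z \<in> cycles les (Suc (3 * q))"
      using subspace_add [OF subspaces(1) yX sX] by (simp add: cycles_def [of les] les_simps z)
  qed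
qed

text \<open>If a cycle of the cone is \<open>d x\<close> in \<open>X\<close>, it is the connecting
  image of \<open>r x\<close> up to the boundary of \<open>x - r x\<close>. Besides exactness, this
  description later serves to filter the boundaries of \<open>X\<close>.\<close>

lemma boundaries_les_C:
  "boundaries les (Suc (Suc (3 * q))) = {z \<in> cycles cC q. z \<in> boundaries cX q}"
proof
  show "{z \<in> cycles cC q. z \<in> boundaries cX q} \<subseteq> boundaries les (Suc (Suc (3 * q)))"
  proof
    fix z assume "z \<in> {z \<in> cycles cC q. z \<in> boundaries cX q}"
    then obtain x where z: "z \<in> C q" and x: "x \<in> X (Suc q)" "z = d x"
      unfolding boundaries_eq cycles_eq by blast
    have "r x \<in> cycles cY (Suc q)"
      using rX [OF x(1)] r_d_r [OF x(1)] r_0 [OF z] x(2) unfolding cycles_eq by simp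
    moreover have "d (x - r x) \<in> boundaries cC q" using r_diff [OF x(1)] unfolding boundaries_eq by blast
    moreover have "z = d (r x) + d (x - r x)" by (simp add: x(2) linear_diff [OF lin_d])
    ultimately show "z \<in> boundaries les (Suc (Suc (3 * q)))"
      unfolding boundaries_def [of les] les_simps les_Suc3 by blast
  qed
next
  show "boundaries les (Suc (Suc (3 * q))) \<subseteq> {z \<in> cycles cC q. z \<in> boundaries cX q}"
  proof
    fix z assume "z \<in> boundaries les (Suc (Suc (3 * q)))"
    then obtain y s where y: "y \<in> cycles cY (Suc q)" and s: "s \<in> boundaries cC q" and z: "z = d y + s"
      unfolding boundaries_def [of les] les_simps les_Suc3 by blast
    have yY: "y \<in> Y (Suc q)" and rdy: "r (d y) = 0" using y unfolding cycles_eq by auto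
    have dyB: "d y \<in> boundaries cX q" using YX [OF yY] unfolding boundaries_eq by blast
    then have "d y \<in> cycles cX q" using subspaces(3) by blast
    then have dyC: "d y \<in> cycles cC q" using rdy unfolding cycles_eq C_eq by blast
    have "s \<in> cycles cC q" using s subspaces(9) by blast
    moreover have "s \<in> boundaries cX q" using s CX unfolding boundaries_eq by blast
    ultimately show "z \<in> {z \<in> cycles cC q. z \<in> boundaries cX q}"
      using subspace_add [OF subspaces(7) dyC] subspace_add [OF subspaces(2) dyB] by (simp add: z)
  qed
qed

lemma exact_C: "cycles les (Suc (Suc (3 * q))) = boundaries les (Suc (Suc (3 * q)))"
  unfolding boundaries_les_C by (auto simp: cycles_def [of les] les_simps)

text \<open>Exactness makes the empty list a homology basis in every degree. What remains is that
  the maps respect the quotients and that the terms vanish beyond degree \<open>3 * n + 2\<close>,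
  where the chain groups are zero.\<close>

lemma les_based: "based_complex les (long_exact_basis hC hX hY) (\<lambda>_. [])"
  unfolding based_complex_def
proof (intro conjI allI impI)
  fix k
  show "basis_mod (num les k) (den les k) (long_exact_basis hC hX hY k)"
    by (rule nat_mod3_cases [of k]) (simp_all add: les_simps long_exact_basis_simps hbases)
  have lin_id: "linear (\<lambda>z::'s. z)" by (rule linear_ident)
  show lin: "linear (dif les (Suc k))" for k
    by (rule nat_mod3_cases [of k]) (simp_all add: les_simps lin_d lin_r lin_id)
  have exact: "cycles les k = boundaries les k"
    by (rule nat_mod3_cases [of k]) (simp_all add: exact_X exact_Y exact_C)
  have sub: "subspace (num les k)" "subspace (den les k)" "den les k \<subseteq> num les k" for k
    by (rule nat_mod3_cases [of k]; simp add: les_simps subspaces)+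
  have "subspace (cycles les k)"
  proof (cases k)
    case 0 then show ?thesis using sub(1) [of 0] by (simp add: cycles_def)
  next
    case (Suc j)
    have "cycles les k = num les k \<inter> {z. dif les k z \<in> den les (k - 1)}"
      using Suc by (auto simp: cycles_def)
    moreover have "subspace {z. dif les k z \<in> den les (k - 1)}"
      using linear_subspace_vimage [OF lin [of j] sub(2) [of j]] Suc by (simp add: vimage_def)
    ultimately show ?thesis using subspace_inter sub(1) by metis
  qed
  then show "homology_basis les k []"
    unfolding homology_basis_def exact basis_mod_iff by auto
  show "dif les (Suc k) ` num les (Suc k) \<subseteq> num les k"
  proof (rule nat_mod3_cases [of k])
    fix q assume k: "k = 3 * q"
    show ?thesis
      using rX r_d_r linear_0 [OF lin_r] unfolding k les_simps cycles_eq by (cases q) auto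
  next
    fix q assume k: "k = Suc (3 * q)"
    show ?thesis using CX unfolding k les_simps cycles_eq by auto
  next
    fix q assume k: "k = Suc (Suc (3 * q))"
    have "d y \<in> cycles cC q" if y: "y \<in> cycles cY (Suc q)" for y
    proof -
      have "d y + 0 \<in> boundaries les (Suc (Suc (3 * q)))"
        unfolding boundaries_def [of les] les_simps les_Suc3
        using y subspace_0 [OF subspaces(8) [of q]] by blast
      then show ?thesis unfolding boundaries_les_C by simp
    qed
    then show ?thesis unfolding k les_simps les_Suc3 by blast
  qed
  show "dif les (Suc k) ` den les (Suc k) \<subseteq> den les k"
  proof (rule nat_mod3_cases [of k])
    fix q assume k: "k = 3 * q"
    have "r (d x) \<in> boundaries cY q" if "x \<in> X (Suc q)" for x
      using rX [OF that] r_d_r [OF that] unfolding boundaries_eq by (metis image_eqI)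
    then show ?thesis unfolding k les_simps boundaries_eq by auto
  next
    fix q assume k: "k = Suc (3 * q)"
    show ?thesis using CX unfolding k les_simps boundaries_eq by auto
  next
    fix q assume k: "k = Suc (Suc (3 * q))"
    have "d (r (d y)) \<in> boundaries cC q" if y: "y \<in> Y (Suc (Suc q))" for y
    proof -
      \<comment> \<open>Since \<open>d (d y) = 0\<close>, the image \<open>d (r (d y))\<close> is
        minus the boundary of \<open>d y - r (d y)\<close>, which is a chain of the cone.\<close>
      have "- d (d y - r (d y)) \<in> boundaries cC q"
        using subspace_neg [OF subspaces(8)] r_diff [OF dX [OF YX [OF y]]] unfolding boundaries_eq by blast
      then show ?thesis using dd [OF YX [OF y]] by (simp add: linear_diff [OF lin_d])
    qed
    then show ?thesis unfolding k les_simps les_Suc3 boundaries_eq(3) by blast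
  qed
  assume k: "k > top_deg les"
  have Y0: "Y q = {0}" if "q > n" for q
    using X_top [OF that] YX subspace_0 [OF Y [of q]] by auto
  have C0: "C q = {0}" if "q > n" for q
    using X_top [OF that] CX subspace_0 [OF C [of q]] by auto
  have q: "cycles cX q = boundaries cX q \<and> cycles cY q = boundaries cY q \<and> cycles cC q = boundaries cC q"
    if "q > n" for q
  proof -
    have "Suc q > n" using that by simp
    show ?thesis
      unfolding cycles_eq boundaries_eq X_top [OF that] Y0 [OF that] C0 [OF that]
        X_top [OF \<open>Suc q > n\<close>] Y0 [OF \<open>Suc q > n\<close>] C0 [OF \<open>Suc q > n\<close>]
      using linear_0 [OF lin_d] linear_0 [OF lin_r] by auto
  qed
  show "num les k = den les k"
    by (rule nat_mod3_cases [of k]) (use k q in \<open>auto simp: les_simps\<close>)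
qed

lemma chains_based:
  "(\<And>q. basis_mod (X q) {0} (vX q)) \<Longrightarrow> based_complex cX vX hX"
  "(\<And>q. basis_mod (C q) {0} (vC q)) \<Longrightarrow> based_complex cC vC hC"
  "(\<And>q. basis_mod (Y q) {0} (vY q)) \<Longrightarrow> based_complex cY vY hY"
proof -
  have lin: "linear (\<lambda>y. r (d y))" using linear_compose [OF lin_d lin_r] by (simp add: o_def)
  have top: "X q = {0}" "Y q = {0}" "C q = {0}" if "q > n" for q
    using X_top [OF that] YX subspace_0 [OF Y [of q]] CX subspace_0 [OF C [of q]] by auto
  note [simp] = linear_0 [OF lin_d] linear_0 [OF lin_r]
  show "based_complex cX vX hX" if "\<And>q. basis_mod (X q) {0} (vX q)"
    unfolding based_complex_def using that hX lin_d dX top by (auto simp: cX_def)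
  show "based_complex cC vC hC" if "\<And>q. basis_mod (C q) {0} (vC q)"
    unfolding based_complex_def using that hC lin_d dC top by (auto simp: cC_def)
  show "based_complex cY vY hY" if "\<And>q. basis_mod (Y q) {0} (vY q)"
    unfolding based_complex_def using that hY lin rX [OF dX [OF YX]] top by (auto simp: cY_def)
qed

end

text \<open>The bases \<open>\<beta>\<close> of the long exact sequence give homology bases \<open>k @ x\<close>, \<open>\<delta> y @ k\<close> and
  \<open>r x @ y\<close> of \<open>X\<close>, \<open>C\<close> and \<open>Y\<close>. With respect to these the factors of the torsion of \<open>X\<close> are the
  products of those of \<open>C\<close> and \<open>Y\<close>, and \<open>torsion_prod_change\<close> accounts for the difference to
  the given homology bases.\<close>

lemma torsion_multiplicative:
  assumes hX: "\<And>q. homology_basis cX q (hX q)" and hY: "\<And>q. homology_basis cY q (hY q)"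
    and hC: "\<And>q. homology_basis cC q (hC q)"
    and vX: "\<And>q. basis_mod (X q) {0} (vX q)" and vY: "\<And>q. basis_mod (Y q) {0} (vY q)"
    and vC: "\<And>q. basis_mod (C q) {0} (vC q)"
    and vol: "\<And>q. \<bar>det_change {0} (vC q @ vY q) (vX q)\<bar> = 1"
  shows "R_torsion cX vX hX =
    R_torsion cC vC hC * R_torsion cY vY hY * R_torsion les (long_exact_basis hC hX hY) (\<lambda>_. [])"
proof -
  note E = les_based [OF hX hY hC]
  note DX = chains_based(1) [OF hX hY hC vX] and DC = chains_based(2) [OF hX hY hC vC]
    and DY = chains_based(3) [OF hX hY hC vY]
  obtain \<beta> where \<beta>: "torsion_lift les \<beta>" using torsion_lift_exists [OF E] by blast
  obtain bC where bC: "torsion_lift cC bC" using torsion_lift_exists [OF DC] by blast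
  obtain bY where bY: "torsion_lift cY bY" using torsion_lift_exists [OF DY] by blast
  define y where "y q = \<beta> (3 * q)" for q
  define x where "x q = \<beta> (Suc (3 * q))" for q
  define k where "k q = \<beta> (Suc (Suc (3 * q)))" for q
  define hX' where "hX' q = k q @ x q" for q
  define hC' where "hC' q = map d (y (Suc q)) @ k q" for q
  define hY' where "hY' q = map r (x q) @ y q" for q
  \<comment> \<open>The boundaries of \<open>X\<close> contain the cycles of \<open>C\<close> that
    bound in \<open>X\<close>, and these contain the boundaries of \<open>C\<close>. One degree up,
    \<open>bY\<close>, \<open>y\<close> and \<open>bC\<close> are mapped by \<open>d\<close> to
    bases of the successive quotients, from the top quotient down.\<close>
  define bX where "bX q = bC q @ y q @ bY q" for q
  have \<beta>_Suc3: "\<beta> (Suc (Suc (Suc (3 * q)))) = y (Suc q)" for q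
    unfolding y_def by (rule arg_cong [of _ _ \<beta>]) simp
  note les = les_simps les_Suc3
  have hY': "basis_mod (cycles cY q) (boundaries cY q) (hY' q)" for q
    using torsion_lift_basis [OF E \<beta>, of "3 * q"] by (simp add: les hY'_def x_def y_def)
  have hX': "basis_mod (cycles cX q) (boundaries cX q) (hX' q)" for q
    using torsion_lift_basis [OF E \<beta>, of "Suc (3 * q)"] by (simp add: les hX'_def x_def k_def)
  have hC': "basis_mod (cycles cC q) (boundaries cC q) (hC' q)" for q
    using torsion_lift_basis [OF E \<beta>, of "Suc (Suc (3 * q))"] by (simp add: les hC'_def k_def \<beta>_Suc3)
  have hX'': "homology_basis cX q (hX' q)" and hY'': "homology_basis cY q (hY' q)"
    and hC'': "homology_basis cC q (hC' q)" for q
    using hX' hY' hC' by (simp_all add: homology_basis_def)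
  note DX' = chains_based(1) [OF hX'' hY'' hC'' vX] and DC' = chains_based(2) [OF hX'' hY'' hC'' vC]
    and DY' = chains_based(3) [OF hX'' hY'' hC'' vY]
  note sub = subspaces [OF hX hY hC]
  have num: "num cX = X" "num cC = C" "num cY = Y" "den cX = (\<lambda>_. {0})" "den cC = (\<lambda>_. {0})"
    "den cY = (\<lambda>_. {0})" "dif cX q = d" "dif cC q = d" "dif cY q = (\<lambda>z. r (d z))" for q
    by (simp_all add: cX_def cC_def cY_def)
  have yY: "set (y q) \<subseteq> Y q" for q
  proof -
    have "set (\<beta> (3 * q)) \<subseteq> num les (3 * q)" using \<beta> unfolding torsion_lift_def by blast
    then show ?thesis unfolding y_def les cycles_eq by blast
  qed
  have bYY: "set (bY q) \<subseteq> Y q" for q using bY unfolding torsion_lift_def num by blast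
  have bCC: "set (bC q) \<subseteq> C q" for q using bC unfolding torsion_lift_def num by blast
  have bX: "torsion_lift cX bX"
    unfolding torsion_lift_def
  proof (intro conjI allI)
    show "bX 0 = []" using \<beta> bC bY by (simp add: bX_def y_def torsion_lift_def)
    show "set (bX q) \<subseteq> num cX q" for q
      using yY [of q] bYY [of q] bCC [of q] CX YX unfolding bX_def num by auto
    fix q
    let ?I = "{z \<in> cycles cC q. z \<in> boundaries cX q}"
    have I: "basis_mod ?I (boundaries cC q) (map d (y (Suc q)))"
      using torsion_liftD(1) [OF E \<beta>, of "Suc (Suc (3 * q))"]
      by (simp add: les boundaries_les_C [OF hX hY hC] \<beta>_Suc3)
    have iso: "quot_iso r (boundaries cX q) ?I (boundaries cY q) {0}"
      unfolding quot_iso_def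
    proof (intro conjI ballI)
      show "subspace ?I" using basis_modD(1) [OF I] .
      show "r ` boundaries cX q \<subseteq> boundaries cY q"
      proof
        fix z assume "z \<in> r ` boundaries cX q"
        then obtain w where w: "w \<in> X (Suc q)" "z = r (d w)" unfolding boundaries_eq by blast
        have "z = r (d (r w))" using r_d_r [OF w(1)] w(2) by simp
        then show "z \<in> boundaries cY q" using rX [OF w(1)] unfolding boundaries_eq by blast
      qed
      show "\<exists>z\<in>boundaries cX q. z' - r z \<in> {0}" if "z' \<in> boundaries cY q" for z'
        using that YX unfolding boundaries_eq by auto
      show "r z \<in> {0} \<longleftrightarrow> z \<in> ?I" if "z \<in> boundaries cX q" for z
      proof -
        have "z \<in> cycles cX q" using that sub(3) by blast
        then show ?thesis using that unfolding cycles_eq C_eq by auto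
      qed
    qed (use lin_r sub subspace_0 [OF sub(5)] in auto)
    have "basis_mod (boundaries cY q) {0} (map r (map d (bY (Suc q))))"
      using torsion_liftD(1) [OF DY bY, of q] by (simp add: num comp_def)
    moreover have "set (map d (bY (Suc q))) \<subseteq> boundaries cX q"
      using bYY [of "Suc q"] YX unfolding boundaries_eq by auto
    ultimately have "basis_mod (boundaries cX q) ?I (map d (bY (Suc q)))"
      using quot_iso_basis_mod [OF iso] by blast
    moreover have "basis_mod (boundaries cC q) {0} (map d (bC (Suc q)))"
      using torsion_liftD(1) [OF DC bC, of q] by (simp add: num)
    ultimately have "basis_mod (boundaries cX q) {0}
        (map d (bC (Suc q)) @ map d (y (Suc q)) @ map d (bY (Suc q)))"
      using I basis_mod_append by metis
    then show "basis_mod (boundaries cX q) (den cX q) (map (dif cX (Suc q)) (bX (Suc q)))"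
      by (simp add: bX_def num)
  qed
  have factor: "\<bar>det_change {0} (map d (bX (Suc q)) @ hX' q @ bX q) (vX q)\<bar> =
      \<bar>det_change {0} (map d (bC (Suc q)) @ hC' q @ bC q) (vC q)\<bar> *
      \<bar>det_change {0} (map (\<lambda>z. r (d z)) (bY (Suc q)) @ hY' q @ bY q) (vY q)\<bar>" for q
  proof -
    \<comment> \<open>\<open>V1\<close> gathers the vectors lying in the cone and is the list for
      \<open>C\<close>. \<open>V2\<close> gathers the others; \<open>r\<close> maps it to the list
      for \<open>Y\<close>, as it fixes \<open>y\<close> and \<open>bY\<close>.\<close>
    define V1 where "V1 = map d (bC (Suc q)) @ hC' q @ bC q"
    define V2 where "V2 = map d (bY (Suc q)) @ x q @ y q @ bY q"
    define W2 where "W2 = map (\<lambda>z. r (d z)) (bY (Suc q)) @ hY' q @ bY q"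
    let ?U = "map d (bX (Suc q)) @ hX' q @ bX q"
    have U: "basis_mod (X q) {0} ?U"
      using torsion_lift_basis [OF DX' bX, of q] by (simp add: num)
    have V1: "basis_mod (C q) {0} V1"
      using torsion_lift_basis [OF DC' bC, of q] by (simp add: num V1_def)
    have W2: "basis_mod (Y q) {0} W2"
      using torsion_lift_basis [OF DY' bY, of q] by (simp add: num W2_def)
    have ms: "mset ?U = mset (V1 @ V2)"
      by (simp add: bX_def hX'_def V1_def V2_def hC'_def)
    have V12: "basis_mod (X q) {0} (V1 @ V2)" using basis_mod_mset [OF U] ms by simp
    have id: "map r ys = ys" if "set ys \<subseteq> Y q" for ys
      using that rY by (intro map_idI) auto
    have rV2: "map r V2 = W2"
      using id [OF yY] id [OF bYY] by (simp add: comp_def V2_def W2_def hY'_def)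
    have iso: "quot_iso r (X q) (C q) (Y q) {0}"
      unfolding quot_iso_def
    proof (intro conjI ballI)
      show "\<exists>z\<in>X q. z' - r z \<in> {0}" if "z' \<in> Y q" for z'
        using rY [OF that] YX [OF that] by (intro bexI [of _ z']) auto
      show "r z \<in> {0} \<longleftrightarrow> z \<in> C q" if "z \<in> X q" for z using that by (simp add: C_eq)
    qed (use lin_r X C Y CX rX subspace_0 [OF Y [of q]] in auto)
    have vY': "map r (vY q) = vY q" using id basis_modD(4) [OF vY] .
    have vYX: "set (vY q) \<subseteq> X q" using basis_modD(4) [OF vY [of q]] YX by blast
    have vYC: "basis_mod (X q) (C q) (vY q)"
      using quot_iso_basis_mod [OF iso vYX] vY [of q] vY' by simp
    have V2X: "set V2 \<subseteq> X q" using basis_modD(4) [OF V12] by simp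
    have len2: "length V2 = length (vY q)" using basis_mod_length [OF W2 vY [of q]] rV2 by (metis length_map)
    have "\<bar>det_change {0} ?U (vX q)\<bar> = \<bar>det_change {0} (V1 @ V2) (vX q)\<bar>"
      by (rule abs_det_change_mset [OF ms basis_mod_length [OF U vX]])
    also have "\<dots> = \<bar>det_change {0} (V1 @ V2) (vC q @ vY q)\<bar> * \<bar>det_change {0} (vC q @ vY q) (vX q)\<bar>"
      using det_change_trans [OF vX basis_mod_append [OF vC vYC] basis_modD(4) [OF V12]
          basis_mod_length [OF V12 vX]]
      by (simp add: abs_mult)
    also have "\<bar>det_change {0} (vC q @ vY q) (vX q)\<bar> = 1" by (rule vol)
    also have "det_change {0} (V1 @ V2) (vC q @ vY q) = det_change {0} V1 (vC q) * det_change (C q) V2 (vY q)"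
      by (rule det_change_append [OF vC vYC basis_modD(4) [OF V1] basis_mod_length [OF V1 vC] V2X len2])
    also have "det_change (C q) V2 (vY q) = det_change {0} W2 (vY q)"
      using det_change_quot_iso [OF iso vYC V2X len2] rV2 vY' by simp
    finally show ?thesis by (simp add: abs_mult V1_def W2_def)
  qed
  have "torsion_prod cX vX hX' bX = torsion_prod cC vC hC' bC * torsion_prod cY vY hY' bY"
    unfolding torsion_prod_def num
    by (simp only: factor power_int_mult_distrib prod.distrib) (simp add: cX_def cC_def cY_def)
  moreover let ?P = "\<lambda>D h' h q. \<bar>det_change (boundaries D q) (h' q) (h q)\<bar>"
  have top: "top_deg cX = n" "top_deg cC = n" "top_deg cY = n" by (simp_all add: cX_def cC_def cY_def)
  have "torsion_prod cX vX hX' bX = R_torsion cX vX hX * (\<Prod>q\<le>n. ?P cX hX' hX q powi ((-1) ^ q))"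
    using torsion_prod_change [OF DX DX' bX bX] R_torsion_eq [OF DX bX] by (simp add: top)
  moreover have "torsion_prod cC vC hC' bC = R_torsion cC vC hC * (\<Prod>q\<le>n. ?P cC hC' hC q powi ((-1) ^ q))"
    using torsion_prod_change [OF DC DC' bC bC] R_torsion_eq [OF DC bC] by (simp add: top)
  moreover have "torsion_prod cY vY hY' bY = R_torsion cY vY hY * (\<Prod>q\<le>n. ?P cY hY' hY q powi ((-1) ^ q))"
    using torsion_prod_change [OF DY DY' bY bY] R_torsion_eq [OF DY bY] by (simp add: top)
  moreover have "R_torsion les (long_exact_basis hC hX hY) (\<lambda>_. []) * (\<Prod>q\<le>n. ?P cX hX' hX q powi ((-1) ^ q)) =
      (\<Prod>q\<le>n. ?P cC hC' hC q powi ((-1) ^ q)) * (\<Prod>q\<le>n. ?P cY hY' hY q powi ((-1) ^ q))"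
  proof -
    let ?f = "\<lambda>k. \<bar>det_change (den les k) (map (dif les (Suc k)) (\<beta> (Suc k)) @ [] @ \<beta> k)
      (long_exact_basis hC hX hY k)\<bar> powi ((-1) ^ k)"
    have "R_torsion les (long_exact_basis hC hX hY) (\<lambda>_. []) = (\<Prod>k\<le>3 * n + 2. ?f k)"
      by (simp add: R_torsion_eq [OF E \<beta>] torsion_prod_def les)
    also have "\<dots> = (\<Prod>q\<le>n. ?f (3 * q) * ?f (3 * q + 1) * ?f (3 * q + 2))"
      by (rule prod_atMost_triples)
    finally have R: "R_torsion les (long_exact_basis hC hX hY) (\<lambda>_. []) =
        (\<Prod>q\<le>n. ?f (3 * q) * ?f (3 * q + 1) * ?f (3 * q + 2))" .
    have "?f (3 * q) * ?f (3 * q + 1) * ?f (3 * q + 2) * ?P cX hX' hX q powi ((-1) ^ q)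
        = ?P cC hC' hC q powi ((-1) ^ q) * ?P cY hY' hY q powi ((-1) ^ q)" for q
    proof -
      \<comment> \<open>Degrees \<open>3 * q\<close> and \<open>3 * q + 2\<close> have the parity of
        \<open>q\<close> and degree \<open>3 * q + 1\<close> the opposite one, so the determinants
        for \<open>X\<close> enter the torsion of the sequence inverted.\<close>
      have pow: "(-1) ^ (3 * q) = ((-1) ^ q :: int)" by (simp add: power_mult)
      have 0: "?f (3 * q) = ?P cY hY' hY q powi ((-1) ^ q)"
        by (simp add: les long_exact_basis_simps hY'_def x_def y_def pow)
      have 1: "?f (3 * q + 1) = ?P cX hX' hX q powi (- ((-1) ^ q))"
        by (simp add: les long_exact_basis_simps hX'_def x_def k_def pow)
      have 2: "?f (3 * q + 2) = ?P cC hC' hC q powi ((-1) ^ q)"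
        by (simp add: les long_exact_basis_simps hC'_def k_def pow \<beta>_Suc3)
      have "?P cX hX' hX q \<noteq> 0"
        using det_change_nonzero [OF hbases(1) [OF hX hY hC] hX'] by simp
      then have "?P cX hX' hX q powi (- ((-1) ^ q)) * ?P cX hX' hX q powi ((-1) ^ q) = 1"
        by (simp add: power_int_minus)
      then show ?thesis unfolding 0 1 2 by (simp add: mult.assoc)
    qed
    then show ?thesis unfolding R by (simp add: prod.distrib [symmetric])
  qed
  moreover have "(\<Prod>q\<le>n. ?P cX hX' hX q powi ((-1) ^ q)) \<noteq> 0"
    using det_change_nonzero [OF hbases(1) [OF hX hY hC] hX'] by simp
  moreover have "a = tc * ty * e"
    if "t = u * v" "t = a * p" "u = tc * pc" "v = ty * py" "e * p = pc * py" "p \<noteq> 0"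
    for a t u v p e tc pc ty py :: real
  proof -
    have "a * p = tc * pc * (ty * py)" using that by simp
    also have "\<dots> = tc * ty * (pc * py)" by simp
    also have "\<dots> = tc * ty * e * p" using that by simp
    finally show ?thesis using that by simp
  qed
  ultimately show ?thesis by blast
qed

end

section \<open>Topology of the cone\<close>

text \<open>Near a point the two lifts run either in one sheet, where \<open>p\<close> is injective,
  or in two disjoint sheets. So both agreement and disagreement are open conditions; the covering
  space need not be Hausdorff for this.\<close>

lemma covering_lifts_agree:
  fixes p :: "'u::topological_space \<Rightarrow> 'x::topological_space"
    and g1 g2 :: "'a::topological_space \<Rightarrow> 'u"
  assumes cov: "covering_space UNIV p UNIV" and T: "connected T"
    and g1: "continuous_on T g1" and g2: "continuous_on T g2"
    and eq: "\<And>x. x \<in> T \<Longrightarrow> p (g1 x) = p (g2 x)"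
    and a: "a \<in> T" "g1 a = g2 a" and b: "b \<in> T"
  shows "g1 b = g2 b"
proof -
  have "(g1 a = g2 a) = (g1 b = g2 b)"
  proof (rule connected_equivalence_relation [OF T a(1) b, where R = "\<lambda>x y. (g1 x = g2 x) = (g1 y = g2 y)"])
    fix x assume x: "x \<in> T"
    obtain S v where S: "p (g1 x) \<in> S" and v: "\<Union>v = p -` S" "\<forall>u\<in>v. open u" "pairwise disjnt v"
      "\<forall>u\<in>v. \<exists>q. homeomorphism u S p q"
      using cov unfolding covering_space_def by (auto; metis UNIV_I)
    have "g1 x \<in> \<Union>v" "g2 x \<in> \<Union>v" using S eq [OF x] v(1) by auto
    then obtain u1 u2 where u: "u1 \<in> v" "g1 x \<in> u1" "u2 \<in> v" "g2 x \<in> u2" by blast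
    let ?N = "(T \<inter> g1 -` u1) \<inter> (T \<inter> g2 -` u2)"
    have "openin (top_of_set T) ?N"
      using u v(2) by (intro openin_Int continuous_openin_preimage_gen g1 g2) auto
    moreover have "x \<in> ?N" using x u by auto
    moreover have "(g1 x = g2 x) = (g1 y = g2 y)" if y: "y \<in> ?N" for y
    proof (cases "u1 = u2")
      case True
      obtain q where "homeomorphism u1 S p q" using v(4) u(1) by blast
      then have "inj_on p u1" by (metis homeomorphism_def inj_onI)
      then show ?thesis using True u y eq [OF x] eq [of y] by (auto simp: inj_on_def)
    next
      case False
      then have "u1 \<inter> u2 = {}" using v(3) u by (auto simp: pairwise_def disjnt_def)
      then show ?thesis using u y by auto
    qed
    ultimately show "\<exists>N. openin (top_of_set T) N \<and> x \<in> N \<and> (\<forall>y\<in>N. (g1 x = g2 x) = (g1 y = g2 y))"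
      by blast
  qed auto
  with a(2) show ?thesis by simp
qed

locale cone_geometry =
  fixes G :: "('x::{t2_space, second_countable_topology}, 'u::topological_space,
      'w::{t2_space, second_countable_topology}, 'd::euclidean_space, 'v::euclidean_space) conical"
  assumes conical: "conical_space G"
begin

abbreviation "L \<equiv> collar_len G"
abbreviation "l \<equiv> len G"

lemma len_bounds: "0 < l" "l < L" "0 < L"
  using conical unfolding conical_space_def by auto

lemma W_top: "compact (UNIV :: 'w set)" "connected (UNIV :: 'w set)"
  using conical unfolding conical_space_def by auto

lemma X_compact: "compact (UNIV :: 'x set)"
  using conical unfolding conical_space_def by auto

lemma cov: "universal_covering (cov (flatb G))" "grp (flatb G) = deck (cov (flatb G))"
  using conical unfolding conical_space_def by auto

lemma act: "\<sigma> \<in> grp (flatb G) \<Longrightarrow> orthogonal_transformation (act (flatb G) \<sigma>)"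
  "\<sigma> \<in> grp (flatb G) \<Longrightarrow> \<tau> \<in> grp (flatb G) \<Longrightarrow>
     act (flatb G) (\<sigma> \<circ> \<tau>) = act (flatb G) \<sigma> \<circ> act (flatb G) \<tau>"
  using conical unfolding conical_space_def by auto

section \<open>Polar coordinates on the collar\<close>

lemma emb_homeo:
  "homeomorphism ({0<..<L} \<times> UNIV) (cone_upto G L) (\<lambda>(x, w). emb G x w) (cone_coords G)"
  using conical unfolding conical_space_def by auto

lemma open_cone: "open (cone_upto G L)"
  using conical unfolding conical_space_def by auto

lemma open_tip_nhd: "0 < r \<Longrightarrow> r \<le> l \<Longrightarrow> open (insert (tip G) (cone_upto G r))"
  using conical unfolding conical_space_def by auto

lemma link_cover: "(\<Union>c\<in>atlas (link G). fst c) = UNIV"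
  using conical unfolding conical_space_def oriented_riemannian_def smooth_atlas_def by auto

lemma coords_emb: "0 < x \<Longrightarrow> x < L \<Longrightarrow> cone_coords G (emb G x w) = (x, w)"
  using emb_homeo unfolding homeomorphism_def by force

lemma emb_inject: "0 < x \<Longrightarrow> x < L \<Longrightarrow> 0 < y \<Longrightarrow> y < L \<Longrightarrow> emb G x w = emb G y v \<longleftrightarrow> x = y \<and> w = v"
  using coords_emb by (metis prod.inject)

text \<open>The cone charts belong to the atlas of the regular part, whose domains avoid the
  tip.\<close>

lemma emb_not_tip: assumes "0 < x" "x < L" shows "emb G x w \<noteq> tip G"
proof -
  obtain c where c: "c \<in> atlas (link G)" "w \<in> fst c" using link_cover by blast
  then have "cone_chart G c \<in> atlas (reg G)" using conical unfolding conical_space_def by auto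
  moreover have "(\<Union>c\<in>atlas (reg G). fst c) = - {tip G}"
    using conical unfolding conical_space_def oriented_riemannian_def smooth_atlas_def by auto
  moreover have "emb G x w \<in> fst (cone_chart G c)" using assms c unfolding cone_chart_def by auto
  ultimately show ?thesis by blast
qed

lemma continuous_emb: "S \<subseteq> {0<..<L} \<times> UNIV \<Longrightarrow> continuous_on S (\<lambda>(x, w). emb G x w)"
  by (rule continuous_on_subset [OF homeomorphism_cont1 [OF emb_homeo]])

lemma continuous_coords: "S \<subseteq> cone_upto G L \<Longrightarrow> continuous_on S (cone_coords G)"
  by (rule continuous_on_subset [OF homeomorphism_cont2 [OF emb_homeo]])

lemma in_cone_upto: "r \<le> L \<Longrightarrow> 0 < x \<Longrightarrow> x < L \<Longrightarrow> emb G x w \<in> cone_upto G r \<longleftrightarrow> x < r"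
proof
  assume r: "r \<le> L" and x: "0 < x" "x < L" and "emb G x w \<in> cone_upto G r"
  then obtain y v where "0 < y" "y < r" "emb G x w = emb G y v" unfolding cone_upto_def by auto
  then show "x < r" using emb_inject [OF x, of y w v] r by auto
qed (auto simp: cone_upto_def)

lemma coords_cone_upto:
  assumes "r \<le> L" "z \<in> cone_upto G r"
  obtains x w where "z = emb G x w" "0 < x" "x < r" "x < L" "cone_coords G z = (x, w)"
proof -
  obtain x w where "z = emb G x w" "0 < x" "x < r" using assms(2) unfolding cone_upto_def by blast
  then show ?thesis using that [of x w] coords_emb [of x w] assms(1) by auto
qed

lemma interface_subset: "interface G \<subseteq> cone_upto G L"
  using len_bounds unfolding interface_def cone_upto_def by auto

lemma compact_emb: "0 < a \<Longrightarrow> b < L \<Longrightarrow> compact ((\<lambda>(x, w). emb G x w) ` ({a..b} \<times> UNIV))"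
  by (intro compact_continuous_image continuous_emb compact_Times W_top) auto

lemma closed_interface: "closed (interface G)"
proof -
  have "interface G = (\<lambda>(x, w). emb G x w) ` ({l..l} \<times> UNIV)"
    unfolding interface_def by auto
  then show ?thesis using compact_emb [of l l] len_bounds compact_imp_closed by metis
qed

lemma closed_partY: "closed (partY G)"
  using open_tip_nhd [of l] len_bounds by (simp add: partY_def closed_def)

lemma interface_partY: "interface G \<subseteq> partY G"
  using in_cone_upto [of l l] emb_not_tip [of l] len_bounds unfolding interface_def partY_def by auto

lemma coneC_partY: "insert (tip G) (coneC G) \<inter> partY G = interface G"
proof
  show "insert (tip G) (coneC G) \<inter> partY G \<subseteq> interface G"
    unfolding coneC_def partY_def interface_def cone_upto_def by force
  show "interface G \<subseteq> insert (tip G) (coneC G) \<inter> partY G"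
    using interface_partY len_bounds unfolding coneC_def interface_def by auto
qed

section \<open>Neighbourhoods of the tip\<close>

lemma connected_X: "connected (UNIV :: 'x set)"
proof -
  have c: "covering_space UNIV (cov (flatb G)) UNIV" and "path_connected (UNIV :: 'u set)"
    using cov(1) unfolding universal_covering_def by auto
  then have "connected (cov (flatb G) ` UNIV)"
    by (intro connected_continuous_image path_connected_imp_connected) (auto simp: covering_space_def)
  then show ?thesis using c by (simp add: covering_space_def)
qed

lemma connected_U: "connected (UNIV :: 'u set)"
  using cov(1) unfolding universal_covering_def by (simp add: path_connected_imp_connected)

text \<open>Points are closed, so an isolated tip would be all of the connected space
  \<open>X\<close>, which has further points on the interface.\<close>

lemma tip_not_open: "\<not> open {tip G}"
proof
  assume "open {tip G}"
  then have "{tip G} = {} \<or> {tip G} = UNIV"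
    using connected_X connected_clopen [of UNIV] by auto
  then show False using emb_not_tip [of l undefined] len_bounds by auto
qed

text \<open>A cone over the connected link that avoids the boundary of a neighbourhood of the tip cannot
  lie outside the neighbourhood, as otherwise the tip would be an isolated point.\<close>

lemma tip_nhd_basis:
  assumes V: "open V" "tip G \<in> V"
  obtains r where "0 < r" "r \<le> l" "insert (tip G) (cone_upto G r) \<subseteq> V"
proof -
  have "\<exists>U1 V1. open U1 \<and> open V1 \<and> tip G \<in> U1 \<and> y \<in> V1 \<and> U1 \<inter> V1 = {}" if "y \<noteq> tip G" for y :: 'x
    using hausdorff [of "tip G" y] that by metis
  then obtain U1 V1 where UV: "\<And>y. y \<noteq> tip G \<Longrightarrow> open (U1 y) \<and> open (V1 y) \<and> tip G \<in> U1 y \<and> y \<in> V1 y \<and> U1 y \<inter> V1 y = {}"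
    by metis
  let ?P = "partY G"
  have "tip G \<notin> ?P" by (simp add: partY_def)
  have "compact ?P" using closed_partY X_compact closed_Int_compact by (metis inf_top_right)
  moreover have UVP: "open (U1 y)" "open (V1 y)" "tip G \<in> U1 y" "y \<in> V1 y" "U1 y \<inter> V1 y = {}" if "y \<in> ?P" for y
    using UV [of y] that \<open>tip G \<notin> ?P\<close> by (cases "y = tip G"; auto)+
  then have "\<forall>y\<in>?P. open (V1 y)" "?P \<subseteq> (\<Union>y\<in>?P. V1 y)" by auto
  ultimately obtain F where F: "F \<subseteq> ?P" "finite F" "?P \<subseteq> (\<Union>y\<in>F. V1 y)"
    using compactE_image by metis
  \<comment> \<open>A neighbourhood of the tip inside \<open>V\<close> whose closure misses
    \<open>partY G\<close>: finitely many of the separating sets \<open>V1 y\<close> cover the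
    compact set, and \<open>A\<close> lies in the corresponding sets \<open>U1 y\<close>.\<close>
  define A where "A = V \<inter> insert (tip G) (cone_upto G l) \<inter> (\<Inter>y\<in>F. U1 y)"
  have "open A" unfolding A_def
    using F UVP V open_tip_nhd [of l] len_bounds by (intro open_Int open_INT) auto
  have "tip G \<in> U1 y" if "y \<in> F" for y using that F(1) UVP(3) by blast
  then have tip_A: "tip G \<in> A" unfolding A_def using V(2) by simp
  have "A \<subseteq> V" unfolding A_def by (rule order_trans [OF Int_lower1 Int_lower1])
  note A = \<open>open A\<close> tip_A \<open>A \<subseteq> V\<close>
  have "closed (- (\<Union>y\<in>F. V1 y))" using F UVP by (intro closed_Compl open_UN) auto
  moreover have "A \<subseteq> - (\<Union>y\<in>F. V1 y)"
  proof -
    have "z \<notin> V1 y" if "z \<in> A" "y \<in> F" for y z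
    proof -
      have "z \<in> U1 y" using that unfolding A_def by blast
      then show ?thesis using UVP(5) [of y] F(1) that(2) by blast
    qed
    then show ?thesis by blast
  qed
  ultimately have "closure A \<subseteq> - (\<Union>y\<in>F. V1 y)" by (rule closure_minimal [rotated])
  then have "closure A \<subseteq> - ?P" using F(3) by blast
  then have clA: "closure A \<subseteq> insert (tip G) (cone_upto G l)" by (auto simp: partY_def)
  let ?B = "closure A - A"
  have B: "?B \<subseteq> cone_upto G l" using clA A(2) by blast
  have "compact ?B"
    using X_compact A(1) by (metis closed_Int_compact closed_closure compact_diff inf_top_right)
  have up: "cone_upto G l \<subseteq> cone_upto G L" using len_bounds unfolding cone_upto_def by force
  \<comment> \<open>The least radius on the compact boundary of \<open>A\<close>, which lies in the
    open cone and stays away from the tip. If the boundary is empty, any radius up to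
    \<open>l\<close> will do.\<close>
  obtain r where r: "0 < r" "r \<le> l" "\<And>z. z \<in> ?B \<Longrightarrow> r \<le> fst (cone_coords G z)"
  proof (cases "?B = {}")
    case True then show ?thesis using that [of l] len_bounds by auto
  next
    case False
    have "continuous_on ?B (\<lambda>z. fst (cone_coords G z))"
      using B up by (intro continuous_on_fst continuous_coords) auto
    from continuous_attains_inf [OF \<open>compact ?B\<close> False this]
    obtain z where z: "z \<in> ?B" "\<And>y. y \<in> ?B \<Longrightarrow> fst (cone_coords G z) \<le> fst (cone_coords G y)" by blast
    have "z \<in> cone_upto G l" using B z(1) by blast
    then obtain x w where "0 < x" "x < l" "cone_coords G z = (x, w)"
      using coords_cone_upto [of l z] len_bounds by (metis less_imp_le)
    then show ?thesis using that [of x] z(2) by auto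
  qed
  have rL: "r \<le> L" using r(2) len_bounds by simp
  have disj: "cone_upto G r \<inter> ?B = {}"
  proof -
    have False if "z \<in> cone_upto G r" "z \<in> ?B" for z
      using coords_cone_upto [OF rL that(1)] r(3) [OF that(2)] by fastforce
    then show ?thesis by blast
  qed
  have conn: "connected (cone_upto G r)"
  proof -
    have "cone_upto G r = (\<lambda>(x, w). emb G x w) ` ({0<..<r} \<times> UNIV)" unfolding cone_upto_def by auto
    moreover have "connected ((\<lambda>(x, w). emb G x w) ` ({0<..<r} \<times> UNIV))"
      using rL by (intro connected_continuous_image continuous_emb connected_Times W_top) auto
    ultimately show ?thesis by simp
  qed
  have "cone_upto G r \<subseteq> A \<or> cone_upto G r \<inter> A = {}"
  proof -
    have "A \<inter> cone_upto G r = {} \<or> - closure A \<inter> cone_upto G r = {}"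
      using connectedD [OF conn A(1), of "- closure A"] closure_subset [of A] disj by blast
    then show ?thesis using disj by blast
  qed
  moreover have "cone_upto G r \<inter> A \<noteq> {}"
  proof
    assume "cone_upto G r \<inter> A = {}"
    then have "insert (tip G) (cone_upto G r) \<inter> A = {tip G}" using A(2) by blast
    then show False using tip_not_open open_Int [OF open_tip_nhd [OF r(1,2)] A(1)] by simp
  qed
  ultimately show ?thesis using that [OF r(1,2)] A by blast
qed

text \<open>Separate a point off the cone from the tip. Cones of small radius lie in the
  neighbourhood of the tip, so only the part between the radii \<open>r\<close> and \<open>l\<close>
  has to be avoided, and it is compact. This confines the closures of cone cells to the
  cone.\<close>

lemma closed_coneC: "closed (insert (tip G) (coneC G))"
proof -
  have "\<exists>T. open T \<and> z \<in> T \<and> T \<subseteq> - insert (tip G) (coneC G)" if z: "z \<notin> insert (tip G) (coneC G)" for z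
  proof -
    obtain U V where UV: "open U" "open V" "tip G \<in> U" "z \<in> V" "U \<inter> V = {}"
      using hausdorff [of "tip G" z] z by blast
    obtain r where r: "0 < r" "r \<le> l" "insert (tip G) (cone_upto G r) \<subseteq> U"
      using tip_nhd_basis [OF UV(1,3)] by blast
    let ?K = "(\<lambda>(x, w). emb G x w) ` ({r..l} \<times> UNIV)"
    have "closed ?K" using compact_emb [of r l] r len_bounds compact_imp_closed by blast
    moreover have "insert (tip G) (coneC G) \<subseteq> insert (tip G) (cone_upto G r) \<union> ?K"
      unfolding coneC_def cone_upto_def by force
    moreover have "?K \<subseteq> coneC G" using r unfolding coneC_def by force
    ultimately show ?thesis using UV r z by (intro exI [of _ "V - ?K"]) blast
  qed
  then have "open (- insert (tip G) (coneC G))" by (subst open_subopen) blast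
  then show ?thesis by (simp add: closed_def)
qed

text \<open>Both are lifts of the covering map to the connected covering space itself, so agreement
  at one point propagates.\<close>

lemma deck_unique:
  assumes "\<sigma> \<in> grp (flatb G)" "\<tau> \<in> grp (flatb G)" "\<sigma> u = \<tau> u"
  shows "\<sigma> = \<tau>"
proof
  fix v
  have c: "continuous_on UNIV \<sigma>" "continuous_on UNIV \<tau>" "cov (flatb G) \<circ> \<sigma> = cov (flatb G)"
    "cov (flatb G) \<circ> \<tau> = cov (flatb G)"
    using assms unfolding cov(2) deck_def homeomorphism_def by auto
  show "\<sigma> v = \<tau> v"
  proof (rule covering_lifts_agree [OF _ connected_U c(1,2)])
    show "covering_space UNIV (cov (flatb G)) UNIV" using cov(1) unfolding universal_covering_def by blast
    show "cov (flatb G) (\<sigma> x) = cov (flatb G) (\<tau> x)" for x using c(3,4) by (metis comp_apply)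
  qed (use assms in auto)
qed

lemma id_grp: "id \<in> grp (flatb G)"
proof -
  have "inv_into UNIV id = (id :: 'u \<Rightarrow> 'u)" by (rule inv_id)
  then show ?thesis unfolding cov(2) deck_def homeomorphism_def by auto
qed

lemma inv_grp: assumes "\<sigma> \<in> grp (flatb G)" shows "inv_into UNIV \<sigma> \<in> grp (flatb G)"
proof -
  have h: "homeomorphism UNIV UNIV \<sigma> (inv_into UNIV \<sigma>)" and c: "cov (flatb G) \<circ> \<sigma> = cov (flatb G)"
    using assms unfolding cov(2) deck_def by auto
  have "bij \<sigma>" using h unfolding homeomorphism_def bij_def by (metis UNIV_I injI)
  then have i: "inv_into UNIV (inv_into UNIV \<sigma>) = \<sigma>" by (rule inv_inv_eq)
  have "cov (flatb G) \<circ> inv_into UNIV \<sigma> = cov (flatb G)"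
  proof
    fix u
    have "\<sigma> (inv_into UNIV \<sigma> u) = u" using h unfolding homeomorphism_def by blast
    then show "(cov (flatb G) \<circ> inv_into UNIV \<sigma>) u = cov (flatb G) u" using c by (metis comp_apply)
  qed
  then show ?thesis using h i homeomorphism_sym unfolding cov(2) deck_def by auto
qed

text \<open>Multiplicativity makes \<open>act (flatb G) id\<close> idempotent and orthogonality
  makes it injective.\<close>

lemma act_id: "act (flatb G) id = id"
proof
  fix v
  have "act (flatb G) id (act (flatb G) id v) = act (flatb G) id v"
    using act(2) [OF id_grp id_grp] by (metis comp_apply comp_id)
  moreover have "inj (act (flatb G) id)"
    using act(1) [OF id_grp] orthogonal_transformation_inj by blast
  ultimately show "act (flatb G) id v = id v" by (simp add: inj_eq)
qed

end

section \<open>Cells of the cone\<close>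

locale cone_decomposition = cone_geometry G
  for G :: "('x::{t2_space, second_countable_topology}, 'u::topological_space,
      'w::{t2_space, second_countable_topology}, 'd::euclidean_space, 'v::euclidean_space) conical" +
  fixes K :: "('x, 'u, real \<times> 'd) decomposition"
  assumes coherent: "coherent_decomposition G K"
begin

abbreviation "MM \<equiv> cells K"
abbreviation "NN \<equiv> cells_N G K"
abbreviation "CN \<equiv> cells_CN G K"
abbreviation "KK \<equiv> cells_K G K"
abbreviation "dm \<equiv> cdim K"
abbreviation "inc \<equiv> incid K"
abbreviation "Co \<equiv> cone_cell G"

lemma decomposition:
  "finite MM" "\<Union>MM = partY G" "e \<in> MM \<Longrightarrow> is_cell TYPE(real \<times> 'd) (dm e) e"
  "e \<in> MM \<Longrightarrow> f \<in> MM \<Longrightarrow> f \<subseteq> closure e \<Longrightarrow> f \<noteq> e \<Longrightarrow> dm f < dm e"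
proof -
  have R: "regular_decomposition TYPE(real \<times> 'd) (partY G) MM dm"
    using coherent unfolding coherent_decomposition_def by (elim conjE)
  show "finite MM" using R unfolding regular_decomposition_def by (elim conjE)
  show "\<Union>MM = partY G" using R unfolding regular_decomposition_def by (elim conjE)
  have "\<forall>e\<in>MM. is_cell TYPE(real \<times> 'd) (dm e) e"
    using R unfolding regular_decomposition_def by (elim conjE)
  then show "e \<in> MM \<Longrightarrow> is_cell TYPE(real \<times> 'd) (dm e) e" by (rule bspec)
  have "\<forall>e\<in>MM. closure e = \<Union>{f \<in> MM. f \<subseteq> closure e} \<and>
        (\<forall>f\<in>MM. f \<subseteq> closure e \<and> f \<noteq> e \<longrightarrow> dm f < dm e)"
    using R unfolding regular_decomposition_def by (elim conjE)
  from bspec [OF this, THEN conjunct2]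
  show "e \<in> MM \<Longrightarrow> f \<in> MM \<Longrightarrow> f \<subseteq> closure e \<Longrightarrow> f \<noteq> e \<Longrightarrow> dm f < dm e" by simp
qed

lemma dm_tip: "dm {tip G} = 0" and dm_cone: "e \<in> NN \<Longrightarrow> dm (Co e) = dm e + 1"
  using coherent unfolding coherent_decomposition_def by auto

lemma incidence: "incidence_function KK dm inc"
  using coherent unfolding coherent_decomposition_def by blast

lemma lifts:
  "e \<in> KK \<Longrightarrow> continuous_on (closure e) (lifts K e)"
  "e \<in> KK \<Longrightarrow> x \<in> closure e \<Longrightarrow> cov (flatb G) (lifts K e x) = x"
  using coherent unfolding coherent_decomposition_def by simp_all

lemma lifts_cone:
  "e \<in> CN \<Longrightarrow> 0 < x \<Longrightarrow> x \<le> l \<Longrightarrow> emb G x w \<in> closure e \<Longrightarrow> lifts K e (emb G x w) = sec G x w"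
  using coherent unfolding coherent_decomposition_def by blast

lemma NN_MM: "NN \<subseteq> MM" and NN_interface: "e \<in> NN \<Longrightarrow> e \<subseteq> interface G"
  by (auto simp: cells_N_def)

lemma finite_cells: "finite MM" "finite NN" "finite CN" "finite KK"
  using decomposition(1) finite_subset [OF NN_MM] by (auto simp: cells_CN_def cells_K_def)

lemma inc_values:
  assumes "e \<in> KK" "f \<in> KK"
  shows "inc e f \<in> (if f \<subseteq> closure e \<and> dm e = dm f + 1 then {-1, 1} else {0})"
  using incidence assms unfolding incidence_function_def by (elim conjE) (drule (1) bspec)+

lemma inc_nonzero:
  assumes "e \<in> KK" "f \<in> KK" "inc e f \<noteq> 0"
  shows "f \<subseteq> closure e" "dm e = dm f + 1"
  using inc_values [OF assms(1,2)] assms(3) by (auto split: if_splits)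

lemma inc_face: "e \<in> KK \<Longrightarrow> f \<in> KK \<Longrightarrow> f \<subseteq> closure e \<Longrightarrow> dm e = dm f + 1 \<Longrightarrow> inc e f \<in> {-1, 1}"
  using inc_values [of e f] by simp

lemma inc_inc: "e \<in> KK \<Longrightarrow> g \<in> KK \<Longrightarrow> (\<Sum>f\<in>KK. inc e f * inc f g) = 0"
  using incidence unfolding incidence_function_def by simp

section \<open>Topology and dimension of cells\<close>

lemma cell_structure:
  assumes "e \<in> MM"
  obtains D :: "(real \<times> 'd) set" and f g where "convex D" "aff_dim D = int (dm e)"
    "homeomorphism (closure e) D f g" "f ` e = rel_interior D" "g ` rel_interior D = e"
proof -
  obtain D :: "(real \<times> 'd) set" and f g where D: "convex D" "aff_dim D = int (dm e)"
    "homeomorphism (closure e) D f g" "f ` e = rel_interior D"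
    using decomposition(3) [OF assms] unfolding is_cell_def by blast
  have "g (f x) = x" if "x \<in> e" for x
    using that closure_subset [of e] by (auto intro: homeomorphism_apply1 [OF D(3)])
  then have "g ` rel_interior D = e" unfolding D(4) [symmetric] image_image by simp
  then show ?thesis using that D by blast
qed

lemma cell_MM:
  assumes "e \<in> MM"
  shows "e \<noteq> {}" "connected e" "closure e \<subseteq> partY G" "dm e \<le> DIM(real \<times> 'd)"
proof -
  obtain D :: "(real \<times> 'd) set" and f g where D: "convex D" "aff_dim D = int (dm e)"
    "homeomorphism (closure e) D f g" "f ` e = rel_interior D" "g ` rel_interior D = e"
    using cell_structure [OF assms] by blast
  have "D \<noteq> {}" using D(2) aff_dim_empty by force
  then show "e \<noteq> {}" using D(1,4) rel_interior_eq_empty by blast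
  have "continuous_on (rel_interior D) g"
    by (rule continuous_on_subset [OF homeomorphism_cont2 [OF D(3)] rel_interior_subset])
  then have "connected (g ` rel_interior D)"
    using D(1) by (intro connected_continuous_image convex_connected convex_rel_interior)
  then show "connected e" by (simp add: D(5))
  have "e \<subseteq> partY G" using assms decomposition(2) by blast
  then show "closure e \<subseteq> partY G" using closed_partY closure_minimal by blast
  show "dm e \<le> DIM(real \<times> 'd)" using D(2) aff_dim_le_DIM [of D] by linarith
qed

lemma coords_interface: "z \<in> interface G \<Longrightarrow> emb G l (snd (cone_coords G z)) = z"
  using coords_emb len_bounds unfolding interface_def by auto

lemma continuous_snd_coords: "S \<subseteq> cone_upto G L \<Longrightarrow> continuous_on S (\<lambda>z. snd (cone_coords G z))"
  by (intro continuous_on_snd continuous_coords)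

text \<open>A cell of larger dimension would give, through a chart of the link, a continuous
  injection of a nonempty open set into a Euclidean space of smaller dimension. The bound keeps
  cones over cells of \<open>N\<close> within degree \<open>dimX G\<close>.\<close>

lemma dm_NN:
  assumes e: "e \<in> NN"
  shows "dm e \<le> DIM('d)"
proof (rule ccontr)
  assume "\<not> dm e \<le> DIM('d)"
  have eM: "e \<in> MM" and eI: "e \<subseteq> interface G" using e NN_MM NN_interface by auto
  obtain D :: "(real \<times> 'd) set" and f g where D: "convex D" "aff_dim D = int (dm e)"
    "homeomorphism (closure e) D f g" "f ` e = rel_interior D" "g ` rel_interior D = e"
    using cell_structure [OF eM] by blast
  \<comment> \<open>The dimension is then that of the ambient space, so the relative interior is
    open, as invariance of dimension requires.\<close>
  have "aff_dim D = int (DIM(real \<times> 'd))"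
    using \<open>\<not> dm e \<le> DIM('d)\<close> cell_MM(4) [OF eM] D(2) by simp
  then have ri: "rel_interior D = interior D" by (rule interior_rel_interior)
  obtain z where z: "z \<in> rel_interior D" using cell_MM(1) [OF eM] D(4) by blast
  let ?s = "\<lambda>y. snd (cone_coords G (g y))"
  obtain U \<phi> where c: "(U, \<phi>) \<in> atlas (link G)" "?s z \<in> U" using link_cover by fastforce
  have U: "open U" "homeomorphism U (\<phi> ` U) \<phi> (inv_into U \<phi>)"
    using c(1) conical unfolding conical_space_def oriented_riemannian_def smooth_atlas_def by auto
  have cg: "continuous_on (rel_interior D) g"
    by (rule continuous_on_subset [OF homeomorphism_cont2 [OF D(3)] rel_interior_subset])
  have cs: "continuous_on (rel_interior D) ?s"
  proof (rule continuous_on_compose2 [OF continuous_snd_coords cg])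
    show "interface G \<subseteq> cone_upto G L" by (rule interface_subset)
    show "g ` rel_interior D \<subseteq> interface G" using eI D(5) by simp
  qed
  let ?S = "rel_interior D \<inter> ?s -` U"
  have "open ?S"
    using cs U(1) ri by (metis continuous_open_preimage open_interior)
  moreover have "?S \<noteq> {}" using z c(2) by blast
  moreover have "continuous_on ?S (\<phi> \<circ> ?s)"
    using cs homeomorphism_cont1 [OF U(2)]
    by (intro continuous_on_compose) (auto intro: continuous_on_subset)
  moreover have "inj_on (\<phi> \<circ> ?s) ?S"
  proof (rule inj_onI)
    fix x y assume xy: "x \<in> ?S" "y \<in> ?S" "(\<phi> \<circ> ?s) x = (\<phi> \<circ> ?s) y"
    have "inj_on \<phi> U" using U(2) unfolding homeomorphism_def by (metis inj_onI)
    then have "?s x = ?s y" using xy by (auto simp: inj_on_def)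
    moreover have "g x \<in> interface G" "g y \<in> interface G" using xy D(5) eI by blast+
    ultimately have "g x = g y" using coords_interface by metis
    moreover have "f (g x) = x" "f (g y) = y"
      using xy rel_interior_subset [of D] by (auto intro: homeomorphism_apply2 [OF D(3)])
    ultimately show "x = y" by metis
  qed
  ultimately have "DIM(real \<times> 'd) \<le> DIM('d)" by (metis invariance_of_dimension)
  then show False by simp
qed

lemma closure_NN: "e \<in> NN \<Longrightarrow> closure e \<subseteq> interface G"
  using NN_interface closed_interface closure_minimal by blast

lemma cone_cell_image:
  assumes "e \<subseteq> interface G"
  shows "Co e = (\<lambda>(x, w). emb G x w) ` ({0<..<l} \<times> (\<lambda>z. snd (cone_coords G z)) ` e)"
proof
  show "Co e \<subseteq> (\<lambda>(x, w). emb G x w) ` ({0<..<l} \<times> (\<lambda>z. snd (cone_coords G z)) ` e)"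
  proof
    fix z assume "z \<in> Co e"
    then obtain x w where z: "z = emb G x w" "0 < x" "x < l" "emb G l w \<in> e"
      unfolding cone_cell_def by blast
    have "w = snd (cone_coords G (emb G l w))" using coords_emb [of l w] len_bounds by simp
    then have "w \<in> (\<lambda>z. snd (cone_coords G z)) ` e" using z(4) by (rule image_eqI)
    then show "z \<in> (\<lambda>(x, w). emb G x w) ` ({0<..<l} \<times> (\<lambda>z. snd (cone_coords G z)) ` e)"
      using z by force
  qed
  show "(\<lambda>(x, w). emb G x w) ` ({0<..<l} \<times> (\<lambda>z. snd (cone_coords G z)) ` e) \<subseteq> Co e"
    using assms coords_interface unfolding cone_cell_def by force
qed

lemma cone_cell:
  assumes e: "e \<in> NN"
  shows "Co e \<noteq> {}" "connected (Co e)" "Co e \<inter> partY G = {}"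
    "closure (Co e) \<subseteq> insert (tip G) (coneC G)" "e \<subseteq> closure (Co e)"
proof -
  have eI: "e \<subseteq> interface G" and eM: "e \<in> MM" using e NN_interface NN_MM by auto
  note im = cone_cell_image [OF eI]
  show "Co e \<noteq> {}" using cell_MM(1) [OF eM] len_bounds by (simp add: im)
  have "connected ((\<lambda>z. snd (cone_coords G z)) ` e)"
    using cell_MM(2) [OF eM] eI interface_subset
    by (intro connected_continuous_image continuous_snd_coords) auto
  then show "connected (Co e)"
    unfolding im using len_bounds
    by (intro connected_continuous_image [OF continuous_emb] connected_Times connected_Ioo) auto
  show "Co e \<inter> partY G = {}" unfolding cone_cell_def partY_def cone_upto_def by blast
  have "Co e \<subseteq> insert (tip G) (coneC G)" unfolding cone_cell_def coneC_def by force
  then show "closure (Co e) \<subseteq> insert (tip G) (coneC G)" using closed_coneC closure_minimal by blast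
  show "e \<subseteq> closure (Co e)"
  proof
    fix z assume z: "z \<in> e"
    define w where "w = snd (cone_coords G z)"
    have zw: "z = emb G l w" using coords_interface z eI unfolding w_def by auto
    have "continuous_on {0<..<L} (\<lambda>x. (x, w))" by (intro continuous_intros)
    then have "continuous_on {0<..<L} (\<lambda>x. emb G x w)"
      using continuous_on_compose2 [OF continuous_emb [OF order_refl], of "{0<..<L}" "\<lambda>x. (x, w)"] by auto
    then have "isCont (\<lambda>x. emb G x w) l"
      using len_bounds by (simp add: continuous_on_eq_continuous_at)
    then have "((\<lambda>x. emb G x w) \<longlongrightarrow> emb G l w) (at_left l)"
      unfolding isCont_def by (rule tendsto_within_subset [of _ _ _ UNIV]) simp
    moreover have "\<forall>\<^sub>F x in at_left l. emb G x w \<in> closure (Co e)"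
    proof -
      have "\<forall>\<^sub>F x in at_left l. x \<in> {0<..<l}"
        using len_bounds by (intro eventually_at_left_real) auto
      then show ?thesis
      proof (rule eventually_mono)
        fix x assume "x \<in> {0<..<l}"
        then have "emb G x w \<in> Co e" using z zw unfolding cone_cell_def by auto
        then show "emb G x w \<in> closure (Co e)" using closure_subset by blast
      qed
    qed
    ultimately have "emb G l w \<in> closure (Co e)"
      by (intro Lim_in_closed_set [OF closed_closure]) auto
    then show "z \<in> closure (Co e)" by (simp add: zw)
  qed
qed

text \<open>The radial projection \<open>?p\<close> onto the interface is continuous on the open
  collar, fixes the interface and maps \<open>Co e\<close> into \<open>e\<close>. A point of the
  interface off \<open>closure e\<close> thus has a neighbourhood that misses \<open>Co e\<close>.
  The collar beyond \<open>l\<close> makes this neighbourhood open in \<open>X\<close>.\<close>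

lemma face_cone_cell:
  assumes e: "e \<in> NN" and g: "g \<subseteq> interface G" "g \<subseteq> closure (Co e)"
  shows "g \<subseteq> closure e"
proof
  fix z assume z: "z \<in> g"
  let ?p = "\<lambda>z. emb G l (snd (cone_coords G z))"
  have eI: "e \<subseteq> interface G" using e NN_interface by auto
  have p: "continuous_on (cone_upto G L) ?p"
  proof -
    have "continuous_on (cone_upto G L) (\<lambda>z. (\<lambda>(x, w). emb G x w) (l, snd (cone_coords G z)))"
      using len_bounds
      by (intro continuous_on_compose2 [OF continuous_emb [OF order_refl]] continuous_on_Pair
          continuous_on_const continuous_snd_coords) auto
    then show ?thesis by simp
  qed
  have pc: "?p y \<in> e" if y: "y \<in> Co e" for y
  proof -
    obtain x w where y': "y = emb G x w" "0 < x" "x < l" "emb G l w \<in> e"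
      using y unfolding cone_cell_def by blast
    then show ?thesis using coords_emb [of x w] len_bounds by simp
  qed
  show "z \<in> closure e"
  proof (rule ccontr)
    assume nz: "z \<notin> closure e"
    let ?T = "cone_upto G L \<inter> ?p -` (- closure e)"
    have "open ?T" by (rule continuous_open_preimage [OF p open_cone open_Compl [OF closed_closure]])
    moreover have "z \<in> ?T" using nz z g(1) coords_interface interface_subset by auto
    ultimately have "?T \<inter> Co e \<noteq> {}"
      using z g(2) open_Int_closure_eq_empty [of ?T "Co e"] by blast
    then obtain y where "y \<in> Co e" "y \<in> ?T" by blast
    then show False using pc [of y] closure_subset [of e] by blast
  qed
qed

section \<open>Faces and incidence numbers of cone cells\<close>

lemma KK_eq: "KK = MM \<union> CN" and CN_eq: "CN = insert {tip G} (NN \<union> Co ` NN)"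
  by (simp_all add: cells_K_def cells_CN_def)

lemma tip_not_MM: "{tip G} \<notin> MM"
  using cell_MM(3) [of "{tip G}"] closure_subset by (auto simp: partY_def)

lemma cone_not_MM: "e \<in> NN \<Longrightarrow> Co e \<notin> MM"
  using cell_MM(3) [of "Co e"] cone_cell(1,3) [of e] closure_subset by blast

lemma MM_Int_CN: "MM \<inter> CN = NN"
  using NN_MM tip_not_MM cone_not_MM unfolding CN_eq by blast

lemma face_MM: assumes "e \<in> MM" "f \<in> KK" "f \<subseteq> closure e" shows "f \<in> MM"
proof -
  have "f \<subseteq> partY G" using cell_MM(3) [OF assms(1)] assms(3) by blast
  then have "f \<noteq> {tip G}" "f \<noteq> Co g" if "g \<in> NN" for g
    using cone_cell(1,3) [OF that] by (auto simp: partY_def)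
  moreover have "f \<noteq> {tip G}" using \<open>f \<subseteq> partY G\<close> by (auto simp: partY_def)
  ultimately show ?thesis using assms(2) NN_MM unfolding KK_eq CN_eq by blast
qed

lemma closure_CN: assumes "e \<in> CN" shows "closure e \<subseteq> insert (tip G) (coneC G)"
proof -
  have "closure f \<subseteq> insert (tip G) (coneC G)" if "f \<in> NN" for f
    using closure_NN [OF that] coneC_partY by blast
  then show ?thesis using assms cone_cell(4) unfolding CN_eq by auto
qed

lemma face_CN: assumes "e \<in> CN" "f \<in> KK" "f \<subseteq> closure e" shows "f \<in> CN"
proof (cases "f \<in> MM")
  case True
  then have "f \<subseteq> partY G" using cell_MM(3) closure_subset by blast
  then have "f \<subseteq> interface G" using closure_CN [OF assms(1)] assms(3) coneC_partY by blast
  then show ?thesis using True by (auto simp: cells_N_def CN_eq)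
qed (use assms KK_eq in auto)

lemma dm_KK: assumes "e \<in> KK" shows "dm e \<le> dimX G"
proof -
  have "dm e \<le> dimX G" if "e \<in> MM" for e
    using cell_MM(4) [OF that] by (simp add: dimX_def dimW_def)
  moreover have "dm (Co e) \<le> dimX G" if "e \<in> NN" for e
    using dm_NN [OF that] dm_cone [OF that] by (simp add: dimX_def dimW_def)
  ultimately show ?thesis using assms NN_MM dm_tip unfolding KK_eq CN_eq by auto
qed

lemma cell_KK: assumes "e \<in> KK" shows "e \<noteq> {}" "connected e"
proof -
  consider "e \<in> MM" | "e = {tip G}" | g where "g \<in> NN" "e = Co g"
    using assms NN_MM unfolding KK_eq CN_eq by blast
  then have "e \<noteq> {} \<and> connected e"
    by cases (use cell_MM(1,2) [of e] cone_cell(1,2) in auto)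
  then show "e \<noteq> {}" "connected e" by auto
qed

lemma inj_cone: "inj_on Co NN"
proof (rule inj_onI)
  have "e \<subseteq> f" if ef: "e \<in> NN" "f \<in> NN" "Co e = Co f" for e f
  proof
    fix z assume z: "z \<in> e"
    define w where "w = snd (cone_coords G z)"
    have zw: "z = emb G l w" using coords_interface z NN_interface [OF ef(1)] unfolding w_def by auto
    have "emb G (l / 2) w \<in> Co e"
      unfolding cone_cell_def using z zw len_bounds
      by (intro CollectI exI [of _ "l / 2"] exI [of _ w]) auto
    then obtain x v where v: "emb G (l / 2) w = emb G x v" "0 < x" "x < l" "emb G l v \<in> f"
      unfolding ef(3) unfolding cone_cell_def by blast
    then have "w = v" using emb_inject [of "l / 2" x w v] len_bounds by auto
    then show "z \<in> f" using v zw by simp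
  qed
  then show "e = f" if "e \<in> NN" "f \<in> NN" "Co e = Co f" for e f using that by (metis subset_antisym)
qed

lemma inc_cone_self: "e \<in> NN \<Longrightarrow> inc (Co e) e \<in> {-1, 1}"
  using inc_face [of "Co e" e] cone_cell(5) dm_cone NN_MM unfolding KK_eq CN_eq by auto

text \<open>Only \<open>e\<close> and \<open>Co f\<close> contribute to the coefficient of \<open>f\<close> in \<open>\<partial>\<partial>(Co e)\<close>.\<close>

lemma inc_cone_cone:
  assumes e: "e \<in> NN" and f: "f \<in> NN"
  shows "inc (Co e) (Co f) = - inc (Co f) f * inc (Co e) e * inc e f"
proof -
  have mem: "Co e \<in> KK" "Co f \<in> KK" "e \<in> KK" "f \<in> KK"
    using e f NN_MM by (auto simp: KK_eq CN_eq)
  show ?thesis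
  proof (cases "dm e = dm f + 1")
    case False
    then have "inc (Co e) (Co f) = 0" "inc e f = 0"
      using inc_nonzero(2) [OF mem(1,2)] inc_nonzero(2) [OF mem(3,4)] dm_cone [OF e] dm_cone [OF f]
      by auto
    then show ?thesis by simp
  next
    case True
    have neq: "e \<noteq> Co f" using e cone_not_MM [OF f] NN_MM by blast
    \<comment> \<open>Any other intermediate cell has the dimension of \<open>e\<close>, which is
      positive and excludes the tip. A cell of \<open>N\<close> would be a proper face of
      \<open>e\<close> of that same dimension. A cone over \<open>g\<close> would have
      \<open>g\<close> of the dimension of \<open>f\<close> with \<open>f\<close> a proper face of
      it.\<close>
    have zero: "inc (Co e) x * inc x f = 0" if x: "x \<in> KK - {e, Co f}" for x
    proof (rule ccontr)
      assume "inc (Co e) x * inc x f \<noteq> 0"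
      then have nz: "inc (Co e) x \<noteq> 0" "inc x f \<noteq> 0" by auto
      have xs: "x \<subseteq> closure (Co e)" "dm x = dm e" "f \<subseteq> closure x"
        using inc_nonzero [OF mem(1) _ nz(1)] inc_nonzero [OF _ mem(4) nz(2)] x dm_cone [OF e] by auto
      have "x \<in> CN" using face_CN [of "Co e" x] e x xs(1) by (auto simp: CN_eq)
      then consider "x = {tip G}" | "x \<in> NN" | g where "g \<in> NN" "x = Co g" unfolding CN_eq by blast
      then show False
      proof cases
        case 1 then show False using xs(2) True dm_tip by simp
      next
        case 2
        have "x \<subseteq> closure e" using face_cone_cell [OF e NN_interface [OF 2] xs(1)] .
        then have "dm x < dm e" using decomposition(4) [of e x] e 2 x NN_MM by auto
        then show False using xs(2) by simp
      next
        case 3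
        have "f \<subseteq> closure g" using face_cone_cell [OF 3(1) NN_interface [OF f]] xs(3) 3(2) by simp
        moreover have "f \<noteq> g" using 3 x by auto
        ultimately have "dm f < dm g" using decomposition(4) [of g f] f 3(1) NN_MM by auto
        then show False using xs(2) 3(2) dm_cone [OF 3(1)] True by simp
      qed
    qed
    have "0 = (\<Sum>x\<in>KK. inc (Co e) x * inc x f)" using inc_inc mem by simp
    also have "\<dots> = (\<Sum>x\<in>{e, Co f}. inc (Co e) x * inc x f)"
      using mem zero finite_cells by (intro sum.mono_neutral_right) auto
    also have "\<dots> = inc (Co e) e * inc e f + inc (Co e) (Co f) * inc (Co f) f"
      using neq by simp
    finally have eq: "inc (Co e) (Co f) * inc (Co f) f = - (inc (Co e) e * inc e f)" by simp
    show ?thesis using inc_cone_self [OF f] eq by auto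
  qed
qed

text \<open>Transitivity of the deck group on fibres matches the two lifts at one point, and
  uniqueness of lifts extends this over the connected cell \<open>f\<close>. Together with
  \<open>deck_unique\<close> this shows that the definite description in \<open>twist\<close> is
  well defined.\<close>

lemma twist:
  assumes e: "e \<in> KK" and f: "f \<in> KK" and fe: "f \<subseteq> closure e"
  shows "twist G K e f \<in> grp (flatb G)" "x \<in> f \<Longrightarrow> twist G K e f (lifts K f x) = lifts K e x"
proof -
  obtain a where a: "a \<in> f" using cell_KK(1) [OF f] by blast
  have f': "f \<subseteq> closure f" by (rule closure_subset)
  have "cov (flatb G) (lifts K f a) = cov (flatb G) (lifts K e a)"
    using lifts(2) e f a fe f' by (metis subsetD)
  then obtain \<sigma> where \<sigma>: "\<sigma> \<in> grp (flatb G)" "\<sigma> (lifts K f a) = lifts K e a"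
    using cov unfolding universal_covering_def by metis
  have c: "continuous_on UNIV \<sigma>" "cov (flatb G) \<circ> \<sigma> = cov (flatb G)"
    using \<sigma>(1) unfolding cov(2) deck_def homeomorphism_def by auto
  have agree: "\<sigma> (lifts K f x) = lifts K e x" if "x \<in> f" for x
  proof (rule covering_lifts_agree [where ?g1.0 = "\<lambda>x. \<sigma> (lifts K f x)" and ?g2.0 = "lifts K e"
        and p = "cov (flatb G)" and T = f and a = a and b = x])
    show "covering_space UNIV (cov (flatb G)) UNIV" using cov(1) unfolding universal_covering_def by blast
    show "continuous_on f (\<lambda>x. \<sigma> (lifts K f x))"
      using continuous_on_compose2 [OF c(1) continuous_on_subset [OF lifts(1) [OF f] f']] by simp
    show "continuous_on f (lifts K e)" using continuous_on_subset [OF lifts(1) [OF e] fe] .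
    show "cov (flatb G) (\<sigma> (lifts K f x)) = cov (flatb G) (lifts K e x)" if "x \<in> f" for x
      using lifts(2) [OF f, of x] lifts(2) [OF e, of x] that f' fe c(2) by (metis comp_apply subsetD)
  qed (use cell_KK(2) [OF f] a \<sigma>(2) that in auto)
  have "\<exists>!\<sigma>. \<sigma> \<in> grp (flatb G) \<and> (\<forall>x\<in>f. \<sigma> (lifts K f x) = lifts K e x)"
  proof (rule ex1I [of _ \<sigma>])
    fix \<tau> assume "\<tau> \<in> grp (flatb G) \<and> (\<forall>x\<in>f. \<tau> (lifts K f x) = lifts K e x)"
    then show "\<tau> = \<sigma>" using deck_unique [OF _ \<sigma>(1), of \<tau> "lifts K f a"] a \<sigma>(2) by auto
  qed (use \<sigma>(1) agree in blast)
  from theI' [OF this, folded twist_def]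
  show "twist G K e f \<in> grp (flatb G)" "x \<in> f \<Longrightarrow> twist G K e f (lifts K f x) = lifts K e x" by blast+
qed

text \<open>Both cells are lifted by \<open>sec\<close>, so the two lifts agree at a point of
  \<open>Co f\<close>. Boundaries among cone cells are therefore untwisted.\<close>

lemma twist_cone:
  assumes e: "e \<in> NN" and f: "f \<in> NN" and fe: "Co f \<subseteq> closure (Co e)"
  shows "twist G K (Co e) (Co f) = id"
proof -
  have mem: "Co e \<in> CN" "Co f \<in> CN" "Co e \<in> KK" "Co f \<in> KK"
    using e f by (auto simp: KK_eq CN_eq)
  obtain x w where z: "emb G x w \<in> Co f" "0 < x" "x < l"
    using cone_cell(1) [OF f] unfolding cone_cell_def by blast
  have "lifts K (Co f) (emb G x w) = sec G x w" "lifts K (Co e) (emb G x w) = sec G x w"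
    using lifts_cone [OF mem(1), of x w] lifts_cone [OF mem(2), of x w] z fe closure_subset [of "Co f"]
    by auto
  then have "twist G K (Co e) (Co f) (sec G x w) = id (sec G x w)"
    using twist(2) [OF mem(3,4) fe z(1)] by simp
  then show ?thesis using deck_unique [OF twist(1) [OF mem(3,4) fe] id_grp] by blast
qed

end

section \<open>Integral kernels and cellular bases\<close>

lemma common_denominator:
  fixes f :: "'i \<Rightarrow> rat"
  assumes "finite I"
  shows "\<exists>D>0. \<forall>i\<in>I. of_int D * f i \<in> \<int>"
  using assms
proof induction
  case empty then show ?case by (auto intro: exI [of _ 1])
next
  case (insert i I)
  then obtain D :: int where D: "D > 0" "\<forall>i\<in>I. of_int D * f i \<in> \<int>" by blast
  obtain a b where ab: "f i = Rat.Fract a b" "b > 0" by (cases "f i") auto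
  have "of_int (D * b) * f j \<in> \<int>" if "j \<in> insert i I" for j
  proof (cases "j = i")
    case True
    have "of_int b * f i = of_int a" using ab by (simp add: Fract_of_int_quotient)
    then have "of_int (D * b) * f i = of_int (D * a)" by (simp add: mult.assoc)
    then show ?thesis using True by (metis Ints_of_int)
  next
    case False
    then have "of_int D * f j \<in> \<int>" using that D(2) by blast
    then have "of_int b * (of_int D * f j) \<in> \<int>" by (rule Ints_mult [OF Ints_of_int])
    moreover have "of_int (D * b) * f j = of_int b * (of_int D * f j)" by (simp add: mult_ac)
    ultimately show ?thesis by (simp only:)
  qed
  then show ?case using D(1) ab(2) by (metis zero_less_mult_iff)
qed

interpretation rat_real: vector_space "\<lambda>(q::rat) (x::real). of_rat q * x"
  by unfold_locales (simp_all add: algebra_simps of_rat_add of_rat_mult)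

text \<open>Expanding the values of a real solution in a basis of their rational span gives rational
  solutions, which become integral after clearing denominators.\<close>

lemma integer_kernel:
  fixes A :: "'f \<Rightarrow> 'i \<Rightarrow> int" and w :: "'i \<Rightarrow> real"
  assumes I: "finite I" and w: "\<And>f. f \<in> F \<Longrightarrow> (\<Sum>i\<in>I. of_int (A f i) * w i) = 0"
  obtains R and N :: "real \<Rightarrow> 'i \<Rightarrow> int" and \<rho> :: "real \<Rightarrow> real" where "finite R"
    "\<And>b f. b \<in> R \<Longrightarrow> f \<in> F \<Longrightarrow> (\<Sum>i\<in>I. A f i * N b i) = 0"
    "\<And>i. i \<in> I \<Longrightarrow> w i = (\<Sum>b\<in>R. \<rho> b * of_int (N b i))"
    "\<And>b i. b \<in> R \<Longrightarrow> i \<in> I \<Longrightarrow> w i = 0 \<Longrightarrow> N b i = 0"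
proof -
  obtain R where R: "R \<subseteq> w ` I" "rat_real.independent R" "w ` I \<subseteq> rat_real.span R"
    using rat_real.maximal_independent_subset by blast
  have finR: "finite R" using R(1) I finite_surj by blast
  let ?r = "\<lambda>i. rat_real.representation R (w i)"
  have rep: "w i = (\<Sum>b\<in>R. of_rat (?r i b) * b)" if "i \<in> I" for i
    using rat_real.sum_representation_eq [OF R(2) _ finR order_refl, of "w i"] R(3) that by auto
  \<comment> \<open>Elements of \<open>R\<close> are rationally independent, so the real equation
    splits into one rational equation for each of them.\<close>
  have ker: "(\<Sum>i\<in>I. of_int (A f i) * ?r i b) = 0" if b: "b \<in> R" and f: "f \<in> F" for b f
  proof (rule rat_real.independentD [OF R(2) finR order_refl _ b])
    have "(\<Sum>b\<in>R. of_rat (\<Sum>i\<in>I. of_int (A f i) * ?r i b) * b)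
        = (\<Sum>b\<in>R. \<Sum>i\<in>I. of_int (A f i) * (of_rat (?r i b) * b))"
      by (simp add: of_rat_sum of_rat_mult sum_distrib_right mult.assoc)
    also have "\<dots> = (\<Sum>i\<in>I. of_int (A f i) * (\<Sum>b\<in>R. of_rat (?r i b) * b))"
      by (subst sum.swap) (simp add: sum_distrib_left)
    also have "\<dots> = (\<Sum>i\<in>I. of_int (A f i) * w i)" using rep by (intro sum.cong) auto
    also have "\<dots> = 0" using w [OF f] .
    finally show "(\<Sum>b\<in>R. of_rat (\<Sum>i\<in>I. of_int (A f i) * ?r i b) * b) = 0" .
  qed
  have "\<forall>b. \<exists>D>0. \<forall>i\<in>I. of_int D * ?r i b \<in> \<int>" by (intro allI common_denominator I)
  then obtain D :: "real \<Rightarrow> int" where D: "\<And>b. D b > 0" "\<And>b i. i \<in> I \<Longrightarrow> of_int (D b) * ?r i b \<in> \<int>"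
    by metis
  define N where "N b i = \<lfloor>of_int (D b) * ?r i b\<rfloor>" for b i
  have N: "of_int (N b i) = of_int (D b) * ?r i b" if "i \<in> I" for b i
    unfolding N_def using D(2) [OF that] by (metis Ints_cases floor_of_int)
  show ?thesis
  proof (rule that [of R N "\<lambda>b. b / of_int (D b)"])
    show "finite R" by (rule finR)
    show "(\<Sum>i\<in>I. A f i * N b i) = 0" if "b \<in> R" "f \<in> F" for b f
    proof -
      have "(of_int (\<Sum>i\<in>I. A f i * N b i) :: rat) = (\<Sum>i\<in>I. of_int (D b) * (of_int (A f i) * ?r i b))"
        using N by (simp add: mult_ac)
      also have "\<dots> = 0" using ker [OF that] by (simp add: sum_distrib_left [symmetric])
      finally show ?thesis by (simp only: of_int_eq_0_iff)
    qed
    show "w i = (\<Sum>b\<in>R. b / of_int (D b) * of_int (N b i))" if "i \<in> I" for i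
    proof -
      have "real_of_int (N b i) = of_int (D b) * of_rat (?r i b)" for b
        using arg_cong [OF N [OF that, of b], of "of_rat :: rat \<Rightarrow> real"] by (simp add: of_rat_mult)
      then have "b / of_int (D b) * of_int (N b i) = of_rat (?r i b) * b" for b
        using D(1) [of b] by simp
      then show ?thesis using rep [OF that] by simp
    qed
    \<comment> \<open>The integral solutions are supported where \<open>w\<close> is. For cycles
      this keeps them in their degree.\<close>
    show "N b i = 0" if "b \<in> R" "i \<in> I" "w i = 0" for b i
      using that by (simp add: N_def rat_real.representation_zero)
  qed
qed

section \<open>Families indexed by two lists\<close>

lemma lin_comb_concat:
  "lin_comb c (concat (map (\<lambda>x. map (F x) ys) xs)) =
     (\<Sum>i<length xs. \<Sum>j<length ys. c (i * length ys + j) *\<^sub>R F (xs ! i) (ys ! j))"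
proof (induction xs arbitrary: c)
  case Nil then show ?case by simp
next
  case (Cons x xs)
  have "lin_comb c (concat (map (\<lambda>x. map (F x) ys) (x # xs))) =
      lin_comb c (map (F x) ys) + lin_comb (\<lambda>i. c (length ys + i)) (concat (map (\<lambda>x. map (F x) ys) xs))"
    by (simp add: lin_comb_append)
  also have "lin_comb c (map (F x) ys) = (\<Sum>j<length ys. c (0 * length ys + j) *\<^sub>R F ((x # xs) ! 0) (ys ! j))"
    by (simp add: lin_comb_def)
  also have "lin_comb (\<lambda>i. c (length ys + i)) (concat (map (\<lambda>x. map (F x) ys) xs)) =
      (\<Sum>i<length xs. \<Sum>j<length ys. c (Suc i * length ys + j) *\<^sub>R F ((x # xs) ! Suc i) (ys ! j))"
    by (simp add: Cons.IH add.assoc)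
  finally show ?case by (simp only: length_Cons sum.lessThan_Suc_shift)
qed

text \<open>Passes between coefficients indexed by pairs and the list enumerating them row by row:
  position \<open>k\<close> stands for the pair \<open>k div length ys\<close>,
  \<open>k mod length ys\<close>. Applied to cells and to cycles, each paired with the vectors of
  \<open>vb\<close>.\<close>

lemma basis_mod_concat:
  assumes Z: "subspace Z" "subspace B" "B \<subseteq> Z"
    and F: "\<And>x y. x \<in> set xs \<Longrightarrow> y \<in> set ys \<Longrightarrow> F x y \<in> Z"
    and gen: "\<And>z. z \<in> Z \<Longrightarrow> \<exists>C. z - (\<Sum>i<length xs. \<Sum>j<length ys. C i j *\<^sub>R F (xs ! i) (ys ! j)) \<in> B"
    and indep: "\<And>C i j. (\<Sum>i<length xs. \<Sum>j<length ys. C i j *\<^sub>R F (xs ! i) (ys ! j)) \<in> B \<Longrightarrow>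
      i < length xs \<Longrightarrow> j < length ys \<Longrightarrow> C i j = (0 :: real)"
  shows "basis_mod Z B (concat (map (\<lambda>x. map (F x) ys) xs))"
  unfolding basis_mod_iff
proof (intro conjI ballI allI impI)
  let ?c = "concat (map (\<lambda>x. map (F x) ys) xs)"
  have len: "length ?c = length xs * length ys" by (induction xs) auto
  show "set ?c \<subseteq> Z" using F by auto
  show "\<exists>c. z - lin_comb c ?c \<in> B" if z: "z \<in> Z" for z
  proof -
    obtain C where C: "z - (\<Sum>i<length xs. \<Sum>j<length ys. C i j *\<^sub>R F (xs ! i) (ys ! j)) \<in> B"
      using gen [OF z] by blast
    have "lin_comb (\<lambda>k. C (k div length ys) (k mod length ys)) ?c
        = (\<Sum>i<length xs. \<Sum>j<length ys. C i j *\<^sub>R F (xs ! i) (ys ! j))"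
      unfolding lin_comb_concat
    proof (intro sum.cong refl)
      fix i j assume "j \<in> {..<length ys}"
      then have "j < length ys" "length ys \<noteq> 0" by (auto simp del: length_0_conv)
      then have "(i * length ys + j) div length ys = i" "(i * length ys + j) mod length ys = j"
        using div_mult_self3 [of "length ys" i j] by simp_all
      then show "C ((i * length ys + j) div length ys) ((i * length ys + j) mod length ys) *\<^sub>R F (xs ! i) (ys ! j)
          = C i j *\<^sub>R F (xs ! i) (ys ! j)" by simp
    qed
    with C show ?thesis by metis
  qed
  show "c k = 0" if c: "lin_comb c ?c \<in> B" and k: "k < length ?c" for c k
  proof -
    have ys: "length ys > 0" using k len by (cases "length ys") auto
    then have "k mod length ys < length ys" "k div length ys < length xs"
      using k len by (auto simp: less_mult_imp_div_less)
    from indep [of "\<lambda>i j. c (i * length ys + j)", OF c [unfolded lin_comb_concat] this(2,1)]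
    show ?thesis by simp
  qed
qed (use Z in auto)

context
  fixes vb :: "'v::euclidean_space list"
  assumes vb: "orthonormal_vectors vb"
begin

lemma length_vb: "length vb = DIM('v)"
  and inner_vb: "i < length vb \<Longrightarrow> j < length vb \<Longrightarrow> vb ! i \<bullet> vb ! j = (if i = j then 1 else 0)"
  using vb by (auto simp: orthonormal_vectors_def)

lemma inner_sum_vb: "k < length vb \<Longrightarrow> (\<Sum>j<length vb. c j *\<^sub>R vb ! j) \<bullet> vb ! k = c k"
  by (simp add: inner_sum_left inner_vb if_distrib cong: if_cong)

text \<open>An orthonormal list of full length spans by counting, so the remainder of the expansion,
  orthogonal to the list, is orthogonal to itself.\<close>

lemma vb_expand: "v = (\<Sum>j<length vb. (v \<bullet> vb ! j) *\<^sub>R vb ! j)"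
proof -
  let ?d = "v - (\<Sum>j<length vb. (v \<bullet> vb ! j) *\<^sub>R vb ! j)"
  have "distinct vb"
    unfolding distinct_conv_nth using inner_vb by (metis zero_neq_one)
  then have card: "card (set vb) = DIM('v)" using length_vb by (simp add: distinct_card)
  have "independent (set vb)"
  proof (rule pairwise_orthogonal_independent)
    show "pairwise real_inner_class.orthogonal (set vb)"
      using inner_vb by (auto simp: pairwise_def real_inner_class.orthogonal_def in_set_conv_nth)
    show "0 \<notin> set vb" using inner_vb by (metis in_set_conv_nth inner_zero_left zero_neq_one)
  qed
  then have span: "UNIV \<subseteq> span (set vb)"
    by (intro card_ge_dim_independent) (auto simp: card)
  have "real_inner_class.orthogonal ?d y" if y: "y \<in> set vb" for y
  proof -
    obtain k where "k < length vb" "y = vb ! k" using y by (metis in_set_conv_nth)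
    then show ?thesis using inner_sum_vb [of k] by (simp add: real_inner_class.orthogonal_def inner_diff_left)
  qed
  then have "real_inner_class.orthogonal ?d ?d" by (rule orthogonal_to_span [OF subsetD [OF span UNIV_I]])
  then show ?thesis by (simp add: real_inner_class.orthogonal_def)
qed

end

section \<open>Chains and cellular bases\<close>

lemma lookup_scaleR [simp]: "Poly_Mapping.lookup (r *\<^sub>R z) e = r *\<^sub>R Poly_Mapping.lookup z e"
proof -
  have "{e. r *\<^sub>R Poly_Mapping.lookup z e \<noteq> 0} \<subseteq> Poly_Mapping.keys z" by (auto simp: in_keys_iff)
  then have "finite {e. r *\<^sub>R Poly_Mapping.lookup z e \<noteq> 0}" using finite_keys finite_subset by blast
  then show ?thesis by (simp add: scaleR_poly_mapping_def)
qed

lemma lookup_restrict_chain: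
  "Poly_Mapping.lookup (restrict_chain A z) e = (if e \<in> A then Poly_Mapping.lookup z e else 0)"
  by (auto simp: restrict_chain_def lookup_sum lookup_single when_def in_keys_iff if_distrib cong: if_cong)

lemma linear_restrict_chain: "linear (restrict_chain A)"
  by (rule linearI; rule poly_mapping_eqI) (simp_all add: lookup_restrict_chain lookup_add)

lemma chains_iff: "z \<in> chains K A q \<longleftrightarrow> (\<forall>e. Poly_Mapping.lookup z e \<noteq> 0 \<longrightarrow> e \<in> A \<and> cdim K e = q)"
  by (auto simp: chains_def in_keys_iff)

lemma subspace_chains: "subspace (chains K A q :: ('x set \<Rightarrow>\<^sub>0 'v::real_vector) set)"
proof (rule subspaceI)
  fix x y :: "'x set \<Rightarrow>\<^sub>0 'v" assume x: "x \<in> chains K A q" and y: "y \<in> chains K A q"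
  have "Poly_Mapping.lookup x e \<noteq> 0 \<or> Poly_Mapping.lookup y e \<noteq> 0"
    if "Poly_Mapping.lookup (x + y) e \<noteq> 0" for e
    using that by (auto simp: lookup_add)
  then show "x + y \<in> chains K A q" using x y unfolding chains_iff by blast
qed (auto simp: chains_iff)

lemma chains_mono: "A \<subseteq> A' \<Longrightarrow> chains K A q \<subseteq> chains K A' q"
  unfolding chains_def by blast

lemma cell_basis_enum:
  assumes "finite A"
  obtains es where "distinct es" "set es = {e \<in> A. cdim K e = q}"
    "cell_basis K vb A q = concat (map (\<lambda>e. map (\<lambda>v. Poly_Mapping.single e v) vb) es)"
proof -
  have "\<exists>es. distinct es \<and> set es = {e \<in> A. cdim K e = q}"
    using finite_distinct_list [of "{e \<in> A. cdim K e = q}"] assms by auto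
  from someI_ex [OF this] show ?thesis
    by (intro that [of "SOME es. distinct es \<and> set es = {e \<in> A. cdim K e = q}"])
      (auto simp: cell_basis_def)
qed

text \<open>\<open>cell_basis\<close> enumerates the cells in an unspecified order, so bases for
  different sets of cells are compared as multisets. The absolute determinant is insensitive to the
  order.\<close>

lemma mset_cell_basis:
  assumes "finite A"
  shows "mset (cell_basis K vb A q) =
    (\<Sum>e\<in>{e \<in> A. cdim K e = q}. mset (map (\<lambda>v. Poly_Mapping.single e v) vb))"
proof -
  obtain es where es: "distinct es" "set es = {e \<in> A. cdim K e = q}"
    "cell_basis K vb A q = concat (map (\<lambda>e. map (\<lambda>v. Poly_Mapping.single e v) vb) es)"
    using cell_basis_enum [OF assms] by blast
  have "mset (cell_basis K vb A q) = (\<Sum>e\<leftarrow>es. mset (map (\<lambda>v. Poly_Mapping.single e v) vb))"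
    by (simp add: es(3) mset_concat comp_def)
  then show ?thesis using es by (simp add: sum_list_distinct_conv_sum_set)
qed

lemma mset_cell_basis_Un:
  assumes "finite A" "finite B" "A \<inter> B = {}"
  shows "mset (cell_basis K vb (A \<union> B) q) = mset (cell_basis K vb A q @ cell_basis K vb B q)"
proof -
  have "{e \<in> A \<union> B. cdim K e = q} = {e \<in> A. cdim K e = q} \<union> {e \<in> B. cdim K e = q}" by auto
  moreover have "{e \<in> A. cdim K e = q} \<inter> {e \<in> B. cdim K e = q} = {}" using assms(3) by auto
  ultimately show ?thesis using assms by (simp add: mset_cell_basis sum.union_disjoint)
qed

lemma lookup_sum_single:
  assumes "distinct es" "i < length es"
  shows "Poly_Mapping.lookup (\<Sum>i<length es. Poly_Mapping.single (es ! i) (g i)) (es ! i) = g i"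
proof -
  have "(\<Sum>k<length es. (g k when es ! k = es ! i)) = (\<Sum>k<length es. (g k when k = i))"
    using assms by (intro sum.cong refl) (simp add: nth_eq_iff_index_eq)
  also have "\<dots> = g i" using assms(2) by (simp add: when_def)
  finally show ?thesis by (simp add: lookup_sum lookup_single)
qed

lemma basis_mod_cell_basis:
  fixes vb :: "'v::euclidean_space list"
  assumes "orthonormal_vectors vb" and A: "finite A"
  shows "basis_mod (chains K A q) {0} (cell_basis K vb A q)"
proof -
  obtain es where es: "distinct es" "set es = {e \<in> A. cdim K e = q}"
    "cell_basis K vb A q = concat (map (\<lambda>e. map (\<lambda>v. Poly_Mapping.single e v) vb) es)"
    using cell_basis_enum [OF A] by blast
  have sum_single: "(\<Sum>j<length vb. c j *\<^sub>R Poly_Mapping.single e (vb ! j))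
      = Poly_Mapping.single e (\<Sum>j<length vb. c j *\<^sub>R vb ! j)" for c and e :: "'a set"
    by (rule poly_mapping_eqI) (simp add: lookup_sum lookup_single when_def)
  show ?thesis
    unfolding es(3)
  proof (rule basis_mod_concat)
    show "subspace (chains K A q)" by (rule subspace_chains)
    show "subspace {0}" by (rule subspace_single_0)
    show "{0} \<subseteq> chains K A q" by (simp add: chains_iff)
    show "Poly_Mapping.single x y \<in> chains K A q" if "x \<in> set es" "y \<in> set vb" for x y
      using that es(2) by (auto simp: chains_iff lookup_single when_def)
  next
    fix z :: "'a set \<Rightarrow>\<^sub>0 'v" assume z: "z \<in> chains K A q"
    let ?C = "\<lambda>i j. Poly_Mapping.lookup z (es ! i) \<bullet> vb ! j"
    have "z - (\<Sum>i<length es. \<Sum>j<length vb. ?C i j *\<^sub>R Poly_Mapping.single (es ! i) (vb ! j)) = 0"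
    proof -
      have "(\<Sum>i<length es. \<Sum>j<length vb. ?C i j *\<^sub>R Poly_Mapping.single (es ! i) (vb ! j))
          = (\<Sum>i<length es. Poly_Mapping.single (es ! i) (Poly_Mapping.lookup z (es ! i)))"
        unfolding sum_single by (simp add: vb_expand [OF assms(1), symmetric])
      also have "\<dots> = z"
      proof (rule poly_mapping_eqI)
        fix e
        show "Poly_Mapping.lookup (\<Sum>i<length es. Poly_Mapping.single (es ! i) (Poly_Mapping.lookup z (es ! i))) e
            = Poly_Mapping.lookup z e"
        proof (cases "e \<in> set es")
          case True
          then obtain i where i: "i < length es" "e = es ! i" by (metis in_set_conv_nth)
          show ?thesis unfolding i(2) by (rule lookup_sum_single [OF es(1) i(1)])
        next
          case False
          then have "Poly_Mapping.lookup z e = 0" using z es(2) by (auto simp: chains_iff)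
          moreover have "es ! i \<noteq> e" if "i < length es" for i using False that by auto
          ultimately show ?thesis by (simp add: lookup_sum lookup_single when_def)
        qed
      qed
      finally show ?thesis by simp
    qed
    then show "\<exists>C. z - (\<Sum>i<length es. \<Sum>j<length vb. C i j *\<^sub>R Poly_Mapping.single (es ! i) (vb ! j)) \<in> {0}"
      by (intro exI [of _ ?C]) simp
  next
    fix C i j assume C: "(\<Sum>i<length es. \<Sum>j<length vb. C i j *\<^sub>R Poly_Mapping.single (es ! i) (vb ! j)) \<in> {0}"
      and i: "i < length es" and j: "j < length vb"
    have "(\<Sum>j<length vb. C i j *\<^sub>R vb ! j) = 0"
      using C lookup_sum_single [OF es(1) i, of "\<lambda>i. \<Sum>j<length vb. C i j *\<^sub>R vb ! j"]
      unfolding sum_single by simp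
    then show "C i j = 0" using inner_sum_vb [OF assms(1) j, of "C i"] by simp
  qed
qed

section \<open>Intersection chains\<close>

context cone_decomposition
begin

section \<open>Coefficients of boundaries\<close>

abbreviation "lk \<equiv> Poly_Mapping.lookup"
abbreviation "transport e f \<equiv> act (flatb G) (inv_into UNIV (twist G K e f))"

text \<open>Where the incidence number is nonzero, \<open>f\<close> is a face of \<open>e\<close>
  and \<open>twist\<close> is a genuine deck transformation. Elsewhere its value may be unspecified,
  but it is multiplied by zero.\<close>

lemma linear_coefficient:
  assumes "e \<in> KK" "f \<in> KK"
  shows "linear (\<lambda>v. real_of_int (inc e f) *\<^sub>R transport e f v)"
proof (cases "inc e f = 0")
  case True then show ?thesis by (simp add: linear_zero)
next
  case False
  then have "linear (transport e f)"
    using act(1) [OF inv_grp [OF twist(1) [OF assms inc_nonzero(1) [OF assms]]]]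
    by (simp add: orthogonal_transformation_def)
  then show ?thesis by (rule linear_compose_scale_right)
qed

lemma lookup_bdry:
  "lk (bdry G K z) f =
     (if f \<in> KK then \<Sum>e\<in>KK. real_of_int (inc e f) *\<^sub>R transport e f (lk z e) else 0)"
  using finite_cells(4)
  by (simp add: bdry_def lookup_sum lookup_single when_def)

lemma linear_bdry: "linear (bdry G K)"
proof (rule linearI; rule poly_mapping_eqI)
  fix x y and f :: "'x set"
  have "real_of_int (inc e f) *\<^sub>R transport e f (lk (x + y) e)
      = real_of_int (inc e f) *\<^sub>R transport e f (lk x e) + real_of_int (inc e f) *\<^sub>R transport e f (lk y e)"
    if "e \<in> KK" "f \<in> KK" for e
    using linear_add [OF linear_coefficient [OF that]] by (simp add: lookup_add)
  then show "lk (bdry G K (x + y)) f = lk (bdry G K x + bdry G K y) f"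
    by (simp add: lookup_bdry lookup_add sum.distrib [symmetric])
next
  fix r x and f :: "'x set"
  have "real_of_int (inc e f) *\<^sub>R transport e f (lk (r *\<^sub>R x) e)
      = r *\<^sub>R (real_of_int (inc e f) *\<^sub>R transport e f (lk x e))"
    if "e \<in> KK" "f \<in> KK" for e
    using linear_cmul [OF linear_coefficient [OF that]] by simp
  then show "lk (bdry G K (r *\<^sub>R x)) f = lk (r *\<^sub>R bdry G K x) f"
    by (simp add: lookup_bdry scaleR_sum_right del: scaleR_scaleR)
qed

lemma bdry_support:
  assumes "lk (bdry G K z) f \<noteq> 0"
  obtains e where "e \<in> KK" "f \<in> KK" "lk z e \<noteq> 0" "inc e f \<noteq> 0"
proof -
  have f: "f \<in> KK" and "(\<Sum>e\<in>KK. real_of_int (inc e f) *\<^sub>R transport e f (lk z e)) \<noteq> 0"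
    using assms by (auto simp: lookup_bdry split: if_splits)
  then obtain e where e: "e \<in> KK" "real_of_int (inc e f) *\<^sub>R transport e f (lk z e) \<noteq> 0"
    by (meson sum.neutral)
  then have "lk z e \<noteq> 0" using linear_0 [OF linear_coefficient [OF e(1) f]] by metis
  then show ?thesis using that e f by auto
qed

text \<open>Subcomplexes, phrased through incidence numbers instead of closures because these are
  what \<open>bdry\<close> sees.\<close>

definition face_closed :: "'x set set \<Rightarrow> bool" where
  "face_closed B \<longleftrightarrow> B \<subseteq> KK \<and> (\<forall>e\<in>B. \<forall>f\<in>KK. inc e f \<noteq> 0 \<longrightarrow> f \<in> B)"

lemma face_closed: "face_closed MM" "face_closed KK" "face_closed CN" "face_closed NN"
proof -
  show M: "face_closed MM"
    unfolding face_closed_def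
  proof (intro conjI ballI impI)
    fix e f assume "e \<in> MM" "f \<in> KK" "inc e f \<noteq> 0"
    then show "f \<in> MM" using face_MM [of e f] inc_nonzero(1) [of e f] by (simp add: KK_eq)
  qed (simp add: KK_eq)
  show C: "face_closed CN"
    unfolding face_closed_def
  proof (intro conjI ballI impI)
    fix e f assume "e \<in> CN" "f \<in> KK" "inc e f \<noteq> 0"
    then show "f \<in> CN" using face_CN [of e f] inc_nonzero(1) [of e f] by (simp add: KK_eq)
  qed (simp add: KK_eq)
  show "face_closed KK" by (auto simp: face_closed_def)
  show "face_closed NN"
    using M C unfolding face_closed_def MM_Int_CN [symmetric] by blast
qed

lemma bdry_chains:
  assumes "face_closed B" and z: "z \<in> chains K B q" and "q \<noteq> 0"
  shows "bdry G K z \<in> chains K B (q - 1)"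
  unfolding chains_iff
proof (intro allI impI)
  fix f assume "lk (bdry G K z) f \<noteq> 0"
  then obtain e where e: "e \<in> KK" "f \<in> KK" "lk z e \<noteq> 0" "inc e f \<noteq> 0" by (rule bdry_support)
  then have "e \<in> B" "dm e = q" using z by (auto simp: chains_iff)
  then show "f \<in> B \<and> dm f = q - 1"
    using assms(1) e inc_nonzero(2) [OF e(1,2,4)] by (auto simp: face_closed_def)
qed

text \<open>Treats the whole space and the cone together: in both cases the larger set arises from
  the smaller one by adding the tip and the open cones over the cells of \<open>N\<close>.\<close>

definition filtration_pair :: "'x set set \<Rightarrow> 'x set set \<Rightarrow> bool" where
  "filtration_pair A A' \<longleftrightarrow> A = MM \<and> A' = KK \<or> A = NN \<and> A' = CN"

lemma filtration_pairD:
  assumes "filtration_pair A A'"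
  shows "A' = insert {tip G} (A \<union> Co ` NN)" "face_closed A" "face_closed A'" "NN \<subseteq> A"
    "{tip G} \<notin> A" "e \<in> NN \<Longrightarrow> Co e \<notin> A" "finite A" "finite A'"
  using assms face_closed NN_MM tip_not_MM cone_not_MM finite_cells
  unfolding filtration_pair_def KK_eq CN_eq by auto

text \<open>After rescaling the coefficient of each cone cell \<open>Co e\<close> by the sign
  \<open>inc (Co e) e\<close>, the boundary among cone cells is minus the untwisted boundary of
  \<open>N\<close>.\<close>

lemma lookup_bdry_cone:
  assumes f: "f \<in> NN"
  shows "lk (bdry G K z) (Co f) = - real_of_int (inc (Co f) f) *\<^sub>R
    (\<Sum>e\<in>NN. real_of_int (inc e f) *\<^sub>R (real_of_int (inc (Co e) e) *\<^sub>R lk z (Co e)))"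
proof -
  have fK: "Co f \<in> KK" using f by (auto simp: KK_eq CN_eq)
  have NK: "Co ` NN \<subseteq> KK" by (auto simp: KK_eq CN_eq)
  have zero: "inc e (Co f) = 0" if e: "e \<in> KK - Co ` NN" for e
  proof (rule ccontr)
    assume nz: "inc e (Co f) \<noteq> 0"
    have "e \<noteq> {tip G}" using inc_nonzero(2) [OF _ fK nz] e dm_tip by auto
    then have "e \<in> MM" using e NN_MM by (auto simp: KK_eq CN_eq)
    then show False using face_closed(1) fK nz cone_not_MM [OF f] by (auto simp: face_closed_def)
  qed
  have "lk (bdry G K z) (Co f) = (\<Sum>e\<in>KK. real_of_int (inc e (Co f)) *\<^sub>R transport e (Co f) (lk z e))"
    using fK by (simp add: lookup_bdry)
  also have "\<dots> = (\<Sum>e\<in>Co ` NN. real_of_int (inc e (Co f)) *\<^sub>R transport e (Co f) (lk z e))"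
    using zero NK finite_cells by (intro sum.mono_neutral_right) auto
  also have "\<dots> = (\<Sum>e\<in>NN. real_of_int (inc (Co e) (Co f)) *\<^sub>R transport (Co e) (Co f) (lk z (Co e)))"
    by (rule sum.reindex_cong [OF inj_cone]) auto
  also have "\<dots> = (\<Sum>e\<in>NN. (- real_of_int (inc (Co f) f) * real_of_int (inc e f) * real_of_int (inc (Co e) e)) *\<^sub>R lk z (Co e))"
  proof (rule sum.cong [OF refl])
    fix e assume e: "e \<in> NN"
    have "inc (Co e) (Co f) = 0 \<or> transport (Co e) (Co f) = id"
      using twist_cone [OF e f] inc_nonzero(1) [of "Co e" "Co f"] fK subsetD [OF NK imageI [OF e]]
      by (cases "inc (Co e) (Co f) = 0") (simp_all add: act_id inv_id)
    then have "real_of_int (inc (Co e) (Co f)) *\<^sub>R transport (Co e) (Co f) (lk z (Co e))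
        = real_of_int (inc (Co e) (Co f)) *\<^sub>R lk z (Co e)" by auto
    then show "real_of_int (inc (Co e) (Co f)) *\<^sub>R transport (Co e) (Co f) (lk z (Co e))
        = (- real_of_int (inc (Co f) f) * real_of_int (inc e f) * real_of_int (inc (Co e) e)) *\<^sub>R lk z (Co e)"
      by (simp add: inc_cone_cone [OF e f] mult_ac)
  qed
  finally show ?thesis by (simp add: scaleR_sum_right sum_negf mult.assoc)
qed

lemma bdry_cone_zero_iff:
  assumes f: "f \<in> NN"
  shows "lk (bdry G K z) (Co f) = 0 \<longleftrightarrow>
    (\<Sum>e\<in>NN. real_of_int (inc e f) *\<^sub>R (real_of_int (inc (Co e) e) *\<^sub>R lk z (Co e))) = 0"
  using inc_cone_self [OF f] unfolding lookup_bdry_cone [OF f] by auto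

text \<open>Away from the cutoff, degrees \<open>q\<close> and \<open>q - 1\<close> use the same set
  of cells, which is closed under faces, so the boundary condition is automatic.\<close>

lemma filtered_chains_other:
  assumes "filtration_pair A A'"
  shows "q < a \<Longrightarrow> filtered_chains G K A A' a q = chains K A q"
    "q > a \<Longrightarrow> filtered_chains G K A A' a q = chains K A' q"
  using bdry_chains [OF filtration_pairD(2) [OF assms]] bdry_chains [OF filtration_pairD(3) [OF assms]]
  by (auto simp: filtered_chains_def)

text \<open>At the cutoff the boundary has to lie in the smaller set. Its degree
  \<open>a - 1\<close> is positive, which excludes the tip, so the condition concerns the cone cells
  alone.\<close>

lemma filtered_chains_cutoff:
  assumes AA: "filtration_pair A A'" and a: "a \<ge> 2"
  shows "filtered_chains G K A A' a a = {z \<in> chains K A' a. \<forall>f\<in>NN. lk (bdry G K z) (Co f) = 0}"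
proof -
  note AD = filtration_pairD [OF AA]
  have "bdry G K z \<in> chains K A (a - 1) \<longleftrightarrow> (\<forall>f\<in>NN. lk (bdry G K z) (Co f) = 0)"
    if z: "z \<in> chains K A' a" for z
  proof
    assume "bdry G K z \<in> chains K A (a - 1)"
    then show "\<forall>f\<in>NN. lk (bdry G K z) (Co f) = 0" using AD(6) by (auto simp: chains_iff)
  next
    assume R: "\<forall>f\<in>NN. lk (bdry G K z) (Co f) = 0"
    have b: "bdry G K z \<in> chains K A' (a - 1)" using bdry_chains [OF AD(3) z] a by simp
    show "bdry G K z \<in> chains K A (a - 1)"
      unfolding chains_iff
    proof (intro allI impI)
      fix f assume f: "lk (bdry G K z) f \<noteq> 0"
      then have "f \<in> A'" "dm f = a - 1" using b by (auto simp: chains_iff)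
      moreover from this have "f \<noteq> {tip G}" using a dm_tip by auto
      moreover have "f \<notin> Co ` NN" using R f by auto
      ultimately show "f \<in> A \<and> dm f = a - 1" using AD(1) by auto
    qed
  qed
  then show ?thesis using a by (auto simp: filtered_chains_def)
qed

lemma lookup_cone_over:
  assumes "e \<in> NN"
  shows "lk (cone_over G K \<zeta> v) (Co e) = real_of_int (\<zeta> e * inc (Co e) e) *\<^sub>R v"
proof -
  have "(\<Sum>f\<in>NN. ((real_of_int (\<zeta> f * inc (Co f) f) *\<^sub>R v) when Co f = Co e))
      = (\<Sum>f\<in>NN. (real_of_int (\<zeta> f * inc (Co f) f) *\<^sub>R v when f = e))"
    using inj_cone assms by (intro sum.cong refl) (auto simp: inj_on_def when_def)
  also have "\<dots> = real_of_int (\<zeta> e * inc (Co e) e) *\<^sub>R v"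
    using assms finite_cells(2) by (simp add: when_def)
  finally show ?thesis by (simp add: cone_over_def lookup_sum lookup_single)
qed

lemma lookup_cone_over_other:
  assumes "x \<notin> Co ` NN" shows "lk (cone_over G K \<zeta> v) x = 0"
  unfolding cone_over_def lookup_sum lookup_single
  using assms by (intro sum.neutral) (auto simp: when_def)

section \<open>Cones over integral cycles\<close>

context
  fixes zb :: "('x set \<Rightarrow> int) list" and p :: nat
  assumes zb: "int_cycle_basis G K p zb"
begin

lemma int_cycles:
  "\<zeta> \<in> int_cycles_N G K p \<longleftrightarrow> (\<forall>e. \<zeta> e \<noteq> 0 \<longrightarrow> e \<in> NN \<and> dm e = p) \<and>
    (\<forall>f\<in>NN. (\<Sum>e\<in>NN. inc e f * \<zeta> e) = 0)"
  by (simp add: int_cycles_N_def mult.commute)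

lemma zb_cycles: "i < length zb \<Longrightarrow> zb ! i \<in> int_cycles_N G K p"
  using zb unfolding int_cycle_basis_def by auto

text \<open>A real relation is a combination of integral ones. Here \<open>integer_kernel\<close> is
  used with the unknowns indexed by the cycles in \<open>zb\<close> and the equations by the
  cells.\<close>

lemma zb_real_independent:
  assumes "\<And>e. e \<in> NN \<Longrightarrow> (\<Sum>i<length zb. r i * real_of_int ((zb ! i) e)) = 0" and k: "k < length zb"
  shows "r k = 0"
proof -
  have "(\<Sum>i\<in>{..<length zb}. real_of_int ((zb ! i) e) * r i) = 0" for e
  proof (cases "e \<in> NN")
    case True then show ?thesis using assms(1) by (simp add: mult.commute)
  next
    case False
    then have "(zb ! i) e = 0" if "i < length zb" for i using zb_cycles [OF that] int_cycles by blast
    then show ?thesis by simp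
  qed
  then obtain R and N :: "real \<Rightarrow> nat \<Rightarrow> int" and \<rho> :: "real \<Rightarrow> real" where
    "finite R"
    and N: "\<And>b f. b \<in> R \<Longrightarrow> f \<in> UNIV \<Longrightarrow> (\<Sum>i\<in>{..<length zb}. (zb ! i) f * N b i) = 0"
      "\<And>i. i \<in> {..<length zb} \<Longrightarrow> r i = (\<Sum>b\<in>R. \<rho> b * of_int (N b i))"
    and "\<And>b i. b \<in> R \<Longrightarrow> i \<in> {..<length zb} \<Longrightarrow> r i = 0 \<Longrightarrow> N b i = 0"
    using that by (rule integer_kernel [where F = UNIV and A = "\<lambda>e i. (zb ! i) e", OF finite_lessThan])
  have indep: "\<And>r. (\<forall>e. (\<Sum>i<length zb. r i * (zb ! i) e) = 0) \<Longrightarrow> \<forall>i<length zb. r i = 0"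
    using zb unfolding int_cycle_basis_def by blast
  have "N b k = 0" if "b \<in> R" for b
    using indep [of "N b"] N(1) [OF that UNIV_I] k by (simp add: mult.commute)
  then show ?thesis using N(2) k by simp
qed

text \<open>\<open>integer_kernel\<close> writes a real cycle through integral cycles with the same
  support condition; extended by zero, these expand in \<open>zb\<close>.\<close>

lemma zb_real_span:
  fixes w :: "'x set \<Rightarrow> real"
  assumes supp: "\<And>e. e \<in> NN \<Longrightarrow> w e \<noteq> 0 \<Longrightarrow> dm e = p"
    and cyc: "\<And>f. f \<in> NN \<Longrightarrow> (\<Sum>e\<in>NN. real_of_int (inc e f) * w e) = 0"
  shows "\<exists>c. \<forall>e\<in>NN. w e = (\<Sum>i<length zb. c i * real_of_int ((zb ! i) e))"
proof -
  obtain R and N :: "real \<Rightarrow> 'x set \<Rightarrow> int" and \<rho> :: "real \<Rightarrow> real" where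
    "finite R"
    and N: "\<And>b f. b \<in> R \<Longrightarrow> f \<in> NN \<Longrightarrow> (\<Sum>e\<in>NN. inc e f * N b e) = 0"
      "\<And>e. e \<in> NN \<Longrightarrow> w e = (\<Sum>b\<in>R. \<rho> b * of_int (N b e))"
      "\<And>b e. b \<in> R \<Longrightarrow> e \<in> NN \<Longrightarrow> w e = 0 \<Longrightarrow> N b e = 0"
    using cyc that by (rule integer_kernel [where A = "\<lambda>f e. inc e f" and F = NN and w = w, OF finite_cells(2)])
  have "\<exists>r. \<forall>e\<in>NN. N b e = (\<Sum>i<length zb. r i * (zb ! i) e)" if b: "b \<in> R" for b
  proof -
    let ?z = "\<lambda>e. if e \<in> NN then N b e else 0"
    have "?z \<in> int_cycles_N G K p"
      unfolding int_cycles using supp N(1,3) [OF b] by auto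
    then have "\<exists>r. \<forall>e. ?z e = (\<Sum>i<length zb. r i * (zb ! i) e)"
      using zb unfolding int_cycle_basis_def by (elim conjE) (drule (1) bspec)
    then obtain r where r: "\<forall>e. ?z e = (\<Sum>i<length zb. r i * (zb ! i) e)" by (elim exE)
    have "N b e = (\<Sum>i<length zb. r i * (zb ! i) e)" if "e \<in> NN" for e using spec [OF r, of e] that by simp
    then show ?thesis by blast
  qed
  then obtain r where r: "\<And>b e. b \<in> R \<Longrightarrow> e \<in> NN \<Longrightarrow> N b e = (\<Sum>i<length zb. r b i * (zb ! i) e)"
    by metis
  have "w e = (\<Sum>i<length zb. (\<Sum>b\<in>R. \<rho> b * of_int (r b i)) * real_of_int ((zb ! i) e))"
    if e: "e \<in> NN" for e
  proof -
    have "w e = (\<Sum>b\<in>R. \<Sum>i<length zb. \<rho> b * of_int (r b i) * real_of_int ((zb ! i) e))"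
      using N(2) [OF e] r [OF _ e] by (simp add: sum_distrib_left mult.assoc)
    then show ?thesis by (subst (asm) sum.swap) (simp add: sum_distrib_right)
  qed
  then show ?thesis by (intro exI [of _ "\<lambda>i. \<Sum>b\<in>R. \<rho> b * of_int (r b i)"] ballI)
qed

text \<open>The coefficients \<open>?w\<close> on the cone cells, rescaled by incidence signs, form
  a \<open>V\<close>-valued function on \<open>N\<close>. A chain of \<open>A'\<close> belongs to
  \<open>?Z\<close> iff \<open>?w\<close> is a cycle, and a chain in \<open>?Z\<close> belongs to
  the chains of \<open>A\<close> if \<open>?w\<close> vanishes. The components of \<open>?w\<close>
  along \<open>vb\<close> are real cycles, which are expanded in \<open>zb\<close>.\<close>

lemma basis_mod_cones:
  assumes vb: "orthonormal_vectors vb" and AA: "filtration_pair A A'" and p: "a = Suc p" "p \<noteq> 0"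
  shows "basis_mod (filtered_chains G K A A' a a) (chains K A a)
    (concat (map (\<lambda>z. map (cone_over G K z) vb) zb))"
proof -
  note AD = filtration_pairD [OF AA]
  let ?Z = "filtered_chains G K A A' a a"
  let ?w = "\<lambda>z e. real_of_int (inc (Co e) e) *\<^sub>R lk z (Co e)"
  have a2: "a \<ge> 2" using p by simp
  have Z: "z \<in> ?Z \<longleftrightarrow> z \<in> chains K A' a \<and> (\<forall>f\<in>NN. (\<Sum>e\<in>NN. real_of_int (inc e f) *\<^sub>R ?w z e) = 0)" for z
    unfolding filtered_chains_cutoff [OF AA a2] using bdry_cone_zero_iff by auto
  have sq: "real_of_int (inc (Co e) e) * real_of_int (inc (Co e) e) = 1" if "e \<in> NN" for e
    using inc_cone_self [OF that] by auto
  have w_cone: "?w (cone_over G K \<zeta> v) e = real_of_int (\<zeta> e) *\<^sub>R v" if "e \<in> NN" for \<zeta> v e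
    using sq [OF that] by (simp add: lookup_cone_over [OF that] mult_ac)
  have w_sum: "?w (\<Sum>i<length zb. \<Sum>j<length vb. C i j *\<^sub>R cone_over G K (zb ! i) (vb ! j)) e
      = (\<Sum>j<length vb. (\<Sum>i<length zb. C i j * real_of_int ((zb ! i) e)) *\<^sub>R vb ! j)" if e: "e \<in> NN" for C e
  proof -
    have "?w (\<Sum>i<length zb. \<Sum>j<length vb. C i j *\<^sub>R cone_over G K (zb ! i) (vb ! j)) e
        = (\<Sum>i<length zb. \<Sum>j<length vb. C i j *\<^sub>R ?w (cone_over G K (zb ! i) (vb ! j)) e)"
      by (simp add: lookup_sum scaleR_sum_right mult.commute)
    also have "\<dots> = (\<Sum>i<length zb. \<Sum>j<length vb. (C i j * real_of_int ((zb ! i) e)) *\<^sub>R vb ! j)"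
      by (simp only: w_cone [OF e] scaleR_scaleR)
    also have "\<dots> = (\<Sum>j<length vb. (\<Sum>i<length zb. C i j * real_of_int ((zb ! i) e)) *\<^sub>R vb ! j)"
      by (subst sum.swap) (simp add: scaleR_sum_left)
    finally show ?thesis .
  qed
  have AZ: "chains K A a \<subseteq> ?Z"
  proof
    fix z :: "'x set \<Rightarrow>\<^sub>0 'v" assume z: "z \<in> chains K A a"
    then have "lk z (Co e) = 0" if "e \<in> NN" for e using AD(6) [OF that] by (auto simp: chains_iff)
    then show "z \<in> ?Z" unfolding Z using z chains_mono [of A A' K a] AD(1) by auto
  qed
  have memA: "z \<in> chains K A a" if z: "z \<in> ?Z" and w: "\<And>e. e \<in> NN \<Longrightarrow> ?w z e = 0" for z
    unfolding chains_iff
  proof (intro allI impI)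
    fix x assume x: "lk z x \<noteq> 0"
    have xA': "x \<in> A'" "dm x = a" using x z unfolding Z chains_iff by auto
    have "x \<noteq> {tip G}" using xA'(2) dm_tip p by auto
    moreover have "x \<notin> Co ` NN"
    proof
      assume "x \<in> Co ` NN"
      then obtain e where "e \<in> NN" "x = Co e" by blast
      then show False using w [of e] inc_cone_self [of e] x by auto
    qed
    ultimately show "x \<in> A \<and> dm x = a" using xA' AD(1) by auto
  qed
  have subZ: "subspace ?Z"
  proof -
    have "?Z = chains K A' a \<inter> bdry G K -` chains K A (a - 1) \<or> ?Z = chains K A' a \<inter> bdry G K -` chains K A' (a - 1)"
      using p by (auto simp: filtered_chains_def)
    moreover have "subspace (bdry G K -` chains K B q :: ('x set \<Rightarrow>\<^sub>0 'v) set)" for B q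
      by (rule linear_subspace_vimage [OF linear_bdry subspace_chains])
    ultimately show ?thesis using subspace_inter [OF subspace_chains] by metis
  qed
  have cones: "cone_over G K \<zeta> v \<in> ?Z" if "\<zeta> \<in> set zb" for \<zeta> and v :: 'v
  proof -
    have \<zeta>: "\<zeta> \<in> int_cycles_N G K p" using zb that unfolding int_cycle_basis_def by auto
    have "cone_over G K \<zeta> v \<in> chains K A' a"
      unfolding chains_iff
    proof (intro allI impI)
      fix x assume x: "lk (cone_over G K \<zeta> v) x \<noteq> 0"
      then obtain e where e: "e \<in> NN" "x = Co e" using lookup_cone_over_other by blast
      then have "\<zeta> e \<noteq> 0" using x lookup_cone_over [OF e(1), of \<zeta> v] by auto
      then have "dm e = p" using \<zeta> int_cycles by blast
      then show "x \<in> A' \<and> dm x = a" using e dm_cone p AD(1) by auto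
    qed
    moreover have "(\<Sum>e\<in>NN. real_of_int (inc e f) *\<^sub>R ?w (cone_over G K \<zeta> v) e) = 0" if f: "f \<in> NN" for f
    proof -
      have "(\<Sum>e\<in>NN. real_of_int (inc e f) *\<^sub>R ?w (cone_over G K \<zeta> v) e)
          = real_of_int (\<Sum>e\<in>NN. inc e f * \<zeta> e) *\<^sub>R v"
        unfolding of_int_sum scaleR_sum_left by (rule sum.cong [OF refl]) (simp only: w_cone scaleR_scaleR of_int_mult)
      also have "(\<Sum>e\<in>NN. inc e f * \<zeta> e) = 0" using \<zeta> f int_cycles by blast
      finally show ?thesis by simp
    qed
    ultimately show ?thesis unfolding Z by blast
  qed
  show ?thesis
  proof (rule basis_mod_concat [OF subZ subspace_chains AZ])
    show "cone_over G K \<zeta> v \<in> ?Z" if "\<zeta> \<in> set zb" for \<zeta> and v :: 'v using cones [OF that] .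
  next
    fix z :: "'x set \<Rightarrow>\<^sub>0 'v" assume z: "z \<in> ?Z"
    have "\<exists>c. \<forall>e\<in>NN. ?w z e \<bullet> vb ! j = (\<Sum>i<length zb. c i * real_of_int ((zb ! i) e))" for j
    proof (rule zb_real_span)
      fix e assume e: "e \<in> NN" "?w z e \<bullet> vb ! j \<noteq> 0"
      then have "lk z (Co e) \<noteq> 0" by auto
      then have "dm (Co e) = a" using z unfolding Z chains_iff by blast
      then show "dm e = p" using dm_cone [OF e(1)] p by simp
    next
      fix f assume "f \<in> NN"
      then have "(\<Sum>e\<in>NN. real_of_int (inc e f) *\<^sub>R ?w z e) \<bullet> vb ! j = 0" using z unfolding Z by simp
      then show "(\<Sum>e\<in>NN. real_of_int (inc e f) * (?w z e \<bullet> vb ! j)) = 0"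
        by (simp only: inner_sum_left inner_scaleR_left)
    qed
    then have "\<forall>j. \<exists>c. \<forall>e\<in>NN. ?w z e \<bullet> vb ! j = (\<Sum>i<length zb. c i * real_of_int ((zb ! i) e))"
      by (rule allI)
    from choice [OF this] obtain c where
      c: "\<forall>j. \<forall>e\<in>NN. ?w z e \<bullet> vb ! j = (\<Sum>i<length zb. c j i * real_of_int ((zb ! i) e))"
      by (elim exE)
    let ?s = "\<Sum>i<length zb. \<Sum>j<length vb. c j i *\<^sub>R cone_over G K (zb ! i) (vb ! j)"
    have sZ: "?s \<in> ?Z"
      using cones by (intro subspace_sum [OF subZ] subspace_scale [OF subZ]) auto
    have "?w (z - ?s) e = 0" if e: "e \<in> NN" for e
    proof -
      have "?w ?s e = (\<Sum>j<length vb. (?w z e \<bullet> vb ! j) *\<^sub>R vb ! j)"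
        unfolding w_sum [OF e] using bspec [OF spec [OF c] e] by simp
      also have "\<dots> = ?w z e" by (rule vb_expand [OF vb, symmetric])
      finally show ?thesis by (auto simp: lookup_minus)
    qed
    then have "z - ?s \<in> chains K A a" by (rule memA [OF subspace_diff [OF subZ z sZ]])
    then show "\<exists>C. z - (\<Sum>i<length zb. \<Sum>j<length vb. C i j *\<^sub>R cone_over G K (zb ! i) (vb ! j)) \<in> chains K A a"
      by (intro exI [of _ "\<lambda>i j. c j i"])
  next
    fix C i j assume C: "(\<Sum>i<length zb. \<Sum>j<length vb. C i j *\<^sub>R cone_over G K (zb ! i) (vb ! j)) \<in> chains K A a"
      and i: "i < length zb" and j: "j < length vb"
    show "C i j = 0"
    proof (rule zb_real_independent [OF _ i])
      fix e assume e: "e \<in> NN"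
      have "lk (\<Sum>i<length zb. \<Sum>j<length vb. C i j *\<^sub>R cone_over G K (zb ! i) (vb ! j)) (Co e) = 0"
        using C AD(6) [OF e] unfolding chains_iff by blast
      then have "(\<Sum>j<length vb. (\<Sum>i<length zb. C i j * real_of_int ((zb ! i) e)) *\<^sub>R vb ! j) = 0"
        using w_sum [OF e, of C] by simp
      then show "(\<Sum>i<length zb. C i j * real_of_int ((zb ! i) e)) = 0"
        using inner_sum_vb [OF vb j, of "\<lambda>j. \<Sum>i<length zb. C i j * real_of_int ((zb ! i) e)"] by simp
    qed
  qed
qed

end

lemma basis_mod_filtered_basis:
  assumes vb: "orthonormal_vectors vb" and zb: "int_cycle_basis G K p zb"
    and AA: "filtration_pair A A'" and a: "a = Suc p" "p \<noteq> 0"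
  shows "basis_mod (filtered_chains G K A A' a q) {0} (filtered_basis G K vb zb A A' a q)"
proof -
  note AD = filtration_pairD [OF AA]
  consider "q < a" | "q = a" | "q > a" by linarith
  then show ?thesis
  proof cases
    case 1
    then show ?thesis
      using basis_mod_cell_basis [OF vb AD(7)] filtered_chains_other(1) [OF AA]
      by (simp add: filtered_basis_def)
  next
    case 2
    then show ?thesis
      using basis_mod_append [OF basis_mod_cell_basis [OF vb AD(7)] basis_mod_cones [OF zb vb AA a]]
      by (simp add: filtered_basis_def)
  next
    case 3
    then show ?thesis
      using basis_mod_cell_basis [OF vb AD(8)] filtered_chains_other(2) [OF AA]
      by (simp add: filtered_basis_def)
  qed
qed

lemma filtration_pairs: "filtration_pair MM KK" "filtration_pair NN CN"
  by (simp_all add: filtration_pair_def)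

text \<open>The same cones over cycles occur in the bases for the cone and for \<open>X\<close>, so
  in every degree the two differ by the cells of \<open>M\<close> off \<open>N\<close>. This yields
  determinants of absolute value 1 in the multiplicativity formula.\<close>

lemma mset_filtered_basis:
  "mset (filtered_basis G K vb zb NN CN a q @ cell_basis K vb (MM - NN) q)
    = mset (filtered_basis G K vb zb MM KK a q)"
proof -
  have fin: "finite (MM - NN)" using finite_cells(1) by simp
  have "MM = NN \<union> (MM - NN)" "KK = CN \<union> (MM - NN)"
    using NN_MM MM_Int_CN unfolding KK_eq CN_eq by blast+
  moreover have "mset (cell_basis K vb (NN \<union> (MM - NN)) q)
      = mset (cell_basis K vb NN q @ cell_basis K vb (MM - NN) q)"
    using fin finite_cells by (intro mset_cell_basis_Un) auto
  moreover have "mset (cell_basis K vb (CN \<union> (MM - NN)) q)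
      = mset (cell_basis K vb CN q @ cell_basis K vb (MM - NN) q)"
    using fin finite_cells MM_Int_CN by (intro mset_cell_basis_Un) auto
  ultimately have "mset (cell_basis K vb MM q) = mset (cell_basis K vb NN q @ cell_basis K vb (MM - NN) q)"
    "mset (cell_basis K vb KK q) = mset (cell_basis K vb CN q @ cell_basis K vb (MM - NN) q)"
    by simp_all
  then show ?thesis by (cases "q = a") (simp_all add: filtered_basis_def)
qed

text \<open>The link has positive dimension, so \<open>dimX G\<close> is at least 2, and both
  perversities are at most \<open>dimX G - 2\<close> there. The bound makes the degree of the coned
  cycles positive.\<close>

lemma cutoff_ge:
  assumes "\<pp> = lower_middle \<or> \<pp> = upper_middle"
  shows "cutoff G \<pp> \<ge> 2"
proof -
  have "dimX G \<ge> 2" using DIM_positive [where 'a = 'd] by (simp add: dimX_def dimW_def)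
  then show ?thesis
    using assms unfolding cutoff_def lower_middle_def upper_middle_def by auto
qed

section \<open>The sequence of intersection chains\<close>

lemma restrict_chain_eq_0_iff:
  "restrict_chain B z = 0 \<longleftrightarrow> (\<forall>e\<in>B. lk z e = 0)"
proof
  assume "restrict_chain B z = 0"
  then show "\<forall>e\<in>B. lk z e = 0" using lookup_restrict_chain [of B z] by (metis lookup_zero)
next
  assume "\<forall>e\<in>B. lk z e = 0"
  then show "restrict_chain B z = 0"
    by (intro poly_mapping_eqI) (simp add: lookup_restrict_chain)
qed

lemma chains_CN_eq:
  "chains K CN q = {z \<in> chains K KK q. restrict_chain (MM - NN) z = 0}"
  "chains K NN q = {z \<in> chains K MM q. restrict_chain (MM - NN) z = 0}"
proof -
  have "e \<in> CN \<longleftrightarrow> e \<in> KK \<and> e \<notin> MM - NN" for e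
    using NN_MM MM_Int_CN unfolding KK_eq by blast
  then show "chains K CN q = {z \<in> chains K KK q. restrict_chain (MM - NN) z = 0}"
    unfolding restrict_chain_eq_0_iff chains_iff set_eq_iff mem_Collect_eq by blast
  show "chains K NN q = {z \<in> chains K MM q. restrict_chain (MM - NN) z = 0}"
    unfolding restrict_chain_eq_0_iff chains_iff set_eq_iff mem_Collect_eq using NN_MM by blast
qed

text \<open>Faces of cells of the cone lie in the cone, so a chain on the cone has its boundary
  there too, and the conditions imposed on the boundary in the two complexes agree.\<close>

lemma filtered_chains_restrict:
  "filtered_chains G K NN CN a q =
    {z \<in> filtered_chains G K MM KK a q. restrict_chain (MM - NN) z = 0}"
proof -
  have *: "restrict_chain (MM - NN) (bdry G K z) = 0"
    if "z \<in> chains K (if q < a then NN else CN) q" "q \<noteq> 0" for z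
  proof -
    have "z \<in> chains K CN q"
      using that(1) chains_mono [of NN CN K q] by (auto simp: CN_eq split: if_splits)
    from bdry_chains [OF face_closed(3) this that(2)] show ?thesis unfolding chains_CN_eq by blast
  qed
  show ?thesis
    unfolding filtered_chains_def
    using * by (cases "q < a"; cases "q - 1 < a"; cases "q = 0") (auto simp: chains_CN_eq)
qed

lemma torsion_formula:
  assumes p: "\<pp> = lower_middle \<or> \<pp> = upper_middle" and vb: "orthonormal_vectors vb"
    and zb: "int_cycle_basis G K (cutoff G \<pp> - 1) zb"
    and hC: "\<And>q. homology_basis (complex_C G K \<pp>) q (hC q)"
    and hX: "\<And>q. homology_basis (complex_X G K \<pp>) q (hX q)"
    and hY: "\<And>q. homology_basis (complex_Y G K) q (hY q)"
  shows "tau_RS_X G K \<pp> vb zb hX =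
           tau_RS_C G K \<pp> vb zb hC * tau_RS_Y G K vb hY *
           R_torsion (long_exact G K \<pp>) (long_exact_basis hC hX hY) (\<lambda>_. [])"
proof -
  let ?a = "cutoff G \<pp>" and ?r = "restrict_chain (MM - NN) :: ('x set \<Rightarrow>\<^sub>0 'v) \<Rightarrow> _"
  let ?X = "filtered_chains G K MM KK ?a" and ?C = "filtered_chains G K NN CN ?a"
    and ?Y = "chains K (MM - NN) :: nat \<Rightarrow> ('x set \<Rightarrow>\<^sub>0 'v) set"
  have a: "?a = Suc (?a - 1)" "?a - 1 \<noteq> 0" using cutoff_ge [OF p] by auto
  \<comment> \<open>By \<open>hX\<close> a homology basis exists, so boundaries are cycles; in
    particular they satisfy the filtration condition.\<close>
  have bX: "bdry G K x \<in> ?X q" if "x \<in> ?X (Suc q)" for x q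
  proof -
    have "bdry G K x + 0 \<in> boundaries (complex_X G K \<pp>) q"
      unfolding boundaries_def complex_X_def using that by (auto intro!: exI)
    then show ?thesis
      using basis_modD(3) [OF hX [unfolded homology_basis_def], of q]
      by (auto simp: cycles_def complex_X_def)
  qed
  have bC: "bdry G K x \<in> ?C q" if "x \<in> ?C (Suc q)" for x q
  proof -
    have "bdry G K x + 0 \<in> boundaries (complex_C G K \<pp>) q"
      unfolding boundaries_def complex_C_def using that by (auto intro!: exI)
    then show ?thesis
      using basis_modD(3) [OF hC [unfolded homology_basis_def], of q]
      by (auto simp: cycles_def complex_C_def)
  qed
  have vX: "basis_mod (?X q) {0} (filtered_basis G K vb zb MM KK ?a q)" for q
    by (rule basis_mod_filtered_basis [OF vb zb filtration_pairs(1) a])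
  have vC: "basis_mod (?C q) {0} (filtered_basis G K vb zb NN CN ?a q)" for q
    by (rule basis_mod_filtered_basis [OF vb zb filtration_pairs(2) a])
  have vY: "basis_mod (?Y q) {0} (cell_basis K vb (MM - NN) q)" for q
    using finite_cells(1) by (intro basis_mod_cell_basis [OF vb]) auto
  interpret S: split_sequence "bdry G K" ?r ?X ?Y ?C "dimX G"
  proof (rule split_sequence.intro)
    show "linear (bdry G K)" by (rule linear_bdry)
    show "linear ?r" by (rule linear_restrict_chain)
    show "subspace (?X q)" for q by (rule basis_modD(1) [OF vX])
    show "subspace (?Y q)" for q by (rule subspace_chains)
    show "bdry G K x \<in> ?X q" if "x \<in> ?X (Suc q)" for x q by (rule bX [OF that])
    show "bdry G K x \<in> ?C q" if "x \<in> ?C (Suc q)" for x q by (rule bC [OF that])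
    show "?r x \<in> ?Y q" if "x \<in> ?X q" for x q
      using that by (auto simp: filtered_chains_def chains_iff lookup_restrict_chain)
    show "?C q = {x \<in> ?X q. ?r x = 0}" for q by (rule filtered_chains_restrict)
    show "?r y = y" if "y \<in> ?Y q" for y q
      using that by (intro poly_mapping_eqI) (auto simp: lookup_restrict_chain chains_iff)
    \<comment> \<open>A chain on cells of \<open>M\<close> has its boundary on cells of
      \<open>M\<close>, which are allowed on both sides of the cutoff.\<close>
    show "y \<in> ?X q" if y: "y \<in> ?Y q" for y q
    proof -
      have yM: "y \<in> chains K MM q" using y chains_mono [of "MM - NN" MM K q] by blast
      then have "y \<in> chains K KK q" using chains_mono [of MM KK K q] by (auto simp: KK_eq)
      moreover have "bdry G K y \<in> chains K MM (q - 1) \<and> bdry G K y \<in> chains K KK (q - 1)" if "q \<noteq> 0"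
        using bdry_chains [OF face_closed(1) yM that] chains_mono [of MM KK K "q - 1"] by (auto simp: KK_eq)
      ultimately show ?thesis using yM by (auto simp: filtered_chains_def)
    qed
    show "?X q = {0}" if q: "q > dimX G" for q
    proof -
      have "x = 0" if "x \<in> ?X q" for x
      proof (rule poly_mapping_eqI)
        fix e
        have "e \<in> KK \<and> dm e = q" if "lk x e \<noteq> 0"
          using that \<open>x \<in> ?X q\<close> by (auto simp: filtered_chains_def chains_iff KK_eq split: if_splits)
        then show "lk x e = lk 0 e" using dm_KK [of e] q by (cases "lk x e = 0") auto
      qed
      then show ?thesis using basis_modD(2,3) [OF vX [of q]] by auto
    qed
  qed
  have eq: "S.cX = complex_X G K \<pp>" "S.cC = complex_C G K \<pp>" "S.cY = complex_Y G K"
    by (simp_all add: S.cX_def S.cC_def S.cY_def complex_X_def complex_C_def complex_Y_def)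
  have les: "S.les = long_exact G K \<pp>"
    unfolding S.les_def long_exact_def eq ..
  have "\<bar>det_change {0} (filtered_basis G K vb zb NN CN ?a q @ cell_basis K vb (MM - NN) q)
      (filtered_basis G K vb zb MM KK ?a q)\<bar> = 1" for q
    using abs_det_change_mset [OF mset_filtered_basis, OF mset_eq_length [OF mset_filtered_basis]]
      det_change_same [OF vX [of q]] by simp
  from S.torsion_multiplicative [unfolded eq, OF hX hY hC vX vY vC this]
  show ?thesis by (simp add: tau_RS_X_def tau_RS_C_def tau_RS_Y_def les)
qed

end

theorem theorem21p7:
  fixes G :: "('x::{t2_space, second_countable_topology}, 'u::topological_space,
      'w::{t2_space, second_countable_topology}, 'd::euclidean_space, 'v::euclidean_space) conical"
    and K :: "('x, 'u, real \<times> 'd) decomposition"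
    and \<pp> :: "nat \<Rightarrow> nat"
    and vb :: "'v list" and zb :: "('x set \<Rightarrow> int) list"
    and aC aX aY :: "nat \<Rightarrow> ('x, 'u, real \<times> 'd, 'v) form list"
    and hC hX hY :: "nat \<Rightarrow> ('x set \<Rightarrow>\<^sub>0 'v) list"
  assumes "conical_space G"
    and "coherent_decomposition G K"
    and "\<pp> = lower_middle \<or> \<pp> = upper_middle"
    and "orthonormal_vectors vb"
    and "int_cycle_basis G K (cutoff G \<pp> - 1) zb"
    and "\<And>q. orthonormal_basis (reg G) (flatb G) (coneC G) q (harm_C G \<pp> q) (aC q)"
    and "\<And>q. orthonormal_basis (reg G) (flatb G) (pts (reg G)) q (harm_X G \<pp> q) (aX q)"
    and "\<And>q. orthonormal_basis (reg G) (flatb G) (partY G) q (harm_Y G q) (aY q)"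
    and "de_rham_basis (complex_C G K \<pp>) (de_rham_C G K \<pp>) aC hC"
    and "de_rham_basis (complex_X G K \<pp>) (de_rham_X G K \<pp>) aX hX"
    and "de_rham_basis (complex_Y G K) (de_rham_Y G K) aY hY"
  shows "tau_RS_X G K \<pp> vb zb hX =
           tau_RS_C G K \<pp> vb zb hC * tau_RS_Y G K vb hY *
           R_torsion (long_exact G K \<pp>) (long_exact_basis hC hX hY) (\<lambda>_. [])"
proof -
  interpret cone_decomposition G K
    using assms(1,2) by unfold_locales
  show ?thesis
    using assms(9-11) by (intro torsion_formula assms(3-5)) (simp_all add: de_rham_basis_def)
qed

end
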